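(* Let $\mathcal{E}=\{p_\theta:\Omega\to\mathbb{R}\mid \theta\in\mathbb{R}^n\}$ be an $n$-dimensional exponential family on a finite sample space $\Omega=\{x_0,\dots,x_m\}$ with $m+1$ elements, $p_\theta(x)=\exp\{C_0(x)+F_1(x)\theta_1+\dots+F_n(x)\theta_n-\psi(\theta)\}$, where $C_0,F_1,\dots,F_n:\Omega\to\mathbb{R}$, the functions $1,F_1,\dots,F_n$ are linearly independent, and $\psi$ is determined by $\sum_{x\in\Omega}p_\theta(x)=1$. Let $h_F$ and $\nabla^{(e)}$ be the Fisher metric and exponential connection on $\mathcal{E}$, and assume that the dually flat manifold $(\mathcal{E},h_F,\nabla^{(e)})$ is toric. Let $\Phi:\mathbb{T}^n\times N\to N$ be its regular torification, with momentum map $\mathbf{J}:N\to\mathbb{R}^n$. Suppose that $\mathcal{E}$ is full and that $\mathbf{J}$ is closed (the image of every closed set is closed). Then the difference of any two vertices of the polytope $\mathbf{J}(N)\subset\mathbb{R}^n$ lies in $4\pi\mathbb{Z}^n$.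
   Context: **Exponential family.** $\Omega$ carries the counting measure. The map $\mathbb{R}^n\to\mathcal{E}$, $\theta\mapsto p_\theta$, is bijective, and $\theta=(\theta_1,\dots,\theta_n)$ is a global coordinate system on the manifold $\mathcal{E}$. The Fisher metric is $(h_F)_{ij}(\theta)=\sum_{x\in\Omega}p_\theta(x)\,\partial_{\theta_i}\log p_\theta(x)\,\partial_{\theta_j}\log p_\theta(x)$; the exponential connection $\nabla^{(e)}$ is the flat torsion-free connection for which $\theta_1,\dots,\theta_n$ are affine coordinates. The triple $(\mathcal{E},h_F,\nabla^{(e)})$ is dually flat. **Full.** Let $\mathrm{conv}(\mathcal{E})$ be the convex hull of $\mathcal{E}$ in the vector space of real functions on $\Omega$, identified with $\mathbb{R}^{m+1}$; it lies in the hyperplane $H=\{y\in\mathbb{R}^{m+1}\mid y_1+\dots+y_{m+1}=1\}$. $\mathcal{E}$ is full if $\mathrm{conv}(\mathcal{E})$ has nonempty topological interior in $H$. **Dually flat manifold.** For a Riemannian metric $h$ and an affine connection $\nabla$ on $M$, the dual connection $\nabla^*$ is defined by $X(h(Y,Z))=h(\nabla_XY,Z)+h(Y,\nabla^*_XZ)$. $(M,h,\nabla)$ is dually flat if both $\nabla$ and $\nabla^*$ have zero curvature and zero torsion. **Dombrowski's construction.** Let $(M,h,\nabla)$ be connected, dually flat, of dimension $n$. Local affine coordinates $(x_1,\dots,x_n)$ on $M$ for $\nabla$ give coordinates $(q,r)$ on $TM$, where $(q,r)(\sum_j a_j\partial_{x_j}|_p)=(x(p),a)$. The functions $z_k=q_k+ir_k$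 form a holomorphic atlas on $TM$, and $TM$ has the Kähler metric whose matrix in the coordinates $(q,r)$ is $\mathrm{diag}(h(x),h(x))$, $h(x)$ being the matrix of $h$ in the coordinates $x$. **Parallel lattices and tubes.** A parallel lattice is a set $\mathcal{L}=\{\sum_i k_iE_i(p)\mid p\in M,\ k_i\in\mathbb{Z}\}\subset TM$, where $E=(E_1,\dots,E_n)$ is a global frame of $\nabla$-parallel vector fields ($E$ is called a generator). $\Gamma(\mathcal{L})\cong\mathbb{Z}^n$ is the group of maps $u\mapsto u+\sum_i k_iE_i$ of $TM$, $k\in\mathbb{Z}^n$; it acts freely and properly by holomorphic isometries, and $\mathrm{Tub}(\mathcal{L})=TM/\Gamma(\mathcal{L})$ has the induced Kähler structure. Let $\mathbb{T}^n=\mathbb{R}^n/\mathbb{Z}^n$. It acts on $\mathrm{Tub}(\mathcal{L})$ by $\Phi_E([t],[u])=[u+\sum_i t_iE_i]$. **Torification.** Let $N$ be a connected Kähler manifold of complex dimension $n$ with an effective holomorphic and isometric action $\Phi:\mathbb{T}^n\times N\to N$. Let $N^\circ=\{p\in N\mid \Phi(a,p)=p\Rightarrow a=e\}$ (open, connected and dense). $N$ (with $\Phi$) is a torification of $M$ if there are a parallel lattice $\mathcal{L}\subset TM$ with respect to $\nabla$, a generator $E$ of $\mathcal{L}$, and a holomorphic isometric diffeomorphism $F:\mathrm{Tub}(\mathcal{L})\to N^\circ$ with $F\circ(\Phi_E)_a=\Phi_a\circ F$ for all $a\in\mathbb{T}^n$. It is regular if $N$ is connected, simply connected, complete, with real analytic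 Kähler metric. $(M,h,\nabla)$ is toric if it has a regular torification; regular torifications of $M$ are unique up to equivariant Kähler isomorphism and reparametrization of the torus by a Lie group automorphism. **Momentum map.** The action $\Phi$ on the regular torification of $\mathcal{E}$ is Hamiltonian. Identify $\mathrm{Lie}(\mathbb{T}^n)$ with $\mathbb{R}^n$ via the derivative at $0$ of $\mathbb{R}^n\to\mathbb{R}^n/\mathbb{Z}^n$, and $\mathbb{R}^n$ with its dual via the Euclidean metric. A momentum map is a $\mathbb{T}^n$-invariant map $\mathbf{J}:N\to\mathbb{R}^n$ with $\omega(\xi_N,u)=d\mathbf{J}^\xi(u)$ for all $\xi\in\mathbb{R}^n$, $u\in TN$, where $\xi_N(p)=\frac{d}{dt}|_{0}\Phi([t\xi],p)$, $\mathbf{J}^\xi=\langle\mathbf{J},\xi\rangle$, and $\omega$ is the Kähler form, with sign convention $\omega(u,v)=g(Ju,v)$ ($g$ the metric, $J$ the complex structure). *)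

theory Defs
  imports "HOL-Analysis.Analysis"
begin

section \<open>Smooth, holomorphic and real analytic maps on open sets\<close>

primrec Ck_on :: "nat \<Rightarrow> ('a::real_normed_vector \<Rightarrow> 'b::real_normed_vector) \<Rightarrow> 'a set \<Rightarrow> bool" where
  "Ck_on 0 f S \<longleftrightarrow> continuous_on S f"
| "Ck_on (Suc k) f S \<longleftrightarrow> (\<forall>x\<in>S. f differentiable (at x)) \<and>
     (\<forall>v. Ck_on k (\<lambda>x. frechet_derivative f (at x) v) S)"

definition smooth_on :: "('a::real_normed_vector \<Rightarrow> 'b::real_normed_vector) \<Rightarrow> 'a set \<Rightarrow> bool" where
  "smooth_on f S \<longleftrightarrow> (\<forall>k. Ck_on k f S)"

definition holo_on :: "(complex^'n::finite \<Rightarrow> complex^'m::finite) \<Rightarrow> (complex^'n) set \<Rightarrow> bool" where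
  "holo_on f S \<longleftrightarrow>
     (\<forall>z\<in>S. \<exists>D. (f has_derivative D) (at z) \<and> (\<forall>c v. D (c *s v) = c *s D v))"

text \<open>The power series runs over the multi-indices supported on \<open>Basis\<close>; \<open>has_sum\<close> is
  unconditional (equivalently absolute) convergence.\<close>

definition real_analytic_on :: "('a::euclidean_space \<Rightarrow> real) \<Rightarrow> 'a set \<Rightarrow> bool" where
  "real_analytic_on f S \<longleftrightarrow>
     (\<forall>x\<in>S. \<exists>a r. 0 < r \<and>
        (\<forall>y\<in>ball x r.
           ((\<lambda>\<alpha>. a \<alpha> * (\<Prod>b\<in>Basis. ((y - x) \<bullet> b) ^ \<alpha> b)) has_sum f y)
             {\<alpha> :: 'a \<Rightarrow> nat. \<forall>b. b \<notin> Basis \<longrightarrow> \<alpha> b = 0}))"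

section \<open>Kaehler manifolds\<close>

text \<open>A manifold is a topology with an atlas of charts \<open>(U, \<phi>)\<close>, \<open>U\<close> open and \<open>\<phi>\<close> a map into
  \<open>\<complex>\<^sup>n\<close> that matters only on \<open>U\<close>.  A tangent vector at \<open>p\<close> is given by its components in a chart
  around \<open>p\<close>, and \<open>kmetric M \<phi> p v w\<close> is the Riemannian metric at \<open>p\<close> applied to the tangent
  vectors with components \<open>v\<close> and \<open>w\<close> in the chart \<open>\<phi>\<close>.  The complex structure is
  multiplication of components by \<open>\<i>\<close>.\<close>

record ('a, 'n::finite) kaehler =
  ktop :: "'a topology"
  charts :: "('a set \<times> ('a \<Rightarrow> complex^'n)) set"
  kmetric :: "('a \<Rightarrow> complex^'n) \<Rightarrow> 'a \<Rightarrow> complex^'n \<Rightarrow> complex^'n \<Rightarrow> real"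

abbreviation kspace :: "('a, 'n::finite) kaehler \<Rightarrow> 'a set" where
  "kspace M \<equiv> topspace (ktop M)"

definition complex_atlas :: "('a, 'n::finite) kaehler \<Rightarrow> bool" where
  "complex_atlas M \<longleftrightarrow>
     (\<forall>p\<in>kspace M. \<exists>(U, \<phi>)\<in>charts M. p \<in> U) \<and>
     (\<forall>(U, \<phi>)\<in>charts M. openin (ktop M) U \<and> open (\<phi> ` U) \<and>
        homeomorphic_map (subtopology (ktop M) U) (top_of_set (\<phi> ` U)) \<phi>) \<and>
     (\<forall>(U, \<phi>)\<in>charts M. \<forall>(V, \<psi>)\<in>charts M. holo_on (\<psi> \<circ> inv_into U \<phi>) (\<phi> ` (U \<inter> V)))"

text \<open>The Kaehler form \<open>\<omega>(v, w) = g(Jv, w)\<close>.\<close>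

definition kform :: "('a, 'n::finite) kaehler \<Rightarrow> ('a \<Rightarrow> complex^'n) \<Rightarrow> 'a \<Rightarrow> complex^'n \<Rightarrow> complex^'n \<Rightarrow> real" where
  "kform M \<phi> p v w = kmetric M \<phi> p (\<i> *s v) w"

definition hermitian_metric :: "('a, 'n::finite) kaehler \<Rightarrow> bool" where
  "hermitian_metric M \<longleftrightarrow>
     (\<forall>(U, \<phi>)\<in>charts M. \<forall>p\<in>U.
        bilinear (kmetric M \<phi> p) \<and>
        (\<forall>v w. kmetric M \<phi> p v w = kmetric M \<phi> p w v) \<and>
        (\<forall>v. v \<noteq> 0 \<longrightarrow> 0 < kmetric M \<phi> p v v) \<and>
        (\<forall>v w. kmetric M \<phi> p (\<i> *s v) (\<i> *s w) = kmetric M \<phi> p v w)) \<and>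
     (\<forall>(U, \<phi>)\<in>charts M. \<forall>v w. smooth_on (\<lambda>z. kmetric M \<phi> (inv_into U \<phi> z) v w) (\<phi> ` U)) \<and>
     (\<forall>(U, \<phi>)\<in>charts M. \<forall>(V, \<psi>)\<in>charts M. \<forall>p\<in>U \<inter> V. \<forall>v w.
        let T = frechet_derivative (\<psi> \<circ> inv_into U \<phi>) (at (\<phi> p))
        in kmetric M \<phi> p v w = kmetric M \<psi> p (T v) (T w))"

text \<open>\<open>d\<omega> = 0\<close>, evaluated on constant vector fields in a chart.\<close>

definition kform_closed :: "('a, 'n::finite) kaehler \<Rightarrow> bool" where
  "kform_closed M \<longleftrightarrow>
     (\<forall>(U, \<phi>)\<in>charts M. \<forall>z\<in>\<phi> ` U. \<forall>u v w.
        let \<omega> = (\<lambda>v w z. kform M \<phi> (inv_into U \<phi> z) v w)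
        in frechet_derivative (\<omega> v w) (at z) u + frechet_derivative (\<omega> w u) (at z) v
           + frechet_derivative (\<omega> u v) (at z) w = 0)"

definition kaehler_manifold :: "('a, 'n::finite) kaehler \<Rightarrow> bool" where
  "kaehler_manifold M \<longleftrightarrow>
     Hausdorff_space (ktop M) \<and> second_countable (ktop M) \<and>
     complex_atlas M \<and> hermitian_metric M \<and> kform_closed M"

definition open_submanifold :: "('a, 'n::finite) kaehler \<Rightarrow> 'a set \<Rightarrow> ('a, 'n) kaehler" where
  "open_submanifold M W =
     \<lparr>ktop = subtopology (ktop M) W,
      charts = (\<lambda>(U, \<phi>). (U \<inter> W, \<phi>)) ` charts M,
      kmetric = kmetric M\<rparr>"

definition holomorphic_map :: "('a, 'n::finite) kaehler \<Rightarrow> ('b, 'm::finite) kaehler \<Rightarrow> ('a \<Rightarrow> 'b) \<Rightarrow> bool" where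
  "holomorphic_map M N F \<longleftrightarrow>
     continuous_map (ktop M) (ktop N) F \<and>
     (\<forall>(U, \<phi>)\<in>charts M. \<forall>(V, \<psi>)\<in>charts N.
        holo_on (\<psi> \<circ> F \<circ> inv_into U \<phi>) (\<phi> ` {p \<in> U. F p \<in> V}))"

definition isometric_map :: "('a, 'n::finite) kaehler \<Rightarrow> ('b, 'm::finite) kaehler \<Rightarrow> ('a \<Rightarrow> 'b) \<Rightarrow> bool" where
  "isometric_map M N F \<longleftrightarrow>
     (\<forall>(U, \<phi>)\<in>charts M. \<forall>(V, \<psi>)\<in>charts N. \<forall>p\<in>U. F p \<in> V \<longrightarrow>
        (let D = frechet_derivative (\<psi> \<circ> F \<circ> inv_into U \<phi>) (at (\<phi> p))
         in \<forall>v w. kmetric N \<psi> (F p) (D v) (D w) = kmetric M \<phi> p v w))"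

text \<open>A holomorphic isometric diffeomorphism; its inverse is then holomorphic as well.\<close>

definition kaehler_iso :: "('a, 'n::finite) kaehler \<Rightarrow> ('b, 'n) kaehler \<Rightarrow> ('a \<Rightarrow> 'b) \<Rightarrow> bool" where
  "kaehler_iso M N F \<longleftrightarrow>
     bij_betw F (kspace M) (kspace N) \<and>
     holomorphic_map M N F \<and> holomorphic_map N M (inv_into (kspace M) F) \<and>
     isometric_map M N F"

section \<open>Simple connectedness and completeness\<close>

definition simply_connected_space :: "'a topology \<Rightarrow> bool" where
  "simply_connected_space X \<longleftrightarrow>
     path_connected_space X \<and>
     (\<forall>p q. pathin X p \<and> p 1 = p 0 \<and> pathin X q \<and> q 1 = q 0 \<longrightarrow>
        homotopic_with (\<lambda>r. r 1 = r 0) (top_of_set {0..1}) X p q)"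

text \<open>\<open>C\<^sup>1\<close> on a neighbourhood of \<open>[0,1]\<close>.  The infimum of the lengths of such curves is the same
  as for piecewise \<open>C\<^sup>1\<close> curves, which can be reparametrised to stop at their corners.\<close>

definition C1_curve :: "('a, 'n::finite) kaehler \<Rightarrow> (real \<Rightarrow> 'a) \<Rightarrow> bool" where
  "C1_curve M \<gamma> \<longleftrightarrow>
     (\<forall>t\<in>{0..1}. \<exists>(U, \<phi>)\<in>charts M. \<exists>e>0.
        \<gamma> ` ball t e \<subseteq> U \<and> (\<phi> \<circ> \<gamma>) C1_differentiable_on ball t e)"

definition speed :: "('a, 'n::finite) kaehler \<Rightarrow> (real \<Rightarrow> 'a) \<Rightarrow> real \<Rightarrow> real" where
  "speed M \<gamma> t = (THE s. \<forall>(U, \<phi>)\<in>charts M. \<gamma> t \<in> U \<longrightarrow>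
     (let v = vector_derivative (\<phi> \<circ> \<gamma>) (at t) in s = sqrt (kmetric M \<phi> (\<gamma> t) v v)))"

definition riem_dist :: "('a, 'n::finite) kaehler \<Rightarrow> 'a \<Rightarrow> 'a \<Rightarrow> real" where
  "riem_dist M p q =
     (if p \<in> kspace M \<and> q \<in> kspace M
      then Inf {integral {0..1} (speed M \<gamma>) | \<gamma>. C1_curve M \<gamma> \<and> \<gamma> 0 = p \<and> \<gamma> 1 = q} else 0)"

definition complete_manifold :: "('a, 'n::finite) kaehler \<Rightarrow> bool" where
  "complete_manifold M \<longleftrightarrow> Metric_space.mcomplete (kspace M) (riem_dist M)"

definition real_analytic_metric :: "('a, 'n::finite) kaehler \<Rightarrow> bool" where
  "real_analytic_metric M \<longleftrightarrow>
     (\<forall>(U, \<phi>)\<in>charts M. \<forall>v w. real_analytic_on (\<lambda>z. kmetric M \<phi> (inv_into U \<phi> z) v w) (\<phi> ` U))"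

section \<open>Torus actions and momentum maps\<close>

definition int_vec :: "(real^'n) set" where
  "int_vec = {k. \<forall>i. k $ i \<in> \<int>}"

text \<open>The point \<open>[t]\<close> of \<open>\<real>\<^sup>n / \<int>\<^sup>n\<close>, as a coset.\<close>

definition torus_pt :: "real^'n \<Rightarrow> (real^'n) set" where
  "torus_pt t = {t + k | k. k \<in> int_vec}"

definition torus :: "(real^'n::finite) set set" where
  "torus = range torus_pt"

text \<open>The action is jointly smooth on \<open>\<T>\<^sup>n \<times> N\<close>; smoothness is tested after composing
  with the covering \<open>\<real>\<^sup>n \<rightarrow> \<T>\<^sup>n\<close>, a local diffeomorphism.\<close>

definition kaehler_torus_action :: "('a, 'n::finite) kaehler \<Rightarrow> ((real^'n) set \<Rightarrow> 'a \<Rightarrow> 'a) \<Rightarrow> bool" where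
  "kaehler_torus_action N \<Phi> \<longleftrightarrow>
     (\<forall>p\<in>kspace N. \<Phi> (torus_pt 0) p = p) \<and>
     (\<forall>s t. \<forall>p\<in>kspace N. \<Phi> (torus_pt (s + t)) p = \<Phi> (torus_pt s) (\<Phi> (torus_pt t) p)) \<and>
     continuous_map (prod_topology euclidean (ktop N)) (ktop N) (\<lambda>(t, p). \<Phi> (torus_pt t) p) \<and>
     (\<forall>(U, \<phi>)\<in>charts N. \<forall>(V, \<psi>)\<in>charts N.
        smooth_on (\<lambda>(t, z). \<psi> (\<Phi> (torus_pt t) (inv_into U \<phi> z)))
          {(t, z). z \<in> \<phi> ` U \<and> \<Phi> (torus_pt t) (inv_into U \<phi> z) \<in> V}) \<and>
     (\<forall>a\<in>torus. holomorphic_map N N (\<Phi> a) \<and> isometric_map N N (\<Phi> a))"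

definition effective :: "('a, 'n::finite) kaehler \<Rightarrow> ((real^'n) set \<Rightarrow> 'a \<Rightarrow> 'a) \<Rightarrow> bool" where
  "effective N \<Phi> \<longleftrightarrow> (\<forall>a\<in>torus. (\<forall>p\<in>kspace N. \<Phi> a p = p) \<longrightarrow> a = torus_pt 0)"

definition free_locus :: "('a, 'n::finite) kaehler \<Rightarrow> ((real^'n) set \<Rightarrow> 'a \<Rightarrow> 'a) \<Rightarrow> 'a set" where
  "free_locus N \<Phi> = {p \<in> kspace N. \<forall>a\<in>torus. \<Phi> a p = p \<longrightarrow> a = torus_pt 0}"

definition fund_field ::
  "((real^'n::finite) set \<Rightarrow> 'a \<Rightarrow> 'a) \<Rightarrow> real^'n \<Rightarrow> ('a \<Rightarrow> complex^'n) \<Rightarrow> 'a \<Rightarrow> complex^'n" where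
  "fund_field \<Phi> \<xi> \<phi> p = vector_derivative (\<lambda>t. \<phi> (\<Phi> (torus_pt (t *\<^sub>R \<xi>)) p)) (at 0)"

definition momentum_map ::
  "('a, 'n::finite) kaehler \<Rightarrow> ((real^'n) set \<Rightarrow> 'a \<Rightarrow> 'a) \<Rightarrow> ('a \<Rightarrow> real^'n) \<Rightarrow> bool" where
  "momentum_map N \<Phi> J \<longleftrightarrow>
     (\<forall>(U, \<phi>)\<in>charts N. smooth_on (J \<circ> inv_into U \<phi>) (\<phi> ` U)) \<and>
     (\<forall>a\<in>torus. \<forall>p\<in>kspace N. J (\<Phi> a p) = J p) \<and>
     (\<forall>(U, \<phi>)\<in>charts N. \<forall>p\<in>U. \<forall>\<xi> u.
        kform N \<phi> p (fund_field \<Phi> \<xi> \<phi> p) u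
          = frechet_derivative (\<lambda>z. J (inv_into U \<phi> z) \<bullet> \<xi>) (at (\<phi> p)) u)"

section \<open>Dombrowski's construction and torifications\<close>

text \<open>The manifold \<open>M\<close> with metric \<open>h\<close> and flat connection \<open>\<nabla>\<close> is given by a bijection
  \<open>P : \<real>\<^sup>n \<rightarrow> M\<close> whose inverse is a global system of \<open>\<nabla>\<close>-affine coordinates, and by the matrix
  \<open>h\<close> of the metric as a function of these coordinates.  The pair \<open>(p, a)\<close> is the tangent vector
  \<open>\<Sum>\<^sub>j a\<^sub>j \<partial>/\<partial>x\<^sub>j\<close> at \<open>p\<close>, and a vector field is given by its component functions on \<open>M\<close>.\<close>

definition tangent_bundle :: "(real^'n \<Rightarrow> 'm) \<Rightarrow> ('m \<times> (real^'n)) set" where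
  "tangent_bundle P = range P \<times> UNIV"

text \<open>The coordinates \<open>z\<^sub>k = q\<^sub>k + \<i> r\<^sub>k\<close>.\<close>

definition tb_coord :: "(real^'n \<Rightarrow> 'm) \<Rightarrow> 'm \<times> (real^'n) \<Rightarrow> complex^'n" where
  "tb_coord P = (\<lambda>(p, a). \<chi> k. Complex (inv P p $ k) (a $ k))"

text \<open>The metric with matrix \<open>diag(h(q), h(q))\<close> in the coordinates \<open>(q, r)\<close>.\<close>

definition dombrowski_metric ::
  "(real^'n \<Rightarrow> real^'n^'n) \<Rightarrow> complex^'n \<Rightarrow> complex^'n \<Rightarrow> complex^'n \<Rightarrow> real" where
  "dombrowski_metric h z v w =
     (let re = (\<lambda>u::complex^'n. \<chi> k. Re (u $ k)); im = (\<lambda>u::complex^'n. \<chi> k. Im (u $ k))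
      in re v \<bullet> (h (re z) *v re w) + im v \<bullet> (h (re z) *v im w))"

definition dombrowski ::
  "(real^'n::finite \<Rightarrow> 'm) \<Rightarrow> (real^'n \<Rightarrow> real^'n^'n) \<Rightarrow> ('m \<times> (real^'n), 'n) kaehler" where
  "dombrowski P h =
     \<lparr>ktop = pullback_topology (tangent_bundle P) (tb_coord P) euclidean,
      charts = {(tangent_bundle P, tb_coord P)},
      kmetric = (\<lambda>\<phi> u. dombrowski_metric h (\<phi> u))\<rparr>"

text \<open>In affine coordinates the Christoffel symbols vanish, so the covariant derivative of a
  vector field differentiates its components.\<close>

definition cov_deriv :: "(real^'n::finite \<Rightarrow> 'm) \<Rightarrow> ('m \<Rightarrow> real^'n) \<Rightarrow> real^'n \<Rightarrow> real^'n \<Rightarrow> real^'n" where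
  "cov_deriv P Y x v = frechet_derivative (Y \<circ> P) (at x) v"

definition parallel_field :: "(real^'n::finite \<Rightarrow> 'm) \<Rightarrow> ('m \<Rightarrow> real^'n) \<Rightarrow> bool" where
  "parallel_field P Y \<longleftrightarrow> smooth_on (Y \<circ> P) UNIV \<and> (\<forall>x v. cov_deriv P Y x v = 0)"

definition parallel_frame :: "(real^'n::finite \<Rightarrow> 'm) \<Rightarrow> ('n \<Rightarrow> 'm \<Rightarrow> real^'n) \<Rightarrow> bool" where
  "parallel_frame P E \<longleftrightarrow>
     (\<forall>i. parallel_field P (E i)) \<and>
     (\<forall>p\<in>range P. \<forall>c. (\<Sum>i\<in>UNIV. c i *\<^sub>R E i p) = 0 \<longrightarrow> (\<forall>i. c i = 0))"

definition lattice_generator ::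
  "(real^'n::finite \<Rightarrow> 'm) \<Rightarrow> ('n \<Rightarrow> 'm \<Rightarrow> real^'n) \<Rightarrow> ('m \<times> (real^'n)) set \<Rightarrow> bool" where
  "lattice_generator P E L \<longleftrightarrow> parallel_frame P E \<and>
     L = {(p, \<Sum>i\<in>UNIV. of_int (k i) *\<^sub>R E i p) | p k. p \<in> range P}"

definition parallel_lattice :: "(real^'n::finite \<Rightarrow> 'm) \<Rightarrow> ('m \<times> (real^'n)) set \<Rightarrow> bool" where
  "parallel_lattice P L \<longleftrightarrow> (\<exists>E. lattice_generator P E L)"

text \<open>The orbit of a tangent vector under the translations \<open>\<Gamma>(L)\<close>.\<close>

definition lattice_orbit :: "('m \<times> (real^'n)) set \<Rightarrow> 'm \<times> (real^'n) \<Rightarrow> ('m \<times> (real^'n)) set" where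
  "lattice_orbit L = (\<lambda>(p, a). {(p, a + l) | l. (p, l) \<in> L})"

text \<open>The quotient of \<open>TM\<close> by \<open>\<Gamma>(L)\<close>: quotient topology, charts the local inverses of the
  projection followed by the coordinates \<open>z\<close>, and the induced metric.\<close>

definition tube ::
  "(real^'n::finite \<Rightarrow> 'm) \<Rightarrow> (real^'n \<Rightarrow> real^'n^'n) \<Rightarrow> ('m \<times> (real^'n)) set
     \<Rightarrow> (('m \<times> (real^'n)) set, 'n) kaehler" where
  "tube P h L =
     \<lparr>ktop = topology (\<lambda>W. W \<subseteq> lattice_orbit L ` tangent_bundle P \<and>
          openin (ktop (dombrowski P h)) {u \<in> tangent_bundle P. lattice_orbit L u \<in> W}),
      charts = {(lattice_orbit L ` V, tb_coord P \<circ> inv_into V (lattice_orbit L)) | V.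
          openin (ktop (dombrowski P h)) V \<and> inj_on (lattice_orbit L) V},
      kmetric = (\<lambda>\<phi> c. dombrowski_metric h (\<phi> c))\<rparr>"

lemma openin_tube:
  "openin (ktop (tube P h L)) W \<longleftrightarrow> W \<subseteq> lattice_orbit L ` tangent_bundle P \<and>
     openin (ktop (dombrowski P h)) {u \<in> tangent_bundle P. lattice_orbit L u \<in> W}"
proof -
  have "istopology (\<lambda>W. W \<subseteq> lattice_orbit L ` tangent_bundle P \<and>
     openin (ktop (dombrowski P h)) {u \<in> tangent_bundle P. lattice_orbit L u \<in> W})"
    (is "istopology (\<lambda>W. W \<subseteq> ?A \<and> openin ?X (?f W))")
    unfolding istopology_def
  proof (intro conjI allI impI)
    fix S T assume S: "S \<subseteq> ?A \<and> openin ?X (?f S)" and T: "T \<subseteq> ?A \<and> openin ?X (?f T)"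
    show "S \<inter> T \<subseteq> ?A" using S by blast
    have "?f (S \<inter> T) = ?f S \<inter> ?f T" by blast
    then show "openin ?X (?f (S \<inter> T))" using S T by auto
  next
    fix K assume K: "\<forall>W\<in>K. W \<subseteq> ?A \<and> openin ?X (?f W)"
    show "\<Union>K \<subseteq> ?A" using K by blast
    have "?f (\<Union>K) = \<Union>(?f ` K)" by blast
    then show "openin ?X (?f (\<Union>K))" using K by auto
  qed
  then show ?thesis by (simp add: tube_def topology_inverse')
qed

text \<open>\<open>([t], [u]) \<mapsto> [u + \<Sum>\<^sub>i t\<^sub>i E\<^sub>i]\<close>; on a coset and an orbit of \<open>\<Gamma>(L)\<close> the set of all sums
  of representatives is exactly this orbit.\<close>

definition tube_action ::
  "('n::finite \<Rightarrow> 'm \<Rightarrow> real^'n) \<Rightarrow> (real^'n) set \<Rightarrow> ('m \<times> (real^'n)) set \<Rightarrow> ('m \<times> (real^'n)) set" where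
  "tube_action E a c = {(p, u + (\<Sum>i\<in>UNIV. t $ i *\<^sub>R E i p)) | p u t. (p, u) \<in> c \<and> t \<in> a}"

definition torification ::
  "(real^'n::finite \<Rightarrow> 'm) \<Rightarrow> (real^'n \<Rightarrow> real^'n^'n) \<Rightarrow> ('a, 'n) kaehler
     \<Rightarrow> ((real^'n) set \<Rightarrow> 'a \<Rightarrow> 'a) \<Rightarrow> bool" where
  "torification P h N \<Phi> \<longleftrightarrow>
     kaehler_manifold N \<and> connected_space (ktop N) \<and>
     kaehler_torus_action N \<Phi> \<and> effective N \<Phi> \<and>
     (\<exists>L E F. parallel_lattice P L \<and> lattice_generator P E L \<and>
        kaehler_iso (tube P h L) (open_submanifold N (free_locus N \<Phi>)) F \<and>
        (\<forall>a\<in>torus. \<forall>c\<in>kspace (tube P h L). F (tube_action E a c) = \<Phi> a (F c)))"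

definition regular_torification ::
  "(real^'n::finite \<Rightarrow> 'm) \<Rightarrow> (real^'n \<Rightarrow> real^'n^'n) \<Rightarrow> ('a, 'n) kaehler
     \<Rightarrow> ((real^'n) set \<Rightarrow> 'a \<Rightarrow> 'a) \<Rightarrow> bool" where
  "regular_torification P h N \<Phi> \<longleftrightarrow> torification P h N \<Phi> \<and>
     simply_connected_space (ktop N) \<and> complete_manifold N \<and> real_analytic_metric N"

section \<open>Exponential families\<close>

text \<open>Functions on the finite sample space \<open>'x\<close> are vectors in \<open>real^'x\<close>.\<close>

definition exp_family ::
  "('x::finite \<Rightarrow> real) \<Rightarrow> ('n::finite \<Rightarrow> 'x \<Rightarrow> real) \<Rightarrow> (real^'n \<Rightarrow> real) \<Rightarrow> real^'n \<Rightarrow> real^'x" where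
  "exp_family C F \<psi> \<theta> = (\<chi> x. exp (C x + (\<Sum>i\<in>UNIV. F i x * \<theta> $ i) - \<psi> \<theta>))"

definition lin_indep_with_1 :: "('n::finite \<Rightarrow> 'x \<Rightarrow> real) \<Rightarrow> bool" where
  "lin_indep_with_1 F \<longleftrightarrow>
     (\<forall>a b. (\<forall>x. a + (\<Sum>i\<in>UNIV. b i * F i x) = 0) \<longrightarrow> a = 0 \<and> (\<forall>i. b i = 0))"

definition fisher :: "(real^'n::finite \<Rightarrow> real^'x::finite) \<Rightarrow> real^'n \<Rightarrow> real^'n^'n" where
  "fisher p \<theta> = (\<chi> i j. \<Sum>x\<in>UNIV. p \<theta> $ x
     * frechet_derivative (\<lambda>\<theta>. ln (p \<theta> $ x)) (at \<theta>) (axis i 1)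
     * frechet_derivative (\<lambda>\<theta>. ln (p \<theta> $ x)) (at \<theta>) (axis j 1))"

definition full_family :: "(real^'x::finite) set \<Rightarrow> bool" where
  "full_family \<E> \<longleftrightarrow> (top_of_set {y. (\<Sum>x\<in>UNIV. y $ x) = 1}) interior_of (convex hull \<E>) \<noteq> {}"

end

theory Submission
  imports Defs "HOL-Complex_Analysis.Conformal_Mappings"
begin

text \<open>
  In the affine coordinates \<open>\<theta>\<close> the tangent bundle is complex \<open>n\<close>-space with \<open>z = \<theta> + \<i> r\<close>, the parallel
  frame is a constant basis \<open>e\<close>, and the free locus of the torus action is the quotient by the lattice
  spanned by the vectors \<open>\<i> e\<^sub>k\<close>.  Let \<open>G\<close> be the quotient map, a local Kaehler isometry
  (\<open>tube_parametrization\<close>).  The Fisher matrix is the Jacobian of the mean \<open>\<mu>\<close> of the feature vectors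
  \<open>F\<^sub>x = (F\<^sub>1(x), ..., F\<^sub>n(x))\<close>, so the equation of the momentum map integrates to \<open>J (G z) = b - B (\<mu> (Re z))\<close>,
  where \<open>B y\<close> has the components \<open>y \<bullet> e\<^sub>k\<close>.  The range of \<open>\<mu>\<close> has as its closure the convex hull of the
  \<open>F\<^sub>x\<close> (\<open>closure_range_mean\<close>), and the free locus is dense (\<open>free_locus_dense\<close>).  As \<open>J\<close> is closed, its
  image is the polytope spanned by the points \<open>b - B F\<^sub>x\<close>.  What remains is that all the differences
  \<open>F\<^sub>x \<bullet> e\<^sub>k - F\<^sub>y \<bullet> e\<^sub>k\<close> are multiples of \<open>4 \<pi>\<close>.

  Conceptually, \<open>z \<mapsto> [exp ((C(x) + F\<^sub>x \<bullet> z) / 2)]\<^sub>x\<close> is an isometric immersion into projective space with a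
  multiple of the Fubini-Study metric, and the claim is that it descends to the quotient by the lattice.  The proof here
  replaces a global extension of this map by a local argument at a single fixed point.  Let \<open>p\<close> be a point
  over a vertex.  There \<open>J\<close> is critical and the torus fixes \<open>p\<close> (\<open>fund_field_zero_over_vertex\<close>,
  \<open>fixed_point_if_fund_field_zero\<close>).  Consequently the orbits of free points near \<open>p\<close> stay in a small
  coordinate ball, in which the metric is given by one convergent power series; so for some \<open>z\<close> the curve
  \<open>\<sigma> \<mapsto> G (z + \<sigma> e\<^sub>k)\<close> maps a strip around the imaginary axis into this ball.  In the chart it is a
  holomorphic curve with period \<open>\<i>\<close>, and its squared speed is \<open>(log S)''\<close> at \<open>Re \<sigma>\<close>, with
  \<open>S(s) = \<Sum>\<^sub>x c\<^sub>x exp (s (F\<^sub>x \<bullet> e\<^sub>k))\<close> and positive \<open>c\<^sub>x\<close>.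

  Now polarize: expand the metric in the curve and its conjugate, and treat the two as independent.
  Moving the parameter \<open>\<sigma>\<close> by the period \<open>\<i>\<close>, but not its conjugate, leaves the squared speed unchanged,
  while \<open>Re \<sigma>\<close>, half the sum of the two, moves by \<open>\<i>/2\<close>.  So \<open>(log S)''\<close> has the period \<open>\<i>/2\<close>
  (\<open>pullback_metric_half_periodic\<close>).  Integrating twice, \<open>S(s + \<i>/2)\<close> is \<open>S(s)\<close> times the exponential of an
  affine function, which must be constant by the behaviour at infinity, so the phases
  \<open>exp (\<i> (F\<^sub>x \<bullet> e\<^sub>k) / 2)\<close> are the same for all \<open>x\<close> (\<open>log_hessian_periodic_imp_phases_eq\<close>).
\<close>

section \<open>Complexified power series\<close>

text \<open>A real power series in the coordinates \<open>(y - z0) \<bullet> b\<close>, with independent complex numbers \<open>\<xi> b\<close>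
  put in for these coordinates.  Evaluating it along holomorphic curves \<open>\<sigma> \<mapsto> \<xi>\<close> is how real analytic
  functions get continued into the complex domain below.\<close>

definition power_series :: "(('a::euclidean_space \<Rightarrow> nat) \<Rightarrow> real) \<Rightarrow> ('a \<Rightarrow> complex) \<Rightarrow> complex" where
  "power_series a \<xi> =
     (\<Sum>\<^sub>\<infinity>\<alpha>\<in>{\<alpha>. \<forall>b. b \<notin> Basis \<longrightarrow> \<alpha> b = 0}. of_real (a \<alpha>) * (\<Prod>b\<in>Basis. \<xi> b ^ \<alpha> b))"

definition polydisc_summable :: "(('a::euclidean_space \<Rightarrow> nat) \<Rightarrow> real) \<Rightarrow> real \<Rightarrow> bool" where
  "polydisc_summable a r \<longleftrightarrow>
     (\<lambda>\<alpha>. \<bar>a \<alpha>\<bar> * (\<Prod>b\<in>Basis. r ^ \<alpha> b)) summable_on {\<alpha>. \<forall>b. b \<notin> Basis \<longrightarrow> \<alpha> b = 0}"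

lemma real_analytic_power_series:
  fixes g :: "'a::euclidean_space \<Rightarrow> real"
  assumes "real_analytic_on g S" "z0 \<in> S"
  obtains a r where "0 < r" "polydisc_summable a r"
    "\<And>y. (\<And>b. b \<in> Basis \<Longrightarrow> \<bar>(y - z0) \<bullet> b\<bar> \<le> r) \<Longrightarrow>
       power_series a (\<lambda>b. of_real ((y - z0) \<bullet> b)) = of_real (g y)"
proof -
  let ?A = "{\<alpha> :: 'a \<Rightarrow> nat. \<forall>b. b \<notin> Basis \<longrightarrow> \<alpha> b = 0}"
  obtain a r0 where "0 < r0" and hs: "\<And>y. y \<in> ball z0 r0 \<Longrightarrow>
      ((\<lambda>\<alpha>. a \<alpha> * (\<Prod>b\<in>Basis. ((y - z0) \<bullet> b) ^ \<alpha> b)) has_sum g y) ?A"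
    using assms unfolding real_analytic_on_def by meson
  define r where "r = r0 / (real DIM('a) + 1)"
  have r: "0 < r" "real DIM('a) * r < r0"
    using \<open>0 < r0\<close> by (auto simp: r_def field_simps)
  have near: "y \<in> ball z0 r0" if "\<And>b. b \<in> Basis \<Longrightarrow> \<bar>(y - z0) \<bullet> b\<bar> \<le> r" for y
  proof -
    have "norm (y - z0) \<le> (\<Sum>b\<in>Basis. \<bar>(y - z0) \<bullet> b\<bar>)" by (rule norm_le_l1)
    also have "\<dots> \<le> real DIM('a) * r" using that by (intro sum_bounded_above) auto
    finally show ?thesis using r by (simp add: dist_norm norm_minus_commute)
  qed
  show thesis
  proof (rule that[OF \<open>0 < r\<close>])
    \<comment> \<open>Unconditional convergence at the corner of the cube \<open>\<bar>(y - z0) \<bullet> b\<bar> \<le> r\<close> is absolute convergence.\<close>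
    define y where "y = z0 + (\<Sum>b\<in>Basis. r *\<^sub>R b)"
    have yb: "(y - z0) \<bullet> b = r" if "b \<in> Basis" for b
      using that by (simp add: y_def inner_sum_left inner_Basis if_distrib sum.delta cong: if_cong)
    have "y \<in> ball z0 r0" by (rule near) (use yb r in auto)
    then have "(\<lambda>\<alpha>. a \<alpha> * (\<Prod>b\<in>Basis. ((y - z0) \<bullet> b) ^ \<alpha> b)) summable_on ?A"
      using hs has_sum_imp_summable by blast
    then have "(\<lambda>\<alpha>. norm (a \<alpha> * (\<Prod>b\<in>Basis. ((y - z0) \<bullet> b) ^ \<alpha> b))) summable_on ?A"
      by (rule iffD1[OF summable_on_iff_abs_summable_on_real])
    then show "polydisc_summable a r"
      using r by (simp add: polydisc_summable_def yb abs_mult abs_prod)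
  next
    fix y assume "\<And>b. b \<in> Basis \<Longrightarrow> \<bar>(y - z0) \<bullet> b\<bar> \<le> r"
    then have "((\<lambda>\<alpha>. a \<alpha> * (\<Prod>b\<in>Basis. ((y - z0) \<bullet> b) ^ \<alpha> b)) has_sum g y) ?A"
      by (intro hs near)
    then have "((\<lambda>\<alpha>. complex_of_real (a \<alpha> * (\<Prod>b\<in>Basis. ((y - z0) \<bullet> b) ^ \<alpha> b))) has_sum of_real (g y)) ?A"
      by (rule has_sum_of_real)
    then show "power_series a (\<lambda>b. of_real ((y - z0) \<bullet> b)) = of_real (g y)"
      by (simp add: power_series_def infsumI)
  qed
qed

text \<open>The series converges uniformly, by the majorant at the corner of the polydisc, and locally uniform
  limits of holomorphic functions are holomorphic.\<close>

lemma power_series_holomorphic: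
  fixes X :: "'a::euclidean_space \<Rightarrow> complex \<Rightarrow> complex"
  assumes sm: "polydisc_summable a r" and "open T"
    and hol: "\<And>b. b \<in> Basis \<Longrightarrow> X b holomorphic_on T"
    and le: "\<And>b \<sigma>. b \<in> Basis \<Longrightarrow> \<sigma> \<in> T \<Longrightarrow> norm (X b \<sigma>) \<le> r"
  shows "(\<lambda>\<sigma>. power_series a (\<lambda>b. X b \<sigma>)) holomorphic_on T"
proof -
  let ?A = "{\<alpha> :: 'a \<Rightarrow> nat. \<forall>b. b \<notin> Basis \<longrightarrow> \<alpha> b = 0}"
  let ?f = "\<lambda>\<alpha> \<sigma>. of_real (a \<alpha>) * (\<Prod>b\<in>Basis. X b \<sigma> ^ \<alpha> b)"
  have ul: "uniform_limit T (\<lambda>Y \<sigma>. \<Sum>\<alpha>\<in>Y. ?f \<alpha> \<sigma>) (\<lambda>\<sigma>. power_series a (\<lambda>b. X b \<sigma>))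
      (finite_subsets_at_top ?A)"
    unfolding power_series_def
  proof (rule Weierstrass_m_test_general)
    show "(\<lambda>\<alpha>. \<bar>a \<alpha>\<bar> * (\<Prod>b\<in>Basis. r ^ \<alpha> b)) summable_on ?A"
      using sm by (simp add: polydisc_summable_def)
    show "norm (?f \<alpha> \<sigma>) \<le> \<bar>a \<alpha>\<bar> * (\<Prod>b\<in>Basis. r ^ \<alpha> b)" if "\<sigma> \<in> T" for \<alpha> \<sigma>
      using le that by (auto simp: norm_mult norm_power prod_norm[symmetric]
          intro!: mult_left_mono prod_mono power_mono)
  qed
  have holf: "(\<lambda>\<sigma>. \<Sum>\<alpha>\<in>Y. ?f \<alpha> \<sigma>) holomorphic_on T" for Y
    by (intro holomorphic_intros hol)
  show ?thesis
    unfolding holomorphic_on_open[OF \<open>open T\<close>]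
  proof
    fix z assume "z \<in> T"
    then obtain e where e: "e > 0" "cball z e \<subseteq> T"
      using \<open>open T\<close> open_contains_cball by blast
    have "(\<lambda>\<sigma>. power_series a (\<lambda>b. X b \<sigma>)) holomorphic_on ball z e"
    proof (rule holomorphic_uniform_limit)
      show "uniform_limit (cball z e) (\<lambda>Y \<sigma>. \<Sum>\<alpha>\<in>Y. ?f \<alpha> \<sigma>) (\<lambda>\<sigma>. power_series a (\<lambda>b. X b \<sigma>))
          (finite_subsets_at_top ?A)"
        by (rule uniform_limit_on_subset[OF ul e(2)])
      show "\<forall>\<^sub>F Y in finite_subsets_at_top ?A. continuous_on (cball z e) (\<lambda>\<sigma>. \<Sum>\<alpha>\<in>Y. ?f \<alpha> \<sigma>) \<and>
          (\<lambda>\<sigma>. \<Sum>\<alpha>\<in>Y. ?f \<alpha> \<sigma>) holomorphic_on ball z e"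
        using e(2) holf ball_subset_cball
        by (intro always_eventually allI conjI)
           (blast intro: holomorphic_on_imp_continuous_on holomorphic_on_subset)+
    qed auto
    then show "\<exists>f'. ((\<lambda>\<sigma>. power_series a (\<lambda>b. X b \<sigma>)) has_field_derivative f') (at z)"
      using e(1) by (auto simp: holomorphic_on_open)
  qed
qed

section \<open>Exponential sums whose second logarithmic derivative has an imaginary period\<close>

definition exp_sum :: "('x::finite \<Rightarrow> complex) \<Rightarrow> ('x \<Rightarrow> real) \<Rightarrow> complex \<Rightarrow> complex" where
  "exp_sum w l \<sigma> = (\<Sum>x\<in>UNIV. w x * exp (of_real (l x) * \<sigma>))"

lemma exp_sum_has_field_derivative:
  "(exp_sum w l has_field_derivative exp_sum (\<lambda>x. of_real (l x) * w x) l \<sigma>) (at \<sigma>)"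
  unfolding exp_sum_def by (auto intro!: derivative_eq_intros sum.cong)

lemma exp_sum_holomorphic: "exp_sum w l holomorphic_on A"
  unfolding exp_sum_def by (intro holomorphic_intros)

lemma exp_sum_shift: "exp_sum w l (\<sigma> + \<tau>) = exp_sum (\<lambda>x. w x * exp (of_real (l x) * \<tau>)) l \<sigma>"
  unfolding exp_sum_def by (intro sum.cong) (auto simp: ring_distribs exp_add)

text \<open>As \<open>s \<rightarrow> \<infinity>\<close> only the terms with the largest exponent survive the normalization.\<close>

lemma exp_sum_asymptotics:
  fixes w :: "'x::finite \<Rightarrow> complex" and l :: "'x \<Rightarrow> real"
  assumes "\<And>x. l x \<le> m"
  shows "((\<lambda>s. exp_sum w l (of_real s) * of_real (exp (- m * s))) \<longlongrightarrow> (\<Sum>x | l x = m. w x)) at_top"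
proof -
  have eq: "exp_sum w l (of_real s) * of_real (exp (- m * s)) =
      (\<Sum>x\<in>UNIV. w x * of_real (exp ((l x - m) * s)))" for s
    unfolding exp_sum_def sum_distrib_right
    by (intro sum.cong) (auto simp: exp_of_real[symmetric] exp_add[symmetric] algebra_simps)
  have "((\<lambda>s. w x * of_real (exp ((l x - m) * s))) \<longlongrightarrow> (if l x = m then w x else 0)) at_top" for x
  proof (cases "l x = m")
    case False
    then have "l x - m < 0" using assms[of x] by simp
    then have "((\<lambda>s. exp ((l x - m) * s)) \<longlongrightarrow> 0) at_top"
      by (intro filterlim_compose[OF exp_at_bot] filterlim_tendsto_neg_mult_at_bot[OF tendsto_const]
          filterlim_ident)
    then have "((\<lambda>s. w x * of_real (exp ((l x - m) * s))) \<longlongrightarrow> w x * of_real 0) at_top"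
      by (intro tendsto_intros)
    then show ?thesis using False by simp
  qed simp
  then have "((\<lambda>s. \<Sum>x\<in>UNIV. w x * of_real (exp ((l x - m) * s))) \<longlongrightarrow>
      (\<Sum>x\<in>UNIV. if l x = m then w x else 0)) at_top"
    by (intro tendsto_sum)
  then show ?thesis unfolding eq by (simp add: sum.If_cases)
qed

lemma eq_of_eq_on_real_interval:
  assumes "f holomorphic_on S" "g holomorphic_on S" "open S" "connected S"
    and "a < b" "\<And>s. a < s \<Longrightarrow> s < b \<Longrightarrow> of_real s \<in> S"
    and "\<And>s. a < s \<Longrightarrow> s < b \<Longrightarrow> f (of_real s) = g (of_real s)" and "z \<in> S"
  shows "f z = g z"
proof -
  let ?c = "of_real ((a + b) / 2) :: complex"
  have lp: "?c islimpt of_real ` {a<..<b}"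
  proof -
    have "(a + b) / 2 islimpt {a<..<b}"
      using assms(5) by (intro open_imp_islimpt) auto
    then show ?thesis
      by (rule islimpt_isCont_image) (auto simp: eventually_at_filter simp del: of_real_add of_real_divide)
  qed
  have "f z - g z = 0"
  proof (rule analytic_continuation[of "\<lambda>z. f z - g z" S "of_real ` {a<..<b}" ?c])
    show "(\<lambda>z. f z - g z) holomorphic_on S" using assms(1,2) by (intro holomorphic_intros)
    show "of_real ` {a<..<b} \<subseteq> S" using assms(6) by auto
    show "?c \<in> S" by (rule assms(6)) (use \<open>a < b\<close> in auto)
    show "f w - g w = 0" if "w \<in> of_real ` {a<..<b}" for w using that assms(7) by auto
  qed (use assms lp in auto)
  then show ?thesis by simp
qed

text \<open>As \<open>S1\<close> and \<open>S2\<close> are the derivatives of \<open>S0\<close>, the hypothesis \<open>per\<close> compares the values of \<open>(log S0)''\<close>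
  at \<open>s\<close> and at \<open>s + \<i> h\<close>, cleared of denominators.  Integrating twice, \<open>S0 (s + \<i> h) = exp (a s + b) S0 s\<close>; both sides have the same largest
  exponent, so \<open>a = 0\<close>.  Thus shifting by \<open>\<i> h\<close>, which multiplies the term with exponent \<open>l x\<close> by the
  phase \<open>exp (\<i> h l x)\<close>, multiplies the whole sum by a single phase, and positivity of the coefficients
  forces all the phases to agree.\<close>

lemma log_hessian_periodic_imp_phases_eq:
  fixes c l :: "'x::finite \<Rightarrow> real" and h :: complex and \<delta> :: real
  defines "S0 \<equiv> exp_sum (\<lambda>x. of_real (c x)) l"
    and "S1 \<equiv> exp_sum (\<lambda>x. of_real (l x) * of_real (c x)) l"
    and "S2 \<equiv> exp_sum (\<lambda>x. of_real (l x) * (of_real (l x) * of_real (c x))) l"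
  assumes c: "\<And>x. 0 < c x" and "0 < \<delta>"
    and per: "\<And>s::real. \<bar>s\<bar> < \<delta> \<Longrightarrow>
      (S2 (s + \<i> * h) * S0 (s + \<i> * h) - S1 (s + \<i> * h) ^ 2) * S0 s ^ 2
        = (S2 s * S0 s - S1 s ^ 2) * S0 (s + \<i> * h) ^ 2"
    and h: "h \<in> \<real>"
  shows "exp (of_real (l x) * (\<i> * h)) = exp (of_real (l y) * (\<i> * h))"
proof -
  define V0 where "V0 = (\<lambda>\<sigma>. S0 (\<sigma> + \<i> * h))"
  define V1 where "V1 = (\<lambda>\<sigma>. S1 (\<sigma> + \<i> * h))"
  define V2 where "V2 = (\<lambda>\<sigma>. S2 (\<sigma> + \<i> * h))"
  have dS: "(S0 has_field_derivative S1 \<sigma>) (at \<sigma>)" "(S1 has_field_derivative S2 \<sigma>) (at \<sigma>)" for \<sigma>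
    unfolding S0_def S1_def S2_def by (rule exp_sum_has_field_derivative)+
  have dV: "(V0 has_field_derivative V1 \<sigma>) (at \<sigma>)" "(V1 has_field_derivative V2 \<sigma>) (at \<sigma>)" for \<sigma>
    unfolding V0_def V1_def V2_def using dS DERIV_shift by blast+
  have hol: "S0 holomorphic_on UNIV" "S1 holomorphic_on UNIV" "S2 holomorphic_on UNIV"
    unfolding S0_def S1_def S2_def by (rule exp_sum_holomorphic)+
  have holV: "V0 holomorphic_on UNIV" "V1 holomorphic_on UNIV" "V2 holomorphic_on UNIV"
    unfolding V0_def V1_def V2_def S0_def S1_def S2_def exp_sum_shift by (rule exp_sum_holomorphic)+
  have all: "(V2 \<sigma> * V0 \<sigma> - V1 \<sigma> ^ 2) * S0 \<sigma> ^ 2 = (S2 \<sigma> * S0 \<sigma> - S1 \<sigma> ^ 2) * V0 \<sigma> ^ 2" for \<sigma>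
  proof (rule eq_of_eq_on_real_interval[where S = UNIV and a = "-\<delta>" and b = \<delta>
        and f = "\<lambda>\<sigma>. (V2 \<sigma> * V0 \<sigma> - V1 \<sigma> ^ 2) * S0 \<sigma> ^ 2"
        and g = "\<lambda>\<sigma>. (S2 \<sigma> * S0 \<sigma> - S1 \<sigma> ^ 2) * V0 \<sigma> ^ 2"])
    fix s :: real assume "- \<delta> < s" "s < \<delta>"
    then show "(V2 s * V0 s - V1 s ^ 2) * S0 s ^ 2 = (S2 s * S0 s - S1 s ^ 2) * V0 s ^ 2"
      unfolding V0_def V1_def V2_def by (intro per) auto
  qed (use \<open>0 < \<delta>\<close> in \<open>auto intro!: holomorphic_intros hol holV\<close>)
  define m where "m = Max (range l)"
  have lm: "l x \<le> m" for x by (simp add: m_def)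
  have "m \<in> range l" unfolding m_def by (rule Max_in) auto
  then obtain x0 where x0: "l x0 = m" by (metis imageE)
  define cm where "cm = (\<Sum>x | l x = m. complex_of_real (c x))"
  have cm: "cm \<noteq> 0"
  proof -
    have "0 < (\<Sum>x | l x = m. c x)" using c x0 by (intro sum_pos) auto
    then show ?thesis unfolding cm_def of_real_sum[symmetric] by (simp del: of_real_sum)
  qed
  define \<epsilon> where "\<epsilon> = exp (of_real m * (\<i> * h))"
  define E where "E = (\<lambda>s. complex_of_real (exp (- m * s)))"
  have E0: "E s \<noteq> 0" for s by (simp add: E_def)
  have lim: "((\<lambda>s. S0 (of_real s) * E s) \<longlongrightarrow> cm) at_top"
    "((\<lambda>s. S1 (of_real s) * E s) \<longlongrightarrow> m * cm) at_top"
    "((\<lambda>s. V0 (of_real s) * E s) \<longlongrightarrow> cm * \<epsilon>) at_top"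
    "((\<lambda>s. V1 (of_real s) * E s) \<longlongrightarrow> m * cm * \<epsilon>) at_top"
    unfolding S0_def S1_def V0_def V1_def E_def exp_sum_shift
    by (rule tendsto_eq_rhs, rule exp_sum_asymptotics, rule lm,
        simp add: cm_def \<epsilon>_def sum_distrib_left sum_distrib_right)+
  have \<epsilon>: "\<epsilon> \<noteq> 0" by (simp add: \<epsilon>_def)
  have "\<forall>\<^sub>F s in at_top. V0 (of_real s) * E s \<noteq> 0"
    by (rule tendsto_imp_eventually_ne[OF lim(3)]) (use cm \<epsilon> in simp)
  moreover have "\<forall>\<^sub>F s in at_top. S0 (of_real s) * E s \<noteq> 0"
    by (rule tendsto_imp_eventually_ne[OF lim(1)]) (use cm in simp)
  ultimately have "\<forall>\<^sub>F s in at_top. V0 (of_real s) \<noteq> 0 \<and> S0 (of_real s) \<noteq> 0"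
    by eventually_elim auto
  then obtain s1 where s1: "\<And>s. s1 < s \<Longrightarrow> V0 (of_real s) \<noteq> 0 \<and> S0 (of_real s) \<noteq> 0"
    by (auto simp: eventually_at_top_dense)
  \<comment> \<open>The logarithmic derivatives of \<open>V0\<close> and \<open>S0\<close> differ by a constant, which is the limit \<open>m - m\<close>.\<close>
  define D where "D = (\<lambda>\<sigma>. V1 \<sigma> / V0 \<sigma> - S1 \<sigma> / S0 \<sigma>)"
  have "((\<lambda>s. D (of_real s)) has_vector_derivative 0) (at s within {s1<..})" if "s \<in> {s1<..}" for s
  proof (rule has_vector_derivative_real_field)
    have ne: "V0 (of_real s) \<noteq> 0" "S0 (of_real s) \<noteq> 0" using s1 that by auto
    have "(V2 s * V0 s - V1 s * V1 s) / (V0 s * V0 s) - (S2 s * S0 s - S1 s * S1 s) / (S0 s * S0 s) = 0"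
      using ne all[of "of_real s"] by (simp add: divide_simps power2_eq_square)
    then show "(D has_field_derivative 0) (at (of_real s))"
      unfolding D_def using ne by (auto intro!: derivative_eq_intros dS dV)
  qed
  then obtain k where k: "\<And>s. s1 < s \<Longrightarrow> D (of_real s) = k"
    by (rule has_vector_derivative_zero_constant[rotated]) auto
  have "((\<lambda>s. (V1 (of_real s) * E s) / (V0 (of_real s) * E s)
      - (S1 (of_real s) * E s) / (S0 (of_real s) * E s)) \<longlongrightarrow> m * cm * \<epsilon> / (cm * \<epsilon>) - m * cm / cm) at_top"
    by (intro tendsto_intros lim) (use cm \<epsilon> in auto)
  then have "((\<lambda>s. D (of_real s)) \<longlongrightarrow> 0) at_top"
    using cm \<epsilon> E0 by (simp add: D_def)
  moreover have "((\<lambda>s. D (of_real s)) \<longlongrightarrow> k) at_top"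
    by (rule tendsto_eventually, rule eventually_mono[OF eventually_gt_at_top[of s1]], rule k)
  ultimately have "k = 0" using tendsto_unique trivial_limit_at_top_linorder by blast
  have "((\<lambda>s. V0 (of_real s) / S0 (of_real s)) has_vector_derivative 0) (at s within {s1<..})"
    if "s \<in> {s1<..}" for s
  proof (rule has_vector_derivative_real_field)
    have ne: "V0 (of_real s) \<noteq> 0" "S0 (of_real s) \<noteq> 0" using s1 that by auto
    have "V1 s * S0 s - V0 s * S1 s = 0"
      using k[of s] that ne \<open>k = 0\<close> by (simp add: D_def divide_simps mult.commute)
    then show "((\<lambda>\<sigma>. V0 \<sigma> / S0 \<sigma>) has_field_derivative 0) (at (of_real s))"
      using ne by (auto intro!: derivative_eq_intros dS dV)
  qed
  then obtain q where q: "\<And>s. s1 < s \<Longrightarrow> V0 (of_real s) / S0 (of_real s) = q"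
    by (rule has_vector_derivative_zero_constant[rotated]) auto
  have "((\<lambda>s. (V0 (of_real s) * E s) / (S0 (of_real s) * E s)) \<longlongrightarrow> cm * \<epsilon> / cm) at_top"
    by (intro tendsto_intros lim) (use cm in auto)
  then have "((\<lambda>s. V0 (of_real s) / S0 (of_real s)) \<longlongrightarrow> \<epsilon>) at_top"
    using cm E0 by simp
  moreover have "((\<lambda>s. V0 (of_real s) / S0 (of_real s)) \<longlongrightarrow> q) at_top"
    by (rule tendsto_eventually, rule eventually_mono[OF eventually_gt_at_top[of s1]], rule q)
  ultimately have "q = \<epsilon>" using tendsto_unique trivial_limit_at_top_linorder by blast
  have "V0 \<sigma> = \<epsilon> * S0 \<sigma>" for \<sigma>
  proof (rule eq_of_eq_on_real_interval[where S = UNIV and a = s1 and b = "s1 + 1"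
        and f = V0 and g = "\<lambda>\<sigma>. \<epsilon> * S0 \<sigma>"])
    show "V0 (of_real s) = \<epsilon> * S0 (of_real s)" if "s1 < s" for s
      using q[OF that] s1[OF that] \<open>q = \<epsilon>\<close> by (simp add: field_simps)
  qed (auto intro!: holomorphic_intros hol holV)
  then have "V0 0 = \<epsilon> * S0 0" .
  \<comment> \<open>At \<open>0\<close> a sum of unit vectors with positive weights has full length, so they all point one way.\<close>
  obtain t where t: "h = of_real t" using h by (auto elim: Reals_cases)
  have "(\<Sum>x\<in>UNIV. c x * (cos ((l x - m) * t))) = (\<Sum>x\<in>UNIV. c x)"
  proof -
    have "(\<Sum>x\<in>UNIV. of_real (c x) * cis ((l x - m) * t)) * \<epsilon> = V0 0"
      unfolding V0_def S0_def exp_sum_shift unfolding exp_sum_def sum_distrib_right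
      by (intro sum.cong) (auto simp: cis_conv_exp \<epsilon>_def t exp_add[symmetric] algebra_simps)
    also have "\<dots> = \<epsilon> * (\<Sum>x\<in>UNIV. of_real (c x))"
      using \<open>V0 0 = \<epsilon> * S0 0\<close> by (simp add: S0_def exp_sum_def)
    finally have "(\<Sum>x\<in>UNIV. of_real (c x) * cis ((l x - m) * t)) = (\<Sum>x\<in>UNIV. complex_of_real (c x))"
      using \<epsilon> by simp
    from arg_cong[OF this, of Re] show ?thesis by simp
  qed
  then have "(\<Sum>x\<in>UNIV. c x * (1 - cos ((l x - m) * t))) = 0"
    by (simp add: sum_subtractf right_diff_distrib)
  then have zero: "c x * (1 - cos ((l x - m) * t)) = 0" for x
    using c[THEN less_imp_le] by (subst (asm) sum_nonneg_eq_0_iff) (auto intro!: mult_nonneg_nonneg)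
  have "cos ((l x - m) * t) = 1" for x
    using zero[of x] c[of x] by simp
  then have "cis ((l x - m) * t) = 1" for x
    by (simp add: complex_eq_iff) (metis cos_one_sin_zero)
  moreover have "exp (of_real (l x) * (\<i> * h)) = cis ((l x - m) * t) * \<epsilon>" for x
    by (simp add: cis_conv_exp \<epsilon>_def t exp_add[symmetric] algebra_simps)
  ultimately show ?thesis by simp
qed

section \<open>Polarization of a metric along a periodic holomorphic curve\<close>

definition strip :: "real \<Rightarrow> complex set" where
  "strip \<delta> = {\<sigma>. \<bar>Re \<sigma>\<bar> < \<delta>}"

lemma strip_simps [simp]:
  "\<sigma> + of_real t * \<i> \<in> strip \<delta> \<longleftrightarrow> \<sigma> \<in> strip \<delta>"
  "\<sigma> + \<i> * of_real t \<in> strip \<delta> \<longleftrightarrow> \<sigma> \<in> strip \<delta>"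
  "\<sigma> + \<i> / 2 \<in> strip \<delta> \<longleftrightarrow> \<sigma> \<in> strip \<delta>"
  "cnj \<sigma> \<in> strip \<delta> \<longleftrightarrow> \<sigma> \<in> strip \<delta>" "of_real t \<in> strip \<delta> \<longleftrightarrow> \<bar>t\<bar> < \<delta>"
  by (auto simp: strip_def)

lemma strip_eq: "strip \<delta> = {\<sigma>. Re \<sigma> < \<delta>} \<inter> {\<sigma>. - \<delta> < Re \<sigma>}"
  by (auto simp: strip_def)

lemma open_strip: "open (strip \<delta>)"
  unfolding strip_eq by (intro open_Int open_halfspace_Re_lt open_halfspace_Re_gt)

lemma connected_strip: "connected (strip \<delta>)"
  unfolding strip_eq by (intro convex_connected convex_Int convex_halfspace_Re_lt convex_halfspace_Re_gt)

text \<open>On the real axis the \<open>b\<close>-coordinate of \<open>F (s + \<i> \<rho>)\<close> is the real part of a Hermitian product, that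
  is \<open>(w + cnj w) / 2\<close> with \<open>w = \<Sum>\<^sub>j F\<^sub>j cnj b\<^sub>j\<close>.  Replacing \<open>cnj (F (s + \<i> \<rho>))\<close> by
  \<open>cnj (F (cnj \<sigma> + \<i> \<rho>))\<close> makes it holomorphic in \<open>\<sigma>\<close>: the point and its conjugate have become the
  two independent arguments \<open>\<sigma> + \<i> \<rho>\<close> and \<open>\<sigma> - \<i> \<rho>\<close>.\<close>

definition polarize ::
  "real \<Rightarrow> (complex \<Rightarrow> complex^'n::finite) \<Rightarrow> complex^'n \<Rightarrow> complex \<Rightarrow> complex" where
  "polarize \<rho> F b \<sigma> = (\<Sum>j\<in>UNIV. F (\<sigma> + \<i> * of_real \<rho>) $ j * cnj (b $ j)
      + cnj (F (cnj \<sigma> + \<i> * of_real \<rho>) $ j) * b $ j) / 2"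

lemma polarize_of_real: "polarize \<rho> F b (of_real s) = of_real (F (of_real s + \<i> * of_real \<rho>) \<bullet> b)"
proof -
  have "z * cnj w + cnj z * w = of_real (2 * (z \<bullet> w))" for z w
    by (simp add: complex_eq_iff inner_complex_def)
  then show ?thesis
    by (simp add: polarize_def inner_vec_def flip: of_real_sum sum_distrib_left)
qed

text \<open>Moving \<open>\<sigma>\<close> by \<open>\<i>/2\<close> and \<open>\<rho>\<close> by \<open>1/2\<close> moves \<open>\<sigma> + \<i> \<rho>\<close> by the full period \<open>\<i>\<close> and leaves
  \<open>\<sigma> - \<i> \<rho>\<close> where it is.  This is the origin of the half period.\<close>

lemma polarize_half_period:
  assumes "\<And>\<sigma>. F (\<sigma> + \<i>) = F \<sigma>"
  shows "polarize (1/2) F b (\<sigma> + \<i> / 2) = polarize 0 F b \<sigma>"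
proof -
  have "\<sigma> + \<i> / 2 + \<i> * of_real (1/2) = \<sigma> + \<i>" "cnj (\<sigma> + \<i> / 2) + \<i> * of_real (1/2) = cnj \<sigma>"
    by (simp_all add: complex_eq_iff)
  then show ?thesis by (simp only: polarize_def assms) simp
qed

lemma polarize_holomorphic:
  assumes "\<And>j. (\<lambda>\<sigma>. F \<sigma> $ j) holomorphic_on strip \<delta>"
  shows "polarize \<rho> F b holomorphic_on strip \<delta>"
proof -
  have 1: "(\<lambda>\<sigma>. F (\<sigma> + \<i> * of_real \<rho>) $ j) holomorphic_on strip \<delta>" for j
    by (rule holomorphic_on_compose_gen[OF _ assms[of j], of "\<lambda>\<sigma>. \<sigma> + \<i> * of_real \<rho>", unfolded o_def])
       (auto intro!: holomorphic_intros)
  have "cnj ` strip \<delta> = strip \<delta>"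
    by (metis (no_types, lifting) strip_simps(4) complex_cnj_cnj image_iff subsetI subset_antisym image_subset_iff)
  then have "cnj \<circ> (\<lambda>\<sigma>. F (\<sigma> + \<i> * of_real \<rho>) $ j) \<circ> cnj holomorphic_on strip \<delta>" for j
    using 1[of j] open_strip by (intro holomorphic_on_compose_cnj_cnj) auto
  then have 2: "(\<lambda>\<sigma>. cnj (F (cnj \<sigma> + \<i> * of_real \<rho>) $ j)) holomorphic_on strip \<delta>" for j
    by (simp add: o_def)
  show ?thesis
    unfolding polarize_def by (intro holomorphic_intros 1 2) auto
qed

text \<open>For a basis vector \<open>b\<close> only one component of \<open>F\<close> enters, so the two arguments never leave the polydisc
  on which the components of \<open>F\<close> are bounded.\<close>

lemma norm_polarize_le:
  assumes "b \<in> Basis" "\<And>\<sigma> j. \<sigma> \<in> strip \<delta> \<Longrightarrow> norm (F \<sigma> $ j) \<le> r" "\<sigma> \<in> strip \<delta>"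
  shows "norm (polarize \<rho> F b \<sigma>) \<le> r"
proof -
  obtain k c where b: "b = axis k c" "norm c = 1"
    using \<open>b \<in> Basis\<close> by (auto simp: Basis_vec_def)
  have "polarize \<rho> F b \<sigma> = (F (\<sigma> + \<i> * of_real \<rho>) $ k * cnj c + cnj (F (cnj \<sigma> + \<i> * of_real \<rho>) $ k) * c) / 2"
    unfolding polarize_def b(1) by (subst sum.remove[of _ k]) (auto simp: axis_def intro!: sum.neutral)
  also have "norm \<dots> \<le> (norm (F (\<sigma> + \<i> * of_real \<rho>) $ k) + norm (F (cnj \<sigma> + \<i> * of_real \<rho>) $ k)) / 2"
    using norm_triangle_ineq[of "F (\<sigma> + \<i> * of_real \<rho>) $ k * cnj c" "cnj (F (cnj \<sigma> + \<i> * of_real \<rho>) $ k) * c"] b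
    by (simp add: norm_mult norm_divide)
  also have "\<dots> \<le> r"
    using assms(2)[of "\<sigma> + \<i> * of_real \<rho>" k] assms(2)[of "cnj \<sigma> + \<i> * of_real \<rho>" k] assms(3) by simp
  finally show ?thesis .
qed

lemma bilinear_Basis_expansion:
  fixes h :: "'a::euclidean_space \<Rightarrow> 'a \<Rightarrow> real"
  assumes "bilinear h"
  shows "h v w = (\<Sum>b\<in>Basis. \<Sum>c\<in>Basis. (v \<bullet> b) * (w \<bullet> c) * h b c)"
proof -
  have "h v w = h (\<Sum>b\<in>Basis. (v \<bullet> b) *\<^sub>R b) (\<Sum>c\<in>Basis. (w \<bullet> c) *\<^sub>R c)"
    by (simp add: euclidean_representation)
  also have "\<dots> = (\<Sum>b\<in>Basis. \<Sum>c\<in>Basis. h ((v \<bullet> b) *\<^sub>R b) ((w \<bullet> c) *\<^sub>R c))"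
    by (simp add: bilinear_sum[OF assms] sum.cartesian_product)
  finally show ?thesis
    by (simp add: bilinear_lmul[OF assms] bilinear_rmul[OF assms] algebra_simps)
qed

text \<open>For each real \<open>\<rho>\<close>, polarizing the squared speed of \<open>f\<close> along the line \<open>Im = \<rho>\<close> gives a holomorphic
  function \<open>R \<rho>\<close> on the strip.  As the squared speed does not depend on the imaginary part, every \<open>R \<rho>\<close>
  agrees with \<open>u\<close> on the real axis, and by the identity theorem they are all the same function.  Comparing \<open>R 0\<close> with \<open>R (1/2)\<close> by
  means of the half period shows that this continuation of \<open>u\<close> is \<open>\<i>/2\<close>-periodic.

  The radius \<open>r\<close> depends on the metric and on \<open>z0\<close> alone, so that a curve can be chosen afterwards to fit into it.\<close>

lemma pullback_metric_half_periodic: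
  fixes g :: "complex^'n::finite \<Rightarrow> complex^'n \<Rightarrow> complex^'n \<Rightarrow> real"
  assumes ana: "\<And>v w. real_analytic_on (\<lambda>z. g z v w) S" and "z0 \<in> S"
  shows "\<exists>r>0. \<forall>\<delta>>0. \<forall>f u.
       (\<forall>j. (\<lambda>\<sigma>. f \<sigma> $ j) holomorphic_on strip \<delta>) \<longrightarrow> (\<forall>\<sigma>. f (\<sigma> + \<i>) = f \<sigma>) \<longrightarrow>
       (\<forall>\<sigma>\<in>strip \<delta>. (\<forall>j. norm (f \<sigma> $ j - z0 $ j) \<le> r) \<and> bilinear (g (f \<sigma>)) \<and>
          g (f \<sigma>) (\<chi> j. deriv (\<lambda>\<sigma>. f \<sigma> $ j) \<sigma>) (\<chi> j. deriv (\<lambda>\<sigma>. f \<sigma> $ j) \<sigma>) = u (Re \<sigma>)) \<longrightarrow>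
       (\<exists>R. R holomorphic_on strip \<delta> \<and>
         (\<forall>s. \<bar>s\<bar> < \<delta> \<longrightarrow> R (of_real s) = of_real (u s) \<and> R (of_real s + \<i> / 2) = of_real (u s)))"
proof -
  have "\<exists>a r. 0 < r \<and> polydisc_summable a r \<and> (\<forall>y. (\<forall>b'\<in>Basis. \<bar>(y - z0) \<bullet> b'\<bar> \<le> r) \<longrightarrow>
       power_series a (\<lambda>b'. of_real ((y - z0) \<bullet> b')) = of_real (g y b c))" for b c
    using real_analytic_power_series[OF ana \<open>z0 \<in> S\<close>, of b c] by metis
  then obtain a r where r: "\<And>b c. 0 < r b c" "\<And>b c. polydisc_summable (a b c) (r b c)"
    "\<And>b c y. (\<And>b'. b' \<in> Basis \<Longrightarrow> \<bar>(y - z0) \<bullet> b'\<bar> \<le> r b c) \<Longrightarrow>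
       power_series (a b c) (\<lambda>b'. of_real ((y - z0) \<bullet> b')) = of_real (g y b c)"
    by metis
  define r0 where "r0 = Min ((\<lambda>(b, c). r b c) ` (Basis \<times> Basis))"
  have r0_le: "r0 \<le> r b c" if "b \<in> Basis" "c \<in> Basis" for b c
    unfolding r0_def using that by (intro Min_le) auto
  have "0 < r0"
    unfolding r0_def using r(1) by (subst Min_gr_iff) auto
  show ?thesis
  proof (intro exI[of _ r0] conjI[OF \<open>0 < r0\<close>] allI impI)
    fix \<delta> :: real and f :: "complex \<Rightarrow> complex^'n" and u :: "real \<Rightarrow> real"
    assume "0 < \<delta>" and hol': "\<forall>j. (\<lambda>\<sigma>. f \<sigma> $ j) holomorphic_on strip \<delta>"
      and per': "\<forall>\<sigma>. f (\<sigma> + \<i>) = f \<sigma>"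
      and *: "\<forall>\<sigma>\<in>strip \<delta>. (\<forall>j. norm (f \<sigma> $ j - z0 $ j) \<le> r0) \<and> bilinear (g (f \<sigma>)) \<and>
          g (f \<sigma>) (\<chi> j. deriv (\<lambda>\<sigma>. f \<sigma> $ j) \<sigma>) (\<chi> j. deriv (\<lambda>\<sigma>. f \<sigma> $ j) \<sigma>) = u (Re \<sigma>)"
    note hol = hol'[rule_format] and per = per'[rule_format]
    have near: "\<And>\<sigma> j. \<sigma> \<in> strip \<delta> \<Longrightarrow> norm (f \<sigma> $ j - z0 $ j) \<le> r0"
      and bil: "\<And>\<sigma>. \<sigma> \<in> strip \<delta> \<Longrightarrow> bilinear (g (f \<sigma>))"
      and u: "\<And>\<sigma>. \<sigma> \<in> strip \<delta> \<Longrightarrow>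
          g (f \<sigma>) (\<chi> j. deriv (\<lambda>\<sigma>. f \<sigma> $ j) \<sigma>) (\<chi> j. deriv (\<lambda>\<sigma>. f \<sigma> $ j) \<sigma>) = u (Re \<sigma>)"
      using * by blast+
    define f0 where "f0 = (\<lambda>\<sigma>. f \<sigma> - z0)"
    define f' where "f' = (\<lambda>\<sigma>. \<chi> j. deriv (\<lambda>\<sigma>. f \<sigma> $ j) \<sigma>)"
    have hol0: "(\<lambda>\<sigma>. f0 \<sigma> $ j) holomorphic_on strip \<delta>" for j
      unfolding f0_def vector_minus_component by (intro holomorphic_intros hol)
    have hol': "(\<lambda>\<sigma>. f' \<sigma> $ j) holomorphic_on strip \<delta>" for j
      using hol open_strip by (auto simp: f'_def intro!: holomorphic_deriv)
    have per0: "f0 (\<sigma> + \<i>) = f0 \<sigma>" for \<sigma> by (simp add: f0_def per)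
    have per': "f' (\<sigma> + \<i>) = f' \<sigma>" for \<sigma>
      unfolding f'_def deriv_def by (simp add: DERIV_shift per)
    define R where "R = (\<lambda>\<rho> \<sigma>. \<Sum>b\<in>Basis. \<Sum>c\<in>Basis. polarize \<rho> f' b \<sigma> * polarize \<rho> f' c \<sigma> *
        power_series (a b c) (\<lambda>b'. polarize \<rho> f0 b' \<sigma>))"
    have polle: "norm (polarize \<rho> f0 b \<sigma>) \<le> r0" if "b \<in> Basis" "\<sigma> \<in> strip \<delta>" for \<rho> b \<sigma>
      by (rule norm_polarize_le[where \<delta> = \<delta>]) (use that near in \<open>auto simp: f0_def\<close>)
    have Rhol: "R \<rho> holomorphic_on strip \<delta>" for \<rho>
      unfolding R_def
    proof (intro holomorphic_intros polarize_holomorphic hol')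
      fix b c :: "complex^'n" assume bc: "b \<in> Basis" "c \<in> Basis"
      show "(\<lambda>\<sigma>. power_series (a b c) (\<lambda>b'. polarize \<rho> f0 b' \<sigma>)) holomorphic_on strip \<delta>"
        by (rule power_series_holomorphic[OF r(2) open_strip])
           (auto intro: polarize_holomorphic hol0 order_trans[OF polle r0_le[OF bc]])
    qed
    have Rreal: "R \<rho> (of_real s) = of_real (u s)" if s: "\<bar>s\<bar> < \<delta>" for \<rho> s
    proof -
      define \<sigma> where "\<sigma> = of_real s + \<i> * of_real \<rho>"
      have \<sigma>: "\<sigma> \<in> strip \<delta>" "Re \<sigma> = s" using s by (auto simp: \<sigma>_def)
      have "power_series (a b c) (\<lambda>b'. of_real (f0 \<sigma> \<bullet> b')) = of_real (g (f \<sigma>) b c)"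
        if bc: "b \<in> Basis" "c \<in> Basis" for b c
        unfolding f0_def
      proof (rule r(3))
        fix b' :: "complex^'n" assume "b' \<in> Basis"
        then have "norm (polarize \<rho> f0 b' (of_real s)) \<le> r0" by (rule polle) (use s in simp)
        then show "\<bar>(f \<sigma> - z0) \<bullet> b'\<bar> \<le> r b c"
          using r0_le[OF bc] by (simp add: polarize_of_real f0_def \<sigma>_def)
      qed
      then have "R \<rho> (of_real s) =
          of_real (\<Sum>b\<in>Basis. \<Sum>c\<in>Basis. (f' \<sigma> \<bullet> b) * (f' \<sigma> \<bullet> c) * g (f \<sigma>) b c)"
        by (simp add: R_def polarize_of_real \<sigma>_def)
      also have "\<dots> = of_real (g (f \<sigma>) (f' \<sigma>) (f' \<sigma>))"
        using bilinear_Basis_expansion[OF bil[OF \<sigma>(1)], of "f' \<sigma>" "f' \<sigma>"] by simp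
      finally show ?thesis using u[OF \<sigma>(1)] \<sigma>(2) by (simp add: f'_def)
    qed
    have shift: "R (1/2) (\<sigma> + \<i> / 2) = R 0 \<sigma>" for \<sigma>
      unfolding R_def by (simp only: polarize_half_period per' per0)
    have eq: "R 0 \<sigma> = R (1/2) \<sigma>" if "\<sigma> \<in> strip \<delta>" for \<sigma>
    proof (rule eq_of_eq_on_real_interval[OF Rhol Rhol open_strip connected_strip])
      show "- \<delta> < \<delta>" using \<open>0 < \<delta>\<close> by simp
      show "R 0 (of_real s) = R (1/2) (of_real s)" if "- \<delta> < s" "s < \<delta>" for s
        using Rreal that by (simp add: abs_less_iff)
    qed (use that in auto)
    show "\<exists>R. R holomorphic_on strip \<delta> \<and>
         (\<forall>s. \<bar>s\<bar> < \<delta> \<longrightarrow> R (of_real s) = of_real (u s) \<and> R (of_real s + \<i> / 2) = of_real (u s))"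
      using Rhol[of 0] Rreal[of _ 0] shift eq by (intro exI[of _ "R 0"]) auto
  qed
qed

section \<open>The mean parameter of an exponential family\<close>

definition feature :: "('n::finite \<Rightarrow> 'x \<Rightarrow> real) \<Rightarrow> 'x \<Rightarrow> real^'n" where
  "feature F x = (\<chi> i. F i x)"

definition mean :: "('x::finite \<Rightarrow> real) \<Rightarrow> ('n::finite \<Rightarrow> 'x \<Rightarrow> real) \<Rightarrow> (real^'n \<Rightarrow> real) \<Rightarrow> real^'n \<Rightarrow> real^'n"
  where "mean C F \<psi> \<theta> = (\<Sum>x\<in>UNIV. exp_family C F \<psi> \<theta> $ x *\<^sub>R feature F x)"

lemma exp_family_feature: "exp_family C F \<psi> \<theta> $ x = exp (C x + feature F x \<bullet> \<theta> - \<psi> \<theta>)"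
  by (simp add: exp_family_def feature_def inner_vec_def)

lemma lin_indep_feature:
  fixes F :: "'n::finite \<Rightarrow> 'x \<Rightarrow> real"
  assumes "lin_indep_with_1 F" "\<And>x. feature F x \<bullet> a = b"
  shows "a = 0 \<and> b = 0"
proof -
  have "- b + (\<Sum>i\<in>UNIV. a $ i * F i x) = 0" for x
    using assms(2)[of x] by (simp add: feature_def inner_vec_def mult.commute)
  then have "- b = 0 \<and> (\<forall>i. a $ i = 0)"
    using assms(1) unfolding lin_indep_with_1_def by blast
  then show ?thesis by (simp add: vec_eq_iff)
qed

context
  fixes C :: "'x::finite \<Rightarrow> real" and F :: "'n::finite \<Rightarrow> 'x \<Rightarrow> real" and \<psi> :: "real^'n \<Rightarrow> real"
    and P :: "real^'n \<Rightarrow> real^'x" and f :: "'x \<Rightarrow> real^'n" and \<mu> :: "real^'n \<Rightarrow> real^'n"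
  defines "P \<equiv> exp_family C F \<psi>" and "f \<equiv> feature F" and "\<mu> \<equiv> mean C F \<psi>"
  assumes norm1: "\<And>\<theta>. (\<Sum>x\<in>UNIV. exp_family C F \<psi> \<theta> $ x) = 1"
begin

lemma exp_family_pos: "0 < P \<theta> $ x"
  by (simp add: P_def exp_family_feature)

lemma exp_log_partition: "exp (\<psi> \<theta>) = (\<Sum>x\<in>UNIV. exp (C x + f x \<bullet> \<theta>))"
proof -
  have "exp (\<psi> \<theta>) = exp (\<psi> \<theta>) * (\<Sum>x\<in>UNIV. P \<theta> $ x)" using norm1 by (simp add: P_def)
  also have "\<dots> = (\<Sum>x\<in>UNIV. exp (C x + f x \<bullet> \<theta>))"
    unfolding sum_distrib_left P_def f_def exp_family_feature
    by (intro sum.cong) (auto simp: exp_add[symmetric])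
  finally show ?thesis .
qed

lemma log_partition_has_derivative: "(\<psi> has_derivative (\<lambda>v. \<mu> \<theta> \<bullet> v)) (at \<theta>)"
proof -
  have \<psi>: "\<psi> = (\<lambda>\<theta>. ln (\<Sum>x\<in>UNIV. exp (C x + f x \<bullet> \<theta>)))"
    by (auto simp: exp_log_partition[symmetric])
  have pos: "0 < (\<Sum>x\<in>UNIV. exp (C x + f x \<bullet> \<theta>))"
    unfolding exp_log_partition[symmetric] by simp
  have "(\<psi> has_derivative (\<lambda>v. (\<Sum>x\<in>UNIV. exp (C x + f x \<bullet> \<theta>) * (f x \<bullet> v)) / exp (\<psi> \<theta>))) (at \<theta>)"
    unfolding exp_log_partition
    by (subst \<psi>) (use pos in \<open>auto intro!: derivative_eq_intros simp: divide_inverse mult.commute\<close>)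
  also have "(\<lambda>v. (\<Sum>x\<in>UNIV. exp (C x + f x \<bullet> \<theta>) * (f x \<bullet> v)) / exp (\<psi> \<theta>)) = (\<lambda>v. \<mu> \<theta> \<bullet> v)"
    unfolding \<mu>_def mean_def inner_sum_left sum_divide_distrib
    by (intro ext sum.cong) (auto simp: exp_family_feature f_def exp_diff)
  finally show ?thesis .
qed

lemma exp_family_has_derivative:
  "((\<lambda>\<theta>. P \<theta> $ x) has_derivative (\<lambda>v. P \<theta> $ x * ((f x - \<mu> \<theta>) \<bullet> v))) (at \<theta>)"
  unfolding P_def exp_family_feature f_def[symmetric]
  by (auto intro!: derivative_eq_intros log_partition_has_derivative simp: inner_diff_left)

lemma exp_family_centered: "(\<Sum>x\<in>UNIV. P \<theta> $ x *\<^sub>R (f x - \<mu> \<theta>)) = 0"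
proof -
  have "(\<Sum>x\<in>UNIV. P \<theta> $ x *\<^sub>R (f x - \<mu> \<theta>)) = \<mu> \<theta> - (\<Sum>x\<in>UNIV. P \<theta> $ x) *\<^sub>R \<mu> \<theta>"
    by (simp add: \<mu>_def mean_def P_def f_def algebra_simps sum_subtractf scaleR_sum_left)
  then show ?thesis using norm1 by (simp add: P_def)
qed

text \<open>The logarithmic derivatives of the densities are the centered features, so the Fisher matrix is the
  covariance matrix of the feature vector.\<close>

lemma fisher_mult_eq_covariance:
  "fisher P \<theta> *v v = (\<Sum>x\<in>UNIV. (P \<theta> $ x * ((f x - \<mu> \<theta>) \<bullet> v)) *\<^sub>R (f x - \<mu> \<theta>))"
proof -
  have "((\<lambda>\<theta>. ln (P \<theta> $ x)) has_derivative (\<lambda>v. (f x - \<mu> \<theta>) \<bullet> v)) (at \<theta>)" for x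
    using exp_family_pos[of \<theta> x]
    by (auto intro!: derivative_eq_intros exp_family_has_derivative)
  then have D: "frechet_derivative (\<lambda>\<theta>. ln (P \<theta> $ x)) (at \<theta>) = (\<lambda>v. (f x - \<mu> \<theta>) \<bullet> v)" for x
    using frechet_derivative_at by metis
  have "fisher P \<theta> $ i $ j = (\<Sum>x\<in>UNIV. P \<theta> $ x * (f x - \<mu> \<theta>) $ i * (f x - \<mu> \<theta>) $ j)" for i j
    by (simp add: fisher_def D inner_axis)
  then show ?thesis
    by (simp add: vec_eq_iff matrix_vector_mult_def inner_vec_def sum_distrib_right sum_distrib_left)
       (subst sum.swap, auto intro!: sum.cong simp: algebra_simps)
qed

text \<open>The Fisher matrix is the Jacobian of the mean; this is what turns the equation for the momentum map
  into one that can be integrated.\<close>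

lemma mean_has_derivative: "(\<mu> has_derivative (\<lambda>v. fisher P \<theta> *v v)) (at \<theta>)"
proof -
  have "(\<mu> has_derivative (\<lambda>v. \<Sum>x\<in>UNIV. (P \<theta> $ x * ((f x - \<mu> \<theta>) \<bullet> v)) *\<^sub>R f x)) (at \<theta>)"
    unfolding \<mu>_def mean_def[abs_def] P_def[symmetric] f_def[symmetric]
    by (rule has_derivative_eq_rhs,
        (rule has_derivative_sum has_derivative_scaleR_left exp_family_has_derivative)+)
       (simp add: \<mu>_def mean_def P_def f_def)
  also have "(\<lambda>v. \<Sum>x\<in>UNIV. (P \<theta> $ x * ((f x - \<mu> \<theta>) \<bullet> v)) *\<^sub>R f x) = (\<lambda>v. fisher P \<theta> *v v)"
  proof
    fix v
    have "(\<Sum>x\<in>UNIV. P \<theta> $ x * ((f x - \<mu> \<theta>) \<bullet> v)) = (\<Sum>x\<in>UNIV. P \<theta> $ x *\<^sub>R (f x - \<mu> \<theta>)) \<bullet> v"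
      by (simp add: inner_sum_left)
    then have "(\<Sum>x\<in>UNIV. (P \<theta> $ x * ((f x - \<mu> \<theta>) \<bullet> v)) *\<^sub>R \<mu> \<theta>) = 0"
      by (simp add: scaleR_sum_left[symmetric] exp_family_centered)
    then show "(\<Sum>x\<in>UNIV. (P \<theta> $ x * ((f x - \<mu> \<theta>) \<bullet> v)) *\<^sub>R f x) = fisher P \<theta> *v v"
      unfolding fisher_mult_eq_covariance scaleR_diff_right sum_subtractf by simp
  qed
  finally show ?thesis .
qed

text \<open>Along a line, \<open>S 0\<close> is the partition function up to a constant factor and the Fisher metric in the
  direction of the line is \<open>(log S 0)''\<close>, here written without denominators.\<close>

lemma fisher_along_line:
  fixes s :: real and e \<theta> :: "real^'n"
  defines "S \<equiv> \<lambda>k::nat. \<Sum>x\<in>UNIV. (f x \<bullet> e) ^ k * (exp (C x + f x \<bullet> \<theta>) * exp ((f x \<bullet> e) * s))"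
  shows "e \<bullet> (fisher P (\<theta> + s *\<^sub>R e) *v e) * S 0 ^ 2 = S 2 * S 0 - S 1 ^ 2"
proof -
  define \<theta>' where "\<theta>' = \<theta> + s *\<^sub>R e"
  have S_eq: "S k = (\<Sum>x\<in>UNIV. (f x \<bullet> e) ^ k * (exp (C x + f x \<bullet> \<theta>) * exp ((f x \<bullet> e) * s)))" for k
    by (simp add: S_def)
  have S0: "S 0 = exp (\<psi> \<theta>')"
    unfolding exp_log_partition S_def \<theta>'_def
    by (intro sum.cong) (auto simp: exp_add[symmetric] inner_add_right algebra_simps)
  have p: "P \<theta>' $ x * S 0 = exp (C x + f x \<bullet> \<theta>) * exp ((f x \<bullet> e) * s)" for x
    unfolding S0 P_def exp_family_feature f_def[symmetric] exp_add[symmetric]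
    by (simp add: \<theta>'_def inner_add_right algebra_simps)
  have m: "(\<mu> \<theta>' \<bullet> e) * S 0 = S 1"
    unfolding S_eq[of 1] p[symmetric]
    by (simp add: \<mu>_def mean_def P_def f_def inner_sum_left sum_distrib_left sum_distrib_right algebra_simps)
  have q: "(\<Sum>x\<in>UNIV. P \<theta>' $ x * (f x \<bullet> e)\<^sup>2) * S 0 = S 2"
    unfolding S_eq[of 2] p[symmetric] by (simp add: sum_distrib_left sum_distrib_right algebra_simps)
  have "e \<bullet> (fisher P \<theta>' *v e) = (\<Sum>x\<in>UNIV. P \<theta>' $ x * ((f x - \<mu> \<theta>') \<bullet> e)\<^sup>2)"
    unfolding fisher_mult_eq_covariance inner_sum_right
    by (intro sum.cong) (auto simp: power2_eq_square inner_commute)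
  also have "\<dots> = (\<Sum>x\<in>UNIV. P \<theta>' $ x * (f x \<bullet> e)\<^sup>2) - 2 * (\<mu> \<theta>' \<bullet> e) * (\<Sum>x\<in>UNIV. P \<theta>' $ x * (f x \<bullet> e))
      + (\<mu> \<theta>' \<bullet> e)\<^sup>2 * (\<Sum>x\<in>UNIV. P \<theta>' $ x)"
    unfolding sum_distrib_left sum_subtractf[symmetric] sum.distrib[symmetric]
    by (intro sum.cong) (auto simp: inner_diff_left power2_eq_square algebra_simps)
  also have "(\<Sum>x\<in>UNIV. P \<theta>' $ x * (f x \<bullet> e)) = \<mu> \<theta>' \<bullet> e"
    by (simp add: \<mu>_def mean_def P_def f_def inner_sum_left)
  also have "(\<Sum>x\<in>UNIV. P \<theta>' $ x) = 1" using norm1 by (simp add: P_def)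
  finally have "e \<bullet> (fisher P \<theta>' *v e) = (\<Sum>x\<in>UNIV. P \<theta>' $ x * (f x \<bullet> e)\<^sup>2) - (\<mu> \<theta>' \<bullet> e)\<^sup>2"
    by (simp add: power2_eq_square)
  then have "e \<bullet> (fisher P \<theta>' *v e) * S 0 ^ 2
      = ((\<Sum>x\<in>UNIV. P \<theta>' $ x * (f x \<bullet> e)\<^sup>2) * S 0) * S 0 - ((\<mu> \<theta>' \<bullet> e) * S 0)\<^sup>2"
    by (simp only: left_diff_distrib power_mult_distrib) (simp add: power2_eq_square)
  then show ?thesis unfolding q m by (simp add: \<theta>'_def)
qed

lemma inj_exp_family:
  assumes "lin_indep_with_1 F"
  shows "inj P"
proof
  fix \<theta> \<theta>' assume "P \<theta> = P \<theta>'"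
  then have "C x + f x \<bullet> \<theta> - \<psi> \<theta> = C x + f x \<bullet> \<theta>' - \<psi> \<theta>'" for x
    by (metis P_def f_def exp_family_feature exp_inj_iff)
  then have "feature F x \<bullet> (\<theta> - \<theta>') = \<psi> \<theta> - \<psi> \<theta>'" for x
    by (simp add: f_def inner_diff_right algebra_simps)
  from lin_indep_feature[OF assms this] show "\<theta> = \<theta>'" by simp
qed

lemma mean_in_convex_hull: "\<mu> \<theta> \<in> convex hull (range f)"
  unfolding \<mu>_def mean_def P_def[symmetric] f_def[symmetric]
  using norm1 exp_family_pos[THEN less_imp_le]
  by (intro convex_sum convex_convex_hull) (auto simp: P_def hull_inc)

lemma interior_convex_hull_features:
  assumes "lin_indep_with_1 F"
  shows "interior (convex hull (range f)) \<noteq> {}"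
proof
  assume "interior (convex hull (range f)) = {}"
  then obtain a b where ab: "a \<noteq> 0" "convex hull (range f) \<subseteq> {x. a \<bullet> x = b}"
    using empty_interior_subset_hyperplane[OF convex_convex_hull] by metis
  then have "feature F x \<bullet> a = b" for x
    using subsetD[OF ab(2) hull_inc[of "f x"]] by (simp add: f_def inner_commute)
  from lin_indep_feature[OF assms this] ab(1) show False by simp
qed

text \<open>An interior point \<open>y\<close> of the hull of the features is the mean at a minimum of \<open>\<psi> \<theta> - y \<bullet> \<theta>\<close>, whose
  gradient is \<open>\<mu> \<theta> - y\<close>.  The minimum exists because this function grows at least linearly: in the
  direction of \<open>\<theta>\<close> some feature lies beyond \<open>y\<close> by the radius of a ball around \<open>y\<close> in the hull.\<close>

lemma interior_convex_hull_subset_range_mean: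
  "interior (convex hull (range f)) \<subseteq> range \<mu>"
proof
  fix y assume "y \<in> interior (convex hull (range f))"
  then obtain \<delta> where \<delta>: "0 < \<delta>" "cball y \<delta> \<subseteq> convex hull (range f)"
    using mem_interior_cball by blast
  define G where "G = (\<lambda>\<theta>. \<psi> \<theta> - y \<bullet> \<theta>)"
  define m where "m = Min (range C)"
  have G_ge: "m + \<delta> * norm \<theta> \<le> G \<theta>" for \<theta>
  proof -
    have "\<exists>x. y \<bullet> \<theta> + \<delta> * norm \<theta> \<le> f x \<bullet> \<theta>"
    proof (rule ccontr)
      assume "\<not> ?thesis"
      then have "range f \<subseteq> {z. \<theta> \<bullet> z < y \<bullet> \<theta> + \<delta> * norm \<theta>}" by (auto simp: inner_commute not_le)
      then have "convex hull (range f) \<subseteq> {z. \<theta> \<bullet> z < y \<bullet> \<theta> + \<delta> * norm \<theta>}"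
        by (rule hull_minimal) (rule convex_halfspace_lt)
      moreover have "y + \<delta> *\<^sub>R sgn \<theta> \<in> cball y \<delta>" using \<open>0 < \<delta>\<close> by (simp add: dist_norm norm_sgn)
      ultimately have "\<theta> \<bullet> (y + \<delta> *\<^sub>R sgn \<theta>) < y \<bullet> \<theta> + \<delta> * norm \<theta>" using \<delta>(2) by blast
      moreover have "\<theta> \<bullet> sgn \<theta> = norm \<theta>"
        by (cases "\<theta> = 0") (simp_all add: sgn_div_norm power2_norm_eq_inner[symmetric] power2_eq_square)
      ultimately show False by (simp add: inner_add_right inner_commute)
    qed
    then obtain x where x: "y \<bullet> \<theta> + \<delta> * norm \<theta> \<le> f x \<bullet> \<theta>" by blast
    have "exp (C x + f x \<bullet> \<theta>) \<le> exp (\<psi> \<theta>)"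
      unfolding exp_log_partition by (rule member_le_sum) auto
    moreover have "m \<le> C x" unfolding m_def by (intro Min_le) auto
    ultimately show ?thesis using x by (simp add: G_def)
  qed
  \<comment> \<open>Outside the ball of radius \<open>R\<close> the lower bound exceeds \<open>G 0\<close>.\<close>
  define R where "R = (\<bar>G 0 - m\<bar> + 1) / \<delta>"
  have "0 < R" using \<open>0 < \<delta>\<close> by (simp add: R_def)
  have G': "(G has_derivative (\<lambda>v. (\<mu> \<theta> - y) \<bullet> v)) (at \<theta>)" for \<theta>
    unfolding G_def by (auto intro!: derivative_eq_intros log_partition_has_derivative simp: inner_diff_left)
  have "continuous_on (cball 0 R) G"
    using G' by (intro continuous_at_imp_continuous_on ballI) (rule has_derivative_continuous)
  then obtain \<theta> where \<theta>: "\<theta> \<in> cball 0 R" "\<And>\<theta>'. \<theta>' \<in> cball 0 R \<Longrightarrow> G \<theta> \<le> G \<theta>'"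
    using continuous_attains_inf[of "cball 0 R" G] \<open>0 < R\<close> by (auto simp del: mem_cball)
  have "G \<theta> \<le> G \<theta>'" for \<theta>'
  proof (cases "\<theta>' \<in> cball 0 R")
    case False
    then have "R < norm \<theta>'" by simp
    then have "\<delta> * R < \<delta> * norm \<theta>'" using \<open>0 < \<delta>\<close> by simp
    then have "G 0 \<le> G \<theta>'" using G_ge[of \<theta>'] \<open>0 < \<delta>\<close> by (simp add: R_def)
    moreover have "G \<theta> \<le> G 0" using \<open>0 < R\<close> by (intro \<theta>(2)) auto
    ultimately show ?thesis by simp
  qed (use \<theta> in blast)
  then have "(\<lambda>v. (\<mu> \<theta> - y) \<bullet> v) = (\<lambda>v. 0)"
    by (intro differential_zero_maxmin[OF _ open_UNIV G']) auto
  then have "(\<mu> \<theta> - y) \<bullet> (\<mu> \<theta> - y) = 0" by meson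
  then show "y \<in> range \<mu>" by (metis inner_eq_zero_iff right_minus_eq rangeI)
qed

lemma closure_range_mean:
  assumes "lin_indep_with_1 F"
  shows "closure (range \<mu>) = convex hull (range f)"
proof
  have "closed (convex hull (range f))"
    by (intro compact_imp_closed compact_convex_hull finite_imp_compact) auto
  then show "closure (range \<mu>) \<subseteq> convex hull (range f)"
    using mean_in_convex_hull by (intro closure_minimal) auto
  have "convex hull (range f) \<subseteq> closure (interior (convex hull (range f)))"
    using convex_closure_interior[OF convex_convex_hull interior_convex_hull_features[OF assms]]
      closure_subset by blast
  also have "\<dots> \<subseteq> closure (range \<mu>)"
    by (rule closure_mono) (rule interior_convex_hull_subset_range_mean)
  finally show "convex hull (range f) \<subseteq> closure (range \<mu>)" .
qed

end

section \<open>Torsion in closed groups containing the integer lattice\<close>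

lemma int_vec_add: "k \<in> int_vec \<Longrightarrow> l \<in> int_vec \<Longrightarrow> k + l \<in> int_vec"
  and int_vec_minus: "k \<in> int_vec \<Longrightarrow> - k \<in> int_vec"
  and int_vec_diff: "k \<in> int_vec \<Longrightarrow> l \<in> int_vec \<Longrightarrow> k - l \<in> int_vec"
  and int_vec_0: "0 \<in> int_vec"
  by (auto simp: int_vec_def)

lemma torus_pt_eq_iff: "torus_pt s = torus_pt t \<longleftrightarrow> s - t \<in> int_vec"
proof
  assume "torus_pt s = torus_pt t"
  then have "s \<in> torus_pt t" using int_vec_0 unfolding torus_pt_def by force
  then show "s - t \<in> int_vec" by (auto simp: torus_pt_def)
next
  assume k: "s - t \<in> int_vec"
  have "s + l = t + (l + (s - t))" "t + l = s + (l - (s - t))" for l by simp_all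
  then show "torus_pt s = torus_pt t"
    unfolding torus_pt_def using k int_vec_add int_vec_diff by blast
qed

definition additive_subgroup :: "'a::ab_group_add set \<Rightarrow> bool" where
  "additive_subgroup H \<longleftrightarrow> 0 \<in> H \<and> (\<forall>x\<in>H. \<forall>y\<in>H. x + y \<in> H) \<and> (\<forall>x\<in>H. - x \<in> H)"

lemma additive_subgroup_diff: "additive_subgroup H \<Longrightarrow> x \<in> H \<Longrightarrow> y \<in> H \<Longrightarrow> x - y \<in> H"
  unfolding additive_subgroup_def by (metis diff_conv_add_uminus)

lemma additive_subgroup_of_int_scale:
  fixes H :: "'a::real_vector set"
  assumes H: "additive_subgroup H" "x \<in> H"
  shows "of_int k *\<^sub>R x \<in> H"
proof -
  have nat: "of_nat n *\<^sub>R x \<in> H" for n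
    by (induction n) (use H in \<open>auto simp: additive_subgroup_def scaleR_add_left\<close>)
  show ?thesis
  proof (cases "0 \<le> k")
    case True
    then show ?thesis using nat[of "nat k"] by simp
  next
    case False
    then have "of_int k *\<^sub>R x = - (of_nat (nat (- k)) *\<^sub>R x)" by simp
    then show ?thesis using nat H by (metis additive_subgroup_def)
  qed
qed

text \<open>A limit \<open>u\<close> of the directions of smaller and smaller elements works: integer multiples of these
  elements come arbitrarily close to any given point of the line through \<open>u\<close>.\<close>

lemma closed_subgroup_contains_line:
  fixes H :: "'a::euclidean_space set"
  assumes H: "closed H" "additive_subgroup H" and W: "subspace W"
    and small: "\<And>e. 0 < e \<Longrightarrow> \<exists>h\<in>H \<inter> W. h \<noteq> 0 \<and> norm h < e"
  obtains u where "u \<in> W" "u \<noteq> 0" "\<And>s. s *\<^sub>R u \<in> H"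
proof -
  have "\<exists>h. \<forall>j. h j \<in> H \<inter> W \<and> h j \<noteq> 0 \<and> norm (h j) < 1 / real (Suc j)"
    using small by (intro choice) (metis divide_pos_pos of_nat_0_less_iff zero_less_Suc zero_less_one)
  then obtain h where h: "\<And>j::nat. h j \<in> H \<inter> W" "\<And>j. h j \<noteq> 0" "\<And>j. norm (h j) < 1 / real (Suc j)"
    by blast
  have "sgn (h j) \<in> sphere 0 1" for j using h(2) by (simp add: norm_sgn)
  then obtain u r where u: "u \<in> sphere 0 1" "strict_mono r" "((sgn \<circ> h) \<circ> r) \<longlonglongrightarrow> u"
    using compact_sphere[of "0::'a" 1] unfolding compact_def by (metis comp_apply)
  have hr: "(\<lambda>j. norm (h (r j))) \<longlonglongrightarrow> 0"
  proof (rule tendsto_sandwich[OF _ _ tendsto_const])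
    show "(\<lambda>j. 1 / real (Suc (r j))) \<longlonglongrightarrow> 0"
      using LIMSEQ_subseq_LIMSEQ[OF LIMSEQ_inverse_real_of_nat u(2)] by (simp add: o_def inverse_eq_divide)
  qed (use h(3) in \<open>auto intro!: always_eventually less_imp_le\<close>)
  show thesis
  proof (rule that[of u])
    show "u \<in> W"
      by (rule closed_sequentially[OF closed_subspace[OF W] _ u(3)])
         (use h(1) W in \<open>auto simp: sgn_div_norm subspace_scale\<close>)
    show "u \<noteq> 0" using u(1) by auto
    fix s :: real
    define g where "g j = of_int \<lfloor>s / norm (h (r j))\<rfloor> *\<^sub>R h (r j)" for j
    have "g \<longlonglongrightarrow> s *\<^sub>R u"
    proof (rule Lim_transform2)
      show "(\<lambda>j. s *\<^sub>R sgn (h (r j))) \<longlonglongrightarrow> s *\<^sub>R u"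
        using u(3) by (intro tendsto_intros) (simp add: o_def)
      have "norm (s *\<^sub>R sgn (h (r j)) - g j) \<le> norm (h (r j))" for j
      proof -
        have "s *\<^sub>R sgn (h (r j)) - g j = frac (s / norm (h (r j))) *\<^sub>R h (r j)"
          by (simp add: g_def frac_def sgn_div_norm algebra_simps divide_inverse)
        then show ?thesis
          using mult_right_mono[of "frac (s / norm (h (r j)))" 1 "norm (h (r j))"] frac_lt_1[of "s / norm (h (r j))"]
          by (simp add: less_imp_le)
      qed
      then show "(\<lambda>j. s *\<^sub>R sgn (h (r j)) - g j) \<longlonglongrightarrow> 0"
        by (intro Lim_null_comparison[OF _ hr] always_eventually) auto
    qed
    then show "s *\<^sub>R u \<in> H"
      by (rule closed_sequentially[OF H(1), rotated])
         (use h(1) additive_subgroup_of_int_scale[OF H(2)] in \<open>auto simp: g_def\<close>)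
  qed
qed

lemma Dirichlet_approx_vector:
  fixes w :: "real^'n::finite"
  assumes "0 < e"
  obtains q :: int and k where "0 < q" "k \<in> int_vec" "norm (of_int q *\<^sub>R w - k) < e"
proof -
  obtain en :: "nat \<Rightarrow> 'n" where en: "bij_betw en {..<CARD('n)} UNIV"
    using ex_bij_betw_nat_finite[of "UNIV::'n set"] by (auto simp: atLeast0LessThan)
  obtain N :: nat where N: "real CARD('n) / e < real N" using reals_Archimedean2 by blast
  then have "0 < N" using \<open>0 < e\<close> by (cases N) (auto simp: divide_less_0_iff)
  obtain q p where q: "0 < q" "\<And>i. i < CARD('n) \<Longrightarrow> \<bar>of_int q * w $ en i - of_int (p i)\<bar> < 1 / N"
    using Dirichlet_approx_simult[OF \<open>0 < N\<close>, where \<theta> = "\<lambda>i. w $ en i" and n = "CARD('n)"] by metis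
  define k :: "real^'n" where "k = (\<chi> i. of_int (p (inv_into {..<CARD('n)} en i)))"
  have "\<bar>(of_int q *\<^sub>R w - k) $ i\<bar> \<le> 1 / N" for i
  proof -
    have "en (inv_into {..<CARD('n)} en i) = i" "inv_into {..<CARD('n)} en i < CARD('n)"
      using en bij_betw_inv_into_right[OF en, of i] inv_into_into[of i en "{..<CARD('n)}"]
      by (auto simp: bij_betw_def)
    then show ?thesis using q(2)[of "inv_into {..<CARD('n)} en i"] by (simp add: k_def)
  qed
  then have "norm (of_int q *\<^sub>R w - k) \<le> real CARD('n) * (1 / N)"
    using norm_le_l1_cart[of "of_int q *\<^sub>R w - k"] sum_bounded_above[of UNIV "\<lambda>i. \<bar>(of_int q *\<^sub>R w - k) $ i\<bar>" "1 / N"]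
    by simp
  also have "\<dots> < e" using N \<open>0 < e\<close> \<open>0 < N\<close> by (simp add: field_simps)
  finally show thesis using that[of q k] q(1) by (auto simp: k_def int_vec_def)
qed

text \<open>Modulo the integer lattice, \<open>H\<close> is a nontrivial closed subgroup of the torus.  If its element \<open>t\<close> has
  infinite order there, the multiples of \<open>t\<close> accumulate, so
  \<open>H\<close> contains lines; let \<open>V\<close> be the union of all of them, a subspace.  Orthogonally to \<open>V\<close> the group \<open>H\<close>
  is discrete, by maximality of \<open>V\<close>, so every sufficiently small element of \<open>H\<close> lies in \<open>V\<close>.
  Approximating multiples of a vector of \<open>V\<close> by integer vectors, the small error therefore lies in \<open>V\<close>,
  and with it a nonzero integer vector.  Since \<open>V\<close> is a subspace inside \<open>H\<close>, all rational multiples of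
  that vector are in \<open>H\<close>.\<close>

lemma closed_supgroup_int_vec_has_torsion:
  fixes H :: "(real^'n::finite) set"
  assumes H: "closed H" "additive_subgroup H" "int_vec \<subseteq> H" and t: "t \<in> H" "t \<notin> int_vec"
  obtains v N where "v \<in> H" "v \<notin> int_vec" "0 < (N::nat)" "of_nat N *\<^sub>R v \<in> int_vec"
proof (cases "\<exists>N>0. of_nat N *\<^sub>R t \<in> int_vec")
  case True
  then show thesis using t that by blast
next
  case False
  define V where "V = {v. \<forall>s. s *\<^sub>R v \<in> H}"
  have V: "subspace V" "V \<subseteq> H"
    using H(2) unfolding V_def subspace_def additive_subgroup_def
    by (auto simp: scaleR_add_right) (metis scaleR_one)
  have V_max: "\<exists>e>0. \<forall>h\<in>H \<inter> orthogonal_comp V. norm h < e \<longrightarrow> h = 0"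
  proof (rule ccontr)
    assume "\<not> ?thesis"
    then obtain u where u: "u \<in> orthogonal_comp V" "u \<noteq> 0" "\<And>s. s *\<^sub>R u \<in> H"
      using closed_subgroup_contains_line[OF H(1,2) subspace_orthogonal_comp[of V]] by blast
    then have "u \<in> V" by (simp add: V_def)
    then have "u \<bullet> u = 0" using u(1) by (auto simp: orthogonal_comp_def orthogonal_def)
    then show False using u(2) by simp
  qed
  then obtain e0 where e0: "0 < e0" "\<And>h. h \<in> H \<Longrightarrow> h \<in> orthogonal_comp V \<Longrightarrow> norm h < e0 \<Longrightarrow> h = 0"
    by blast
  have small_in_V: "h \<in> V" if h: "h \<in> H" "norm h < e0" for h
  proof -
    obtain a b where ab: "a \<in> span V" "\<And>w. w \<in> span V \<Longrightarrow> orthogonal b w" "h = a + b"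
      using orthogonal_subspace_decomp_exists[of V h] by metis
    have "a \<in> V" using ab(1) V(1) by (simp add: span_eq_iff[THEN iffD2])
    then have "b \<in> H" using ab(3) h(1) V(2) additive_subgroup_diff[OF H(2), of h a] by auto
    moreover have "b \<in> orthogonal_comp V"
      using ab(2) by (auto simp: orthogonal_comp_def span_base orthogonal_commute)
    moreover have "norm b \<le> norm h"
    proof -
      have "orthogonal a b" using ab(1,2) by (simp add: orthogonal_commute)
      then have "(norm h)\<^sup>2 = (norm a)\<^sup>2 + (norm b)\<^sup>2" unfolding ab(3) by (rule norm_add_Pythagorean)
      then show ?thesis by (intro power2_le_imp_le[of "norm b"]) auto
    qed
    ultimately have "b = 0" using e0(2) h(2) by simp
    then show ?thesis using ab(3) \<open>a \<in> V\<close> by simp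
  qed
  obtain q k where qk: "0 < q" "k \<in> int_vec" "norm (of_int q *\<^sub>R t - k) < e0"
    using Dirichlet_approx_vector[OF e0(1)] by metis
  define u where "u = of_int q *\<^sub>R t - k"
  have "u \<in> V"
    unfolding u_def using qk H(3) t(1) additive_subgroup_of_int_scale[OF H(2)]
    by (intro small_in_V additive_subgroup_diff[OF H(2)]) auto
  have "u \<noteq> 0"
  proof
    assume "u = 0"
    then have "of_nat (nat q) *\<^sub>R t \<in> int_vec" using qk(1,2) by (simp add: u_def)
    then show False using False qk(1) by (metis zero_less_nat_eq)
  qed
  \<comment> \<open>Norm \<open>2\<close> and an error below \<open>1\<close> keep the approximating integer vector away from \<open>0\<close>.\<close>
  define w where "w = (2 / norm u) *\<^sub>R u"
  have w: "w \<in> V" "norm w = 2"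
    using \<open>u \<in> V\<close> \<open>u \<noteq> 0\<close> V(1) by (auto simp: w_def subspace_scale)
  obtain q' k' where qk': "0 < q'" "k' \<in> int_vec" "norm (of_int q' *\<^sub>R w - k') < min e0 1"
    using Dirichlet_approx_vector[of "min e0 1" w] e0(1) by auto
  have qw: "of_int q' *\<^sub>R w \<in> V" using w V(1) by (simp add: subspace_scale)
  have "of_int q' *\<^sub>R w - k' \<in> V"
    using qk' qw V(2) H(3) by (intro small_in_V additive_subgroup_diff[OF H(2)]) auto
  then have "k' \<in> V" using subspace_diff[OF V(1) qw] by fastforce
  have "k' \<noteq> 0"
  proof
    assume "k' = 0"
    then have "2 * of_int q' < (1::real)" using qk' w by simp
    then show False using qk'(1) by linarith
  qed
  then obtain i where i: "k' $ i \<noteq> 0" by (auto simp: vec_eq_iff)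
  obtain c :: int where c: "k' $ i = of_int c" using qk'(2) by (auto simp: int_vec_def Ints_def)
  define v where "v = (1 / (2 * k' $ i)) *\<^sub>R k'"
  show thesis
  proof
    show "v \<in> H" using \<open>k' \<in> V\<close> by (simp add: v_def V_def)
    have "v $ i = 1 / 2" using i by (simp add: v_def)
    moreover have "(1 / 2 :: real) \<notin> \<int>"
    proof
      assume "(1 / 2 :: real) \<in> \<int>"
      then obtain z where "(1 / 2 :: real) = of_int z" by (elim Ints_cases)
      then have "real_of_int (2 * z) = of_int 1" by simp
      then have "2 * z = 1" by (simp only: of_int_eq_iff)
      then show False by presburger
    qed
    ultimately show "v \<notin> int_vec" unfolding int_vec_def by (metis mem_Collect_eq)
    show "0 < nat (2 * \<bar>c\<bar>)" using i c by simp
    have "of_nat (nat (2 * \<bar>c\<bar>)) *\<^sub>R v = k' \<or> of_nat (nat (2 * \<bar>c\<bar>)) *\<^sub>R v = - k'"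
      using i c by (auto simp: v_def abs_if)
    then show "of_nat (nat (2 * \<bar>c\<bar>)) *\<^sub>R v \<in> int_vec" using qk'(2) int_vec_minus by metis
  qed
qed

lemma countable_torsion_vectors:
  "countable {v::real^'n::finite. \<exists>N>0. of_nat N *\<^sub>R v \<in> int_vec}"
proof -
  have "{v::real^'n. \<exists>N>0. of_nat N *\<^sub>R v \<in> int_vec} \<subseteq>
      range (\<lambda>(k :: 'n \<Rightarrow> int, N :: nat). \<chi> i. of_int (k i) / real N)"
  proof
    fix v :: "real^'n" assume "v \<in> {v. \<exists>N>0. of_nat N *\<^sub>R v \<in> int_vec}"
    then obtain N :: nat where N: "0 < N" "\<And>i. \<exists>k. real N * v $ i = of_int k"
      by (auto simp: int_vec_def) (metis Ints_cases)
    then obtain k where "\<And>i. real N * v $ i = of_int (k i)" by metis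
    then have "v = (\<chi> i. of_int (k i) / real N)" using N(1) by (simp add: vec_eq_iff field_simps)
    then show "v \<in> range (\<lambda>(k :: 'n \<Rightarrow> int, N :: nat). \<chi> i. of_int (k i) / real N)" by auto
  qed
  then show ?thesis by (rule countable_subset) simp
qed

section \<open>Charts and the identity theorem\<close>

lemma has_field_derivative_along_line:
  fixes f :: "complex^'n::finite \<Rightarrow> complex^'m::finite"
  assumes "(f has_derivative D) (at (z + \<tau> *s w))" "\<And>c v. D (c *s v) = c *s D v"
  shows "((\<lambda>\<sigma>. f (z + \<sigma> *s w) $ i) has_field_derivative D w $ i) (at \<tau>)"
proof -
  have "bounded_linear (\<lambda>\<sigma>. \<sigma> *s w)"
    by (intro linear_conv_bounded_linear[THEN iffD1] linearI) (auto simp: vec_eq_iff algebra_simps)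
  then have "((\<lambda>\<sigma>. z + \<sigma> *s w) has_derivative (\<lambda>\<sigma>. \<sigma> *s w)) (at \<tau>)"
    by (auto intro!: derivative_eq_intros bounded_linear_imp_has_derivative)
  from has_derivative_compose[OF this assms(1)]
  have "((\<lambda>\<sigma>. f (z + \<sigma> *s w)) has_derivative (\<lambda>\<sigma>. \<sigma> *s D w)) (at \<tau>)"
    by (simp add: assms(2))
  from bounded_linear.has_derivative[OF bounded_linear_vec_nth this, of i]
  show ?thesis by (simp add: has_field_derivative_def mult.commute[of "D w $ i"] cong: if_cong)
     (simp add: mult_commute_abs)
qed

text \<open>Restrict both maps to the complex line through \<open>b\<close> and \<open>c\<close>, which meets the convex set \<open>B\<close> in a
  connected set.\<close>

lemma holo_on_identity_theorem:
  fixes f :: "complex^'n::finite \<Rightarrow> complex^'m::finite"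
  assumes f: "holo_on f B" and g: "holo_on g B" and B: "open B" "convex B"
    and U: "open U" "U \<subseteq> B" "b \<in> U" "\<And>z. z \<in> U \<Longrightarrow> f z = g z" and c: "c \<in> B"
  shows "f c = g c"
proof -
  define l where "l = (\<lambda>\<sigma>::complex. b + \<sigma> *s (c - b))"
  have bl: "linear (\<lambda>\<sigma>::complex. \<sigma> *s (c - b))"
    by (intro linearI) (auto simp: vec_eq_iff algebra_simps)
  then have "continuous_on UNIV l"
    unfolding l_def by (intro continuous_intros linear_continuous_on) (simp add: linear_conv_bounded_linear)
  then have op: "open (l -` X)" if "open X" for X
    using that by (simp add: open_vimage)
  have "convex (l -` B)"
  proof (rule convexI)
    fix x y :: complex and u v :: real
    assume *: "x \<in> l -` B" "y \<in> l -` B" "0 \<le> u" "0 \<le> v" "u + v = 1"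
    have "u *\<^sub>R l x + v *\<^sub>R l y = (u + v) *\<^sub>R b + (u *\<^sub>R x + v *\<^sub>R y) *s (c - b)"
      by (simp add: l_def vec_eq_iff algebra_simps)
    then have "l (u *\<^sub>R x + v *\<^sub>R y) = u *\<^sub>R l x + v *\<^sub>R l y"
      using *(5) by (simp add: l_def)
    then show "u *\<^sub>R x + v *\<^sub>R y \<in> l -` B" using convexD[OF B(2)] * by simp
  qed
  have hol: "(\<lambda>\<sigma>. h (l \<sigma>) $ i) holomorphic_on l -` B" if h: "holo_on h B" for h :: "complex^'n \<Rightarrow> complex^'m" and i
    unfolding holomorphic_on_open[OF op[OF B(1)]]
  proof
    fix \<sigma> assume "\<sigma> \<in> l -` B"
    then obtain D where "(h has_derivative D) (at (b + \<sigma> *s (c - b)))" "\<And>a v. D (a *s v) = a *s D v"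
      using h unfolding holo_on_def l_def by blast
    from has_field_derivative_along_line[OF this]
    show "\<exists>f'. ((\<lambda>\<sigma>. h (l \<sigma>) $ i) has_field_derivative f') (at \<sigma>)" unfolding l_def by blast
  qed
  have "f (l 1) $ i = g (l 1) $ i" for i
  proof (rule analytic_continuation_open[OF op[OF U(1)] op[OF B(1)] _ _ _ hol[OF f] hol[OF g]])
    have "0 \<in> l -` U" using U(3) by (simp add: l_def)
    then show "l -` U \<noteq> {}" by blast
    show "connected (l -` B)" using \<open>convex (l -` B)\<close> by (rule convex_connected)
    show "1 \<in> l -` B" using c by (simp add: l_def)
  qed (use U in auto)
  then show ?thesis by (simp add: l_def vec_eq_iff)
qed

lemma chart_maps:
  assumes "kaehler_manifold N" "(U, \<phi>) \<in> charts N"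
  shows chart_openin: "openin (ktop N) U" and chart_subset: "U \<subseteq> kspace N"
    and chart_open_image: "open (\<phi> ` U)" and chart_inj: "inj_on \<phi> U"
    and chart_continuous: "continuous_map (subtopology (ktop N) U) euclidean \<phi>"
    and chart_inv_continuous: "continuous_map (top_of_set (\<phi> ` U)) (ktop N) (inv_into U \<phi>)"
    and chart_openin_preimage: "\<And>X. open X \<Longrightarrow> openin (ktop N) {q \<in> U. \<phi> q \<in> X}"
    and chart_open_preimage: "\<And>W. openin (ktop N) W \<Longrightarrow> open {z \<in> \<phi> ` U. inv_into U \<phi> z \<in> W}"
proof -
  have U: "openin (ktop N) U" "open (\<phi> ` U)"
    and hom: "homeomorphic_map (subtopology (ktop N) U) (top_of_set (\<phi> ` U)) \<phi>"
    using assms unfolding kaehler_manifold_def complex_atlas_def by auto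
  show "openin (ktop N) U" "open (\<phi> ` U)" by fact+
  show sub: "U \<subseteq> kspace N" using U(1) by (rule openin_subset)
  then have tU: "topspace (subtopology (ktop N) U) = U" by auto
  show inj: "inj_on \<phi> U" using hom unfolding homeomorphic_map_def tU by simp
  have "continuous_map (subtopology (ktop N) U) (top_of_set (\<phi> ` U)) \<phi>"
    using hom homeomorphic_imp_continuous_map by blast
  then show cont: "continuous_map (subtopology (ktop N) U) euclidean \<phi>"
    by (simp add: continuous_map_in_subtopology)
  obtain g where g: "homeomorphic_maps (subtopology (ktop N) U) (top_of_set (\<phi> ` U)) \<phi> g"
    using hom homeomorphic_map_maps by blast
  then have g': "continuous_map (top_of_set (\<phi> ` U)) (subtopology (ktop N) U) g" "\<And>q. q \<in> U \<Longrightarrow> g (\<phi> q) = q"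
    using tU unfolding homeomorphic_maps_def by auto
  have "continuous_map (top_of_set (\<phi> ` U)) (subtopology (ktop N) U) (inv_into U \<phi>)"
    by (rule continuous_map_eq[OF g'(1)]) (use inj g'(2) in auto)
  then show cinv: "continuous_map (top_of_set (\<phi> ` U)) (ktop N) (inv_into U \<phi>)"
    by (rule continuous_map_into_fulltopology)
  show "openin (ktop N) {q \<in> U. \<phi> q \<in> X}" if "open X" for X
    using openin_continuous_map_preimage[OF cont, of X, unfolded tU] that U(1)
    by (intro openin_trans_full[OF _ U(1)]) simp
  show "open {z \<in> \<phi> ` U. inv_into U \<phi> z \<in> W}" if "openin (ktop N) W" for W
    using openin_continuous_map_preimage[OF cinv that] U(2) by (simp add: openin_open_eq)
qed

lemma chart_around:
  assumes "kaehler_manifold N" "p \<in> kspace N"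
  obtains U \<phi> where "(U, \<phi>) \<in> charts N" "p \<in> U"
  using assms unfolding kaehler_manifold_def complex_atlas_def by fastforce

lemma kaehler_locally_compact:
  assumes "kaehler_manifold N"
  shows "locally_compact_space (ktop N)"
  unfolding locally_compact_space_def
proof
  fix p assume "p \<in> kspace N"
  then obtain U \<phi> where U: "(U, \<phi>) \<in> charts N" "p \<in> U" using chart_around assms by metis
  note ch = chart_maps[OF assms U(1)]
  obtain e where e: "0 < e" "cball (\<phi> p) e \<subseteq> \<phi> ` U"
    using ch(3) U(2) open_contains_cball by (metis imageI)
  have "openin (ktop N) {q \<in> U. \<phi> q \<in> ball (\<phi> p) e}" by (rule ch(7)) simp
  moreover have "compactin (ktop N) (inv_into U \<phi> ` cball (\<phi> p) e)"
    by (rule image_compactin[OF _ ch(6)]) (use e in \<open>simp add: compactin_subtopology\<close>)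
  moreover have "{q \<in> U. \<phi> q \<in> ball (\<phi> p) e} \<subseteq> inv_into U \<phi> ` cball (\<phi> p) e"
  proof
    fix q assume "q \<in> {q \<in> U. \<phi> q \<in> ball (\<phi> p) e}"
    then have "q = inv_into U \<phi> (\<phi> q)" "\<phi> q \<in> cball (\<phi> p) e" using ch(4) by auto
    then show "q \<in> inv_into U \<phi> ` cball (\<phi> p) e" by blast
  qed
  ultimately show "\<exists>V K. openin (ktop N) V \<and> compactin (ktop N) K \<and> p \<in> V \<and> V \<subseteq> K"
    using U(2) e(1) by (intro exI[of _ "{q \<in> U. \<phi> q \<in> ball (\<phi> p) e}"]
        exI[of _ "inv_into U \<phi> ` cball (\<phi> p) e"]) auto
qed

text \<open>The interior of the fixed point set is closed: near a point of its closure, a chart turns the map into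
  a holomorphic map of a ball that is the identity on an open subset.\<close>

lemma holomorphic_map_eq_id_if_locally_id:
  assumes N: "kaehler_manifold N" "connected_space (ktop N)" and hol: "holomorphic_map N N f"
    and W: "openin (ktop N) W" "W \<noteq> {}" "\<And>q. q \<in> W \<Longrightarrow> f q = q" and p: "p \<in> kspace N"
  shows "f p = p"
proof -
  have Hd: "Hausdorff_space (ktop N)" using N(1) by (simp add: kaehler_manifold_def)
  have cont: "continuous_map (ktop N) (ktop N) f" using hol by (simp add: holomorphic_map_def)
  define Fx where "Fx = {q \<in> kspace N. f q = q}"
  have Fx: "closedin (ktop N) Fx"
    unfolding Fx_def by (rule closedin_continuous_maps_eq[OF Hd cont continuous_map_id, simplified])
  define A where "A = ktop N interior_of Fx"
  have "W \<subseteq> Fx" using W openin_subset[OF W(1)] by (auto simp: Fx_def)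
  then have A: "openin (ktop N) A" "A \<subseteq> Fx" "W \<subseteq> A"
    unfolding A_def using W(1) by (simp_all add: interior_of_subset interior_of_maximal)
  have "ktop N closure_of A \<subseteq> A"
  proof
    fix q assume q: "q \<in> ktop N closure_of A"
    have "q \<in> Fx" using q closure_of_minimal[OF A(2) Fx] by blast
    then have fq: "q \<in> kspace N" "f q = q" by (auto simp: Fx_def)
    obtain U \<phi> where U: "(U, \<phi>) \<in> charts N" "q \<in> U" using chart_around N(1) fq(1) by metis
    note ch = chart_maps[OF N(1) U(1)]
    define X where "X = {z \<in> \<phi> ` U. inv_into U \<phi> z \<in> {r \<in> kspace N. f r \<in> U}}"
    have "open X"
      unfolding X_def by (rule ch(8)) (rule openin_continuous_map_preimage[OF cont ch(1)])
    have Xeq: "X = \<phi> ` {r \<in> U. f r \<in> U}"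
      unfolding X_def using ch(2,4) by (auto simp: image_iff) 
    have "\<phi> q \<in> X" unfolding Xeq using U fq by auto
    then obtain e where e: "0 < e" "ball (\<phi> q) e \<subseteq> X" using \<open>open X\<close> open_contains_ball by blast
    have hg: "holo_on (\<phi> \<circ> f \<circ> inv_into U \<phi>) (ball (\<phi> q) e)"
      using hol U(1) e(2) unfolding holomorphic_map_def Xeq holo_on_def by blast
    have hid: "holo_on (\<lambda>z. z) (ball (\<phi> q) e)"
      unfolding holo_on_def by (auto intro!: exI[of _ "\<lambda>z. z"] derivative_eq_intros)
    define Y where "Y = {z \<in> \<phi> ` U. inv_into U \<phi> z \<in> A} \<inter> ball (\<phi> q) e"
    have "open Y" unfolding Y_def using ch(8)[OF A(1)] by auto
    have "openin (ktop N) {r \<in> U. \<phi> r \<in> ball (\<phi> q) e}" by (rule ch(7)) simp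
    then obtain r where r: "r \<in> A" "r \<in> U" "\<phi> r \<in> ball (\<phi> q) e"
      using q U(2) e(1) unfolding in_closure_of by (metis (no_types, lifting) centre_in_ball mem_Collect_eq)
    then have "\<phi> r \<in> Y" using ch(4) by (simp add: Y_def)
    have eqY: "(\<phi> \<circ> f \<circ> inv_into U \<phi>) z = z" if "z \<in> Y" for z
      using that A(2) f_inv_into_f[of z \<phi> U] by (auto simp: Y_def Fx_def)
    have id: "(\<phi> \<circ> f \<circ> inv_into U \<phi>) z = z" if "z \<in> ball (\<phi> q) e" for z
      by (rule holo_on_identity_theorem[OF hg hid open_ball convex_ball \<open>open Y\<close> _ \<open>\<phi> r \<in> Y\<close> eqY that])
         (auto simp: Y_def)
    have "{r \<in> U. \<phi> r \<in> ball (\<phi> q) e} \<subseteq> Fx"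
    proof clarify
      fix s assume s: "s \<in> U" "\<phi> s \<in> ball (\<phi> q) e"
      then have "\<phi> (f s) = \<phi> s" using id[OF s(2)] ch(4) by simp
      moreover have "f s \<in> U"
      proof -
        have "\<phi> s \<in> \<phi> ` {r \<in> U. f r \<in> U}" using e(2) s(2) unfolding Xeq by (rule subsetD)
        then obtain r where "r \<in> U" "f r \<in> U" "\<phi> s = \<phi> r" by blast
        then show ?thesis using inj_onD[OF ch(4), of s r] s(1) by simp
      qed
      ultimately have "f s = s" using ch(4) s(1) by (meson inj_onD)
      then show "s \<in> Fx" using s(1) ch(2) by (auto simp: Fx_def)
    qed
    then have "{r \<in> U. \<phi> r \<in> ball (\<phi> q) e} \<subseteq> A"
      unfolding A_def using ch(7)[of "ball (\<phi> q) e"] by (intro interior_of_maximal) auto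
    then show "q \<in> A" using U(2) e(1) by auto
  qed
  then have "closedin (ktop N) A"
    using A(1) by (simp add: closure_of_subset_eq[symmetric] openin_subset)
  then have "A = kspace N"
    using N(2) A W(2) unfolding connected_space_clopen_in by blast
  then show ?thesis using A(2) p by (auto simp: Fx_def)
qed

section \<open>Density of the free locus\<close>

lemma torus_action_facts:
  assumes "kaehler_torus_action N \<Phi>"
  shows torus_action_0: "\<And>p. p \<in> kspace N \<Longrightarrow> \<Phi> (torus_pt 0) p = p"
    and torus_action_add: "\<And>s t p. p \<in> kspace N \<Longrightarrow> \<Phi> (torus_pt (s + t)) p = \<Phi> (torus_pt s) (\<Phi> (torus_pt t) p)"
    and torus_action_continuous:
      "continuous_map (prod_topology euclidean (ktop N)) (ktop N) (\<lambda>(t, p). \<Phi> (torus_pt t) p)"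
    and torus_action_holomorphic: "\<And>t. holomorphic_map N N (\<Phi> (torus_pt t))"
    and torus_action_orbit_continuous:
      "\<And>p. p \<in> kspace N \<Longrightarrow> continuous_map euclidean (ktop N) (\<lambda>t. \<Phi> (torus_pt t) p)"
    and torus_action_in: "\<And>t p. p \<in> kspace N \<Longrightarrow> \<Phi> (torus_pt t) p \<in> kspace N"
proof -
  show c: "continuous_map (prod_topology euclidean (ktop N)) (ktop N) (\<lambda>(t, p). \<Phi> (torus_pt t) p)"
    using assms by (simp add: kaehler_torus_action_def)
  show "\<Phi> (torus_pt t) p \<in> kspace N" if "p \<in> kspace N" for t p
    using continuous_map_image_subset_topspace[OF c] that by force
  show "continuous_map euclidean (ktop N) (\<lambda>t. \<Phi> (torus_pt t) p)" if "p \<in> kspace N" for p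
  proof -
    have "continuous_map euclidean (prod_topology euclidean (ktop N)) (\<lambda>t. (t, p))"
      using that by (intro continuous_intros) auto
    from continuous_map_compose[OF this c] show ?thesis by (simp add: o_def)
  qed
qed (use assms in \<open>auto simp: kaehler_torus_action_def torus_def\<close>)

text \<open>A point with nontrivial stabilizer is fixed by a nontrivial torsion element, of which there are only
  countably many.  The fixed point set of each is closed, and its interior is empty because a holomorphic
  map that is the identity on an open set is the identity, against effectiveness.  Baire's theorem does
  the rest.\<close>

lemma free_locus_dense:
  fixes N :: "('a, 'n::finite) kaehler" and \<Phi> :: "(real^'n) set \<Rightarrow> 'a \<Rightarrow> 'a"
  assumes N: "kaehler_manifold N" "connected_space (ktop N)"
    and act: "kaehler_torus_action N \<Phi>" and eff: "effective N \<Phi>"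
  shows "ktop N closure_of free_locus N \<Phi> = kspace N"
proof -
  note act_facts = torus_action_facts[OF act]
  have Hd: "Hausdorff_space (ktop N)" using N(1) by (simp add: kaehler_manifold_def)
  define Fx where "Fx v = {p \<in> kspace N. \<Phi> (torus_pt v) p = p}" for v
  define Q :: "(real^'n) set" where "Q = {v. v \<notin> int_vec \<and> (\<exists>M>0. of_nat M *\<^sub>R v \<in> int_vec)}"
  have "countable Q"
    by (rule countable_subset[OF _ countable_torsion_vectors]) (auto simp: Q_def)
  have cont: "continuous_map (ktop N) (ktop N) (\<Phi> (torus_pt v))" for v
    using act_facts(4) by (simp add: holomorphic_map_def)
  have Fx_closed: "closedin (ktop N) (Fx v)" for v
    unfolding Fx_def by (rule closedin_continuous_maps_eq[OF Hd cont continuous_map_id, simplified])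
  have Fx_interior: "ktop N interior_of Fx v = {}" if "v \<in> Q" for v
  proof (rule ccontr)
    assume ne: "ktop N interior_of Fx v \<noteq> {}"
    have "\<Phi> (torus_pt v) p = p" if "p \<in> kspace N" for p
      by (rule holomorphic_map_eq_id_if_locally_id[OF N act_facts(4) openin_interior_of ne _ that])
         (use interior_of_subset[of "ktop N" "Fx v"] in \<open>auto simp: Fx_def\<close>)
    then have "torus_pt v = torus_pt 0" using eff by (auto simp: effective_def torus_def)
    then show False using \<open>v \<in> Q\<close> by (simp add: torus_pt_eq_iff Q_def)
  qed
  have "kspace N - free_locus N \<Phi> \<subseteq> \<Union> (Fx ` Q)"
  proof
    fix p assume "p \<in> kspace N - free_locus N \<Phi>"
    then obtain t where p: "p \<in> kspace N" and t: "\<Phi> (torus_pt t) p = p" "torus_pt t \<noteq> torus_pt 0"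
      by (auto simp: free_locus_def torus_def)
    define H where "H = {s. \<Phi> (torus_pt s) p = p}"
    have "closedin euclidean H"
      unfolding H_def
      using closedin_continuous_maps_eq[OF Hd act_facts(5)[OF p], of "\<lambda>_. p"] p by simp
    then have "closed H" by simp
    moreover have "additive_subgroup H"
    proof -
      have "\<Phi> (torus_pt (- s)) p = p" if "\<Phi> (torus_pt s) p = p" for s
        using act_facts(2)[OF p, of "- s" s] act_facts(1)[OF p] that by simp
      then show ?thesis
        using act_facts(1)[OF p] act_facts(2)[OF p] by (auto simp: additive_subgroup_def H_def)
    qed
    moreover have "int_vec \<subseteq> H"
    proof
      fix k :: "real^'n" assume "k \<in> int_vec"
      then have "torus_pt k = torus_pt 0" by (simp add: torus_pt_eq_iff)
      then show "k \<in> H" using act_facts(1)[OF p] by (simp add: H_def)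
    qed
    moreover have "t \<in> H" "t \<notin> int_vec" using t by (simp_all add: H_def torus_pt_eq_iff)
    ultimately obtain v M where "v \<in> H" "v \<notin> int_vec" "0 < (M::nat)" "of_nat M *\<^sub>R v \<in> int_vec"
      using closed_supgroup_int_vec_has_torsion by metis
    then show "p \<in> \<Union> (Fx ` Q)" using p unfolding Q_def Fx_def H_def by blast
  qed
  moreover have "ktop N interior_of \<Union> (Fx ` Q) = {}"
    using kaehler_locally_compact[OF N(1)] locally_compact_Hausdorff_imp_regular_space[OF _ Hd]
      \<open>countable Q\<close> Fx_closed Fx_interior
    by (intro Baire_category_alt) auto
  ultimately have "ktop N interior_of (kspace N - free_locus N \<Phi>) = {}"
    using interior_of_mono by blast
  then have "kspace N \<subseteq> ktop N closure_of free_locus N \<Phi>"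
    by (simp only: interior_of_complement Diff_eq_empty_iff)
  then show ?thesis by (intro subset_antisym closure_of_subset_topspace)
qed

section \<open>The free locus as a quotient of complex space\<close>

definition re_vec :: "complex^'n \<Rightarrow> real^'n" where "re_vec z = (\<chi> k. Re (z $ k))"
definition im_vec :: "complex^'n \<Rightarrow> real^'n" where "im_vec z = (\<chi> k. Im (z $ k))"
definition real_emb :: "real^'n \<Rightarrow> complex^'n" where "real_emb v = (\<chi> k. of_real (v $ k))"

lemma real_emb_simps [simp]:
  "re_vec (real_emb v) = v" "im_vec (real_emb v) = 0"
  "re_vec (\<i> *s real_emb v) = 0" "im_vec (\<i> *s real_emb v) = v"
  "re_vec (z + z') = re_vec z + re_vec z'" "im_vec (z + z') = im_vec z + im_vec z'"
  by (auto simp: re_vec_def im_vec_def real_emb_def vec_eq_iff)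

lemma linear_real_emb: "linear real_emb"
  by (intro linearI) (auto simp: real_emb_def vec_eq_iff complex_eq_iff)

lemma real_emb_0 [simp]: "real_emb 0 = 0"
  by (simp add: real_emb_def vec_eq_iff)

lemma linear_re_vec: "linear (re_vec :: complex^'n \<Rightarrow> real^'n)"
  by (intro linearI) (auto simp: re_vec_def vec_eq_iff)

lemma norm_imag_emb: "norm (\<i> *s real_emb v) = norm v"
  by (simp add: norm_vec_def real_emb_def norm_mult)

text \<open>In affine coordinates a parallel field has constant components, so a parallel frame is a basis of the
  coordinate space.\<close>

lemma parallel_frame_constant:
  assumes "parallel_frame P E"
  obtains e where "\<And>i \<theta>. E i (P \<theta>) = e i" "inj (\<lambda>t::real^'n::finite. \<Sum>i\<in>UNIV. t $ i *\<^sub>R e i)"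
proof
  have pf: "parallel_field P (E i)" for i using assms by (simp add: parallel_frame_def)
  show "E i (P \<theta>) = E i (P 0)" for i \<theta>
  proof -
    have "((E i \<circ> P) has_derivative (\<lambda>v. 0)) (at x)" for x
    proof -
      have "Ck_on (Suc 0) (E i \<circ> P) UNIV" using pf unfolding parallel_field_def smooth_on_def by blast
      then have "(E i \<circ> P) differentiable (at x)" by simp
      then have "((E i \<circ> P) has_derivative frechet_derivative (E i \<circ> P) (at x)) (at x)"
        using frechet_derivative_works by blast
      moreover have "frechet_derivative (E i \<circ> P) (at x) = (\<lambda>v. 0)"
        using pf[of i] by (auto simp: parallel_field_def cov_deriv_def)
      ultimately show ?thesis by simp
    qed
    then have "\<exists>c. \<forall>x\<in>UNIV. (E i \<circ> P) x = c"
      by (intro has_derivative_zero_constant[of UNIV "E i \<circ> P"]) simp_all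
    then show ?thesis by auto
  qed
  show "inj (\<lambda>t::real^'n. \<Sum>i\<in>UNIV. t $ i *\<^sub>R E i (P 0))"
  proof (rule injI)
    fix s t :: "real^'n"
    assume "(\<Sum>i\<in>UNIV. s $ i *\<^sub>R E i (P 0)) = (\<Sum>i\<in>UNIV. t $ i *\<^sub>R E i (P 0))"
    then have "(\<Sum>i\<in>UNIV. (s $ i - t $ i) *\<^sub>R E i (P 0)) = 0"
      by (simp add: scaleR_diff_left sum_subtractf)
    moreover have indep: "(\<Sum>i\<in>UNIV. c i *\<^sub>R E i (P 0)) = 0 \<Longrightarrow> \<forall>i. c i = 0" for c
      using assms unfolding parallel_frame_def by blast
    ultimately have "\<forall>i. s $ i - t $ i = 0" by (intro indep[of "\<lambda>i. s $ i - t $ i"])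
    then show "s = t" by (simp add: vec_eq_iff)
  qed
qed

definition frame_comb :: "('n::finite \<Rightarrow> real^'n) \<Rightarrow> real^'n \<Rightarrow> real^'n" where
  "frame_comb e t = (\<Sum>i\<in>UNIV. t $ i *\<^sub>R e i)"

lemma linear_frame_comb: "linear (frame_comb e)"
  unfolding frame_comb_def[abs_def]
  by (intro linearI) (auto simp: scaleR_add_left sum.distrib scaleR_sum_right)

text \<open>Dombrowski's coordinates \<open>z = \<theta> + \<i> r\<close> identify the tangent bundle with complex \<open>n\<close>-space.  A map \<open>G\<close>
  from there into a Kaehler manifold is recorded here as a local Kaehler isometry that turns imaginary
  translations along the basis \<open>e\<close> into the torus action.\<close>

definition equivariant_cover ::
  "('a, 'n::finite) kaehler \<Rightarrow> ((real^'n) set \<Rightarrow> 'a \<Rightarrow> 'a) \<Rightarrow> (real^'n \<Rightarrow> real^'n^'n)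
     \<Rightarrow> ('n \<Rightarrow> real^'n) \<Rightarrow> (complex^'n \<Rightarrow> 'a) \<Rightarrow> bool" where
  "equivariant_cover N \<Phi> h e G \<longleftrightarrow> continuous_map euclidean (ktop N) G \<and>
    (\<forall>t z. \<Phi> (torus_pt t) (G z) = G (z + \<i> *s real_emb (frame_comb e t))) \<and>
    (\<forall>z. \<forall>(V, \<psi>)\<in>charts N. G z \<in> V \<longrightarrow>
       (\<exists>D. ((\<psi> \<circ> G) has_derivative D) (at z) \<and> (\<forall>c v. D (c *s v) = c *s D v) \<and>
         (\<forall>v w. kmetric N \<psi> (G z) (D v) (D w) = dombrowski_metric h z v w)))"

lemma equivariant_coverD:
  assumes "equivariant_cover N \<Phi> h e G"
  shows "continuous_map euclidean (ktop N) G"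
    and "\<Phi> (torus_pt t) (G z) = G (z + \<i> *s real_emb (frame_comb e t))"
    and "(V, \<psi>) \<in> charts N \<Longrightarrow> G z \<in> V \<Longrightarrow>
       \<exists>D. ((\<psi> \<circ> G) has_derivative D) (at z) \<and> (\<forall>c v. D (c *s v) = c *s D v) \<and>
         (\<forall>v w. kmetric N \<psi> (G z) (D v) (D w) = dombrowski_metric h z v w)"
  using assms unfolding equivariant_cover_def by blast+

text \<open>\<open>G\<close> is the projection to the tube followed by the isomorphism \<open>T\<close>.  Its local properties are those of \<open>T\<close>
  in the charts of the tube, once it is known that the projection is injective on small balls: the lattice
  spanned by a basis is discrete.\<close>

lemma tube_parametrization:
  fixes P :: "real^'n::finite \<Rightarrow> 'm" and N :: "('a, 'n) kaehler" and T :: "('m \<times> (real^'n)) set \<Rightarrow> 'a"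
  assumes P: "inj P" and L: "lattice_generator P E L"
    and iso: "kaehler_iso (tube P h L) (open_submanifold N W) T"
    and equi: "\<And>a c. a \<in> torus \<Longrightarrow> c \<in> kspace (tube P h L) \<Longrightarrow> T (tube_action E a c) = \<Phi> a (T c)"
    and W: "W \<subseteq> kspace N"
  shows "\<exists>e G. equivariant_cover N \<Phi> h e G \<and> range G = W"
proof -
  obtain e where e: "\<And>i \<theta>. E i (P \<theta>) = e i" and injA: "inj (\<lambda>t::real^'n. \<Sum>i\<in>UNIV. t $ i *\<^sub>R e i)"
    using L unfolding lattice_generator_def by (elim conjE, elim parallel_frame_constant) blast
  define A where "A = frame_comb e"
  have linA: "linear A" unfolding A_def by (rule linear_frame_comb)
  have A_eq: "A = (\<lambda>t. \<Sum>i\<in>UNIV. t $ i *\<^sub>R e i)" by (auto simp: A_def frame_comb_def)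
  obtain m where m: "0 < m" "\<And>t. m * norm t \<le> norm (A t)"
    using linear_inj_bounded_below_pos[OF linA] injA[folded A_eq] by blast
  define K where "K = (\<lambda>z. (P (re_vec z), im_vec z))"
  define \<pi> where "\<pi> = lattice_orbit L"
  have tbK: "tb_coord P (K z) = z" for z
    using P by (simp add: tb_coord_def K_def re_vec_def im_vec_def vec_eq_iff complex_eq_iff inv_f_f)
  have Ktb: "K (tb_coord P u) = u" if "u \<in> tangent_bundle P" for u
  proof -
    obtain \<theta> a where "u = (P \<theta>, a)" using \<open>u \<in> tangent_bundle P\<close> by (auto simp: tangent_bundle_def)
    then show ?thesis
      using P by (simp add: tb_coord_def K_def re_vec_def im_vec_def vec_eq_iff inv_f_f vec_lambda_eta)
  qed
  have K_in: "K z \<in> tangent_bundle P" for z by (simp add: K_def tangent_bundle_def)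
  have injK: "K z = K z' \<longleftrightarrow> z = z'" for z z' by (metis tbK)
  have openD: "openin (ktop (dombrowski P h)) S \<longleftrightarrow> (\<exists>X. open X \<and> S = tb_coord P -` X \<inter> tangent_bundle P)" for S
    by (simp add: dombrowski_def openin_pullback_topology)
  have openK: "openin (ktop (dombrowski P h)) (K ` X)" if "open X" for X
  proof -
    have "u \<in> K ` X" if "u \<in> tb_coord P -` X \<inter> tangent_bundle P" for u
      using that Ktb[of u] by (metis IntD1 IntD2 imageI vimageD)
    then have "K ` X = tb_coord P -` X \<inter> tangent_bundle P" by (auto simp: tbK K_in)
    then show ?thesis unfolding openD using \<open>open X\<close> by blast
  qed
  have \<pi>K: "\<pi> (K z) = (\<lambda>k. K (z + \<i> *s real_emb (A k))) ` int_vec" for z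
  proof -
    have "{l. (P \<theta>, l) \<in> L} = A ` int_vec" for \<theta>
    proof -
      have "{l. (P \<theta>, l) \<in> L} = {\<Sum>i\<in>UNIV. of_int (k i) *\<^sub>R e i | k. True}"
        using L P e unfolding lattice_generator_def by (auto simp: inj_eq)
      also have "\<dots> = A ` int_vec"
      proof (intro subset_antisym subsetI)
        fix l assume "l \<in> {\<Sum>i\<in>UNIV. of_int (k i) *\<^sub>R e i | k. True}"
        then obtain k where "l = (\<Sum>i\<in>UNIV. of_int (k i) *\<^sub>R e i)" by blast
        then have "l = A (\<chi> i. of_int (k i))" by (simp add: A_eq)
        then show "l \<in> A ` int_vec" by (auto simp: int_vec_def)
      next
        fix l assume "l \<in> A ` int_vec"
        then obtain k where k: "k \<in> int_vec" "l = A k" by blast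
        then have "\<exists>n. \<forall>i. k $ i = of_int (n i)"
          by (intro choice) (auto simp: int_vec_def elim: Ints_cases)
        then show "l \<in> {\<Sum>i\<in>UNIV. of_int (k i) *\<^sub>R e i | k. True}" using k(2) by (auto simp: A_eq)
      qed
      finally show ?thesis .
    qed
    moreover have "\<pi> (K z) = (\<lambda>l. (P (re_vec z), im_vec z + l)) ` {l. (P (re_vec z), l) \<in> L}"
      unfolding \<pi>_def lattice_orbit_def K_def by auto
    ultimately show ?thesis by (simp add: image_image K_def)
  qed
  have kspace_tube: "kspace (tube P h L) = \<pi> ` tangent_bundle P"
  proof -
    have "openin (ktop (tube P h L)) (\<pi> ` tangent_bundle P)"
      unfolding openin_tube openD \<pi>_def by (auto intro!: exI[of _ UNIV])
    moreover have "S \<subseteq> \<pi> ` tangent_bundle P" if "openin (ktop (tube P h L)) S" for S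
      using that by (simp add: openin_tube \<pi>_def)
    ultimately show ?thesis unfolding topspace_def by blast
  qed
  define G where "G = T \<circ> \<pi> \<circ> K"
  have act: "\<Phi> (torus_pt t) (G z) = G (z + \<i> *s real_emb (A t))" for t z
  proof -
    have "tube_action E (torus_pt t) (\<pi> (K z)) = \<pi> (K (z + \<i> *s real_emb (A t)))"
    proof (intro subset_antisym subsetI)
      fix w assume "w \<in> tube_action E (torus_pt t) (\<pi> (K z))"
      then obtain k l where kl: "k \<in> int_vec" "l \<in> int_vec"
        and w: "w = (P (re_vec z), im_vec z + A k + A (t + l))"
        unfolding tube_action_def \<pi>K torus_pt_def by (auto simp: K_def e A_eq)
      have "w = K (z + \<i> *s real_emb (A t) + \<i> *s real_emb (A (k + l)))"
        using w by (simp add: K_def linear_add[OF linA])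
      then show "w \<in> \<pi> (K (z + \<i> *s real_emb (A t)))" unfolding \<pi>K using kl int_vec_add by blast
    next
      fix w assume "w \<in> \<pi> (K (z + \<i> *s real_emb (A t)))"
      then obtain k where k: "k \<in> int_vec" and w: "w = (P (re_vec z), im_vec z + A k + A t)"
        unfolding \<pi>K by (auto simp: K_def)
      have "t \<in> torus_pt t" using int_vec_0 by (force simp: torus_pt_def)
      moreover have "(P (re_vec z), im_vec z + A k) \<in> \<pi> (K z)"
        unfolding \<pi>K using k by (auto simp: K_def)
      ultimately show "w \<in> tube_action E (torus_pt t) (\<pi> (K z))"
        unfolding tube_action_def w by (force simp: A_eq e)
    qed
    moreover have "\<pi> (K z) \<in> kspace (tube P h L)" using K_in kspace_tube by blast
    ultimately show ?thesis
      using equi[of "torus_pt t" "\<pi> (K z)"] by (simp add: G_def torus_def)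
  qed
  have contG: "continuous_map euclidean (ktop N) G"
  proof -
    have "continuous_map euclidean (ktop (tube P h L)) (\<pi> \<circ> K)"
      unfolding continuous_map_def
    proof (intro conjI allI impI)
      show "\<pi> \<circ> K \<in> topspace euclidean \<rightarrow> kspace (tube P h L)" using K_in kspace_tube by auto
      fix S assume "openin (ktop (tube P h L)) S"
      then obtain X where X: "open X" "{u \<in> tangent_bundle P. \<pi> u \<in> S} = tb_coord P -` X \<inter> tangent_bundle P"
        unfolding openin_tube openD \<pi>_def by blast
      have "\<pi> (K z) \<in> S \<longleftrightarrow> z \<in> X" for z
      proof -
        have "K z \<in> {u \<in> tangent_bundle P. \<pi> u \<in> S} \<longleftrightarrow> K z \<in> tb_coord P -` X \<inter> tangent_bundle P"
          by (simp only: X(2))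
        then show ?thesis by (simp add: K_in tbK)
      qed
      then show "openin euclidean {x \<in> topspace euclidean. (\<pi> \<circ> K) x \<in> S}" using X(1) by simp
    qed
    moreover have "continuous_map (ktop (tube P h L)) (ktop N) T"
      using iso by (simp add: kaehler_iso_def holomorphic_map_def open_submanifold_def continuous_map_in_subtopology)
    ultimately show ?thesis unfolding G_def by (metis continuous_map_compose comp_assoc)
  qed
  have rangeG: "range G = W"
  proof -
    have "u \<in> range K" if "u \<in> tangent_bundle P" for u using Ktb[OF that] by (metis rangeI)
    then have "range K = tangent_bundle P" using K_in by blast
    moreover have "T ` kspace (tube P h L) = W"
      using iso W by (simp add: kaehler_iso_def bij_betw_def open_submanifold_def Int_absorb1)
    moreover have "range G = T ` \<pi> ` range K" by (simp only: G_def image_comp comp_assoc)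
    ultimately show ?thesis by (simp only: kspace_tube)
  qed
  have der: "\<exists>D. ((\<psi> \<circ> G) has_derivative D) (at z) \<and> (\<forall>c v. D (c *s v) = c *s D v) \<and>
         (\<forall>v w. kmetric N \<psi> (G z) (D v) (D w) = dombrowski_metric h z v w)"
    if V: "(V, \<psi>) \<in> charts N" and Gz: "G z \<in> V" for z V \<psi>
  proof -
    \<comment> \<open>Distinct points of this ball are less than \<open>m\<close> apart, the nonzero lattice vectors have norm at least \<open>m\<close>.\<close>
    define B where "B = ball z (m / 2)"
    define Y where "Y = K ` B"
    have injY: "inj_on \<pi> Y"
    proof (rule inj_onI)
      fix u u' assume "u \<in> Y" "u' \<in> Y" and eq: "\<pi> u = \<pi> u'"
      then obtain x x' where x: "x \<in> B" "x' \<in> B" "u = K x" "u' = K x'" by (auto simp: Y_def)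
      have "K x' \<in> \<pi> (K x')" 
        unfolding \<pi>K by (rule image_eqI[of _ _ 0]) (simp_all add: linear_0[OF linA] int_vec_0)
      then have "K x' \<in> \<pi> (K x)" using eq x(3,4) by simp
      then obtain k where k: "k \<in> int_vec" "x' = x + \<i> *s real_emb (A k)"
        unfolding \<pi>K by (auto simp: injK)
      have "norm (A k) < m"
        using x(1,2) k(2) norm_imag_emb[of "A k"] dist_triangle2[of x' x z]
        by (simp add: B_def dist_norm norm_minus_commute)
      then have "m * norm k < m * 1" using m(2)[of k] by simp
      then have "norm k < 1" using m(1) by (simp only: mult_less_cancel_left_pos)
      have "k $ i = 0" for i
      proof -
        obtain n :: int where "k $ i = of_int n" using k(1) by (auto simp: int_vec_def elim: Ints_cases)
        then show ?thesis using component_le_norm_cart[of k i] \<open>norm k < 1\<close> by simp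
      qed
      then have "k = 0" by (simp add: vec_eq_iff)
      then show "u = u'" using k(2) x(3,4) linear_0[OF linA] by simp
    qed
    define \<phi> where "\<phi> = tb_coord P \<circ> inv_into Y \<pi>"
    have ch: "(\<pi> ` Y, \<phi>) \<in> charts (tube P h L)"
    proof -
      have "openin (ktop (dombrowski P h)) Y" unfolding Y_def B_def by (rule openK) simp
      then show ?thesis
        using injY unfolding tube_def kaehler.select_convs \<phi>_def \<pi>_def
        by (intro CollectI exI[of _ Y] conjI refl)
    qed
    have \<phi>: "\<phi> (\<pi> (K x)) = x" if "x \<in> B" for x
      using that injY by (simp add: \<phi>_def Y_def tbK)
    have inv\<phi>: "inv_into (\<pi> ` Y) \<phi> x = \<pi> (K x)" if "x \<in> B" for x
    proof -
      have "inj_on \<phi> (\<pi> ` Y)" by (rule inj_on_inverseI[of _ "\<pi> \<circ> K"]) (auto simp: Y_def \<phi>)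
      moreover have "\<pi> (K x) \<in> \<pi> ` Y" using that by (simp add: Y_def)
      ultimately have "inv_into (\<pi> ` Y) \<phi> (\<phi> (\<pi> (K x))) = \<pi> (K x)" by (rule inv_into_f_f)
      then show ?thesis using \<phi>[OF that] by simp
    qed
    have zB: "z \<in> B" using m(1) by (simp add: B_def)
    have chN: "(V \<inter> W, \<psi>) \<in> charts (open_submanifold N W)"
      using V by (force simp: open_submanifold_def)
    have mem: "\<pi> (K z) \<in> \<pi> ` Y" "T (\<pi> (K z)) \<in> V \<inter> W"
      using zB Gz rangeG by (auto simp: Y_def G_def)
    have "holo_on (\<psi> \<circ> T \<circ> inv_into (\<pi> ` Y) \<phi>) (\<phi> ` {p \<in> \<pi> ` Y. T p \<in> V \<inter> W})"
      using iso ch chN unfolding kaehler_iso_def holomorphic_map_def by blast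
    moreover have "z \<in> \<phi> ` {p \<in> \<pi> ` Y. T p \<in> V \<inter> W}"
      using mem \<phi>[OF zB] by (metis (mono_tags, lifting) imageI mem_Collect_eq)
    ultimately obtain D where D: "((\<psi> \<circ> T \<circ> inv_into (\<pi> ` Y) \<phi>) has_derivative D) (at z)"
      "\<And>c v. D (c *s v) = c *s D v"
      unfolding holo_on_def by blast
    have "((\<psi> \<circ> G) has_derivative D) (at z)"
    proof (rule has_derivative_transform_within_open[OF D(1) _ zB])
      show "open B" by (simp add: B_def)
      show "(\<psi> \<circ> T \<circ> inv_into (\<pi> ` Y) \<phi>) x = (\<psi> \<circ> G) x" if "x \<in> B" for x
        using inv\<phi>[OF that] by (simp add: G_def)
    qed
    moreover have "kmetric N \<psi> (G z) (D v) (D w) = dombrowski_metric h z v w" for v w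
    proof -
      have "frechet_derivative (\<psi> \<circ> T \<circ> inv_into (\<pi> ` Y) \<phi>) (at (\<phi> (\<pi> (K z)))) = D"
        using frechet_derivative_at[OF D(1)] \<phi>[OF zB] by simp
      moreover have "isometric_map (tube P h L) (open_submanifold N W) T"
        using iso by (simp add: kaehler_iso_def)
      ultimately have "kmetric (open_submanifold N W) \<psi> (T (\<pi> (K z))) (D v) (D w)
          = kmetric (tube P h L) \<phi> (\<pi> (K z)) v w"
        using ch chN mem unfolding isometric_map_def Let_def by blast
      then show ?thesis using \<phi>[OF zB] by (simp add: open_submanifold_def tube_def G_def)
    qed
    ultimately show ?thesis using D(2) by blast
  qed
  show ?thesis
    unfolding equivariant_cover_def
    by (intro exI[of _ e] exI[of _ G] conjI contG rangeG allI ballI)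
       (use act der in \<open>auto simp: A_def\<close>)
qed

section \<open>Vertices of the momentum image come from fixed points\<close>

lemma dombrowski_metric_eq:
  "dombrowski_metric h z v w =
     re_vec v \<bullet> (h (re_vec z) *v re_vec w) + im_vec v \<bullet> (h (re_vec z) *v im_vec w)"
  by (simp add: dombrowski_metric_def re_vec_def im_vec_def Let_def)

lemma momentum_map_differentiable:
  assumes J: "momentum_map N \<Phi> J" and U: "(U, \<phi>) \<in> charts N" "p \<in> U"
  obtains D where "((J \<circ> inv_into U \<phi>) has_derivative D) (at (\<phi> p))"
    "\<And>\<xi> u. kform N \<phi> p (fund_field \<Phi> \<xi> \<phi> p) u = D u \<bullet> \<xi>"
proof -
  have "smooth_on (J \<circ> inv_into U \<phi>) (\<phi> ` U)" using J U(1) unfolding momentum_map_def by blast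
  then have "Ck_on (Suc 0) (J \<circ> inv_into U \<phi>) (\<phi> ` U)" unfolding smooth_on_def by blast
  then have "(J \<circ> inv_into U \<phi>) differentiable (at (\<phi> p))" using U(2) by simp
  then obtain D where D: "((J \<circ> inv_into U \<phi>) has_derivative D) (at (\<phi> p))"
    unfolding differentiable_def by blast
  have "kform N \<phi> p (fund_field \<Phi> \<xi> \<phi> p) u = D u \<bullet> \<xi>" for \<xi> u
  proof -
    have "((\<lambda>z. J (inv_into U \<phi> z) \<bullet> \<xi>) has_derivative (\<lambda>u. D u \<bullet> \<xi>)) (at (\<phi> p))"
      using has_derivative_inner_left[OF D] by (simp add: o_def)
    then have "frechet_derivative (\<lambda>z. J (inv_into U \<phi> z) \<bullet> \<xi>) (at (\<phi> p)) = (\<lambda>u. D u \<bullet> \<xi>)"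
      by (rule frechet_derivative_at[symmetric])
    moreover have "kform N \<phi> p (fund_field \<Phi> \<xi> \<phi> p) u
        = frechet_derivative (\<lambda>z. J (inv_into U \<phi> z) \<bullet> \<xi>) (at (\<phi> p)) u"
      using J U unfolding momentum_map_def by blast
    ultimately show ?thesis by simp
  qed
  then show thesis using that D by blast
qed

lemma momentum_map_continuous:
  fixes N :: "('a, 'n::finite) kaehler"
  assumes N: "kaehler_manifold N" and J: "momentum_map N \<Phi> J"
  shows "continuous_map (ktop N) euclidean J"
  unfolding continuous_map_def
proof (intro conjI allI impI)
  fix X :: "(real^'n) set" assume "openin euclidean X"
  then have "open X" by simp
  show "openin (ktop N) {q \<in> kspace N. J q \<in> X}"
  proof (subst openin_subopen, intro ballI)
    fix q assume q: "q \<in> {q \<in> kspace N. J q \<in> X}"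
    then have "q \<in> kspace N" by simp
    then obtain U \<phi> where U: "(U, \<phi>) \<in> charts N" "q \<in> U" using chart_around N by metis
    note ch = chart_maps[OF N U(1)]
    have "smooth_on (J \<circ> inv_into U \<phi>) (\<phi> ` U)" using J U(1) unfolding momentum_map_def by blast
    then have "Ck_on 0 (J \<circ> inv_into U \<phi>) (\<phi> ` U)" unfolding smooth_on_def by blast
    then have "continuous_on (\<phi> ` U) (J \<circ> inv_into U \<phi>)" by simp
    then have "open ((J \<circ> inv_into U \<phi>) -` X \<inter> \<phi> ` U)"
      using ch(3) \<open>open X\<close> continuous_on_open_vimage by blast
    then have "openin (ktop N) {r \<in> U. \<phi> r \<in> (J \<circ> inv_into U \<phi>) -` X \<inter> \<phi> ` U}" by (rule ch(7))
    moreover have "{r \<in> U. \<phi> r \<in> (J \<circ> inv_into U \<phi>) -` X \<inter> \<phi> ` U} = {r \<in> U. J r \<in> X}"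
      by (intro Collect_cong conj_cong refl) (simp add: inv_into_f_f[OF ch(4)])
    ultimately have "openin (ktop N) {r \<in> U. J r \<in> X}" by simp
    then show "\<exists>Y. openin (ktop N) Y \<and> q \<in> Y \<and> Y \<subseteq> {q \<in> kspace N. J q \<in> X}"
      using q U(2) ch(2) by (intro exI[of _ "{r \<in> U. J r \<in> X}"]) auto
  qed
qed simp

lemma kform_nondegenerate:
  assumes N: "kaehler_manifold N" and U: "(U, \<phi>) \<in> charts N" "p \<in> U"
    and 0: "\<And>u. kform N \<phi> p X u = 0"
  shows "X = 0"
proof (rule ccontr)
  assume "X \<noteq> 0"
  then have "\<i> *s X \<noteq> 0" by (simp add: vec_eq_iff)
  then have "0 < kmetric N \<phi> p (\<i> *s X) (\<i> *s X)"
    using N U unfolding kaehler_manifold_def hermitian_metric_def by blast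
  then show False using 0[of "\<i> *s X"] by (simp add: kform_def)
qed

text \<open>A vertex of a polytope is exposed, and moreover the supporting functional decreases at a linear rate
  away from the vertex.  The rate is obtained from a hyperplane that separates the vertex from the hull of
  the other points.\<close>

lemma extreme_point_sharp_support:
  fixes S :: "'a::euclidean_space set"
  assumes "finite S" "v extreme_point_of (convex hull S)"
  obtains a \<kappa> where "0 < \<kappa>" "\<And>x. x \<in> convex hull S \<Longrightarrow> a \<bullet> (x - v) + \<kappa> * norm (x - v) \<le> 0"
proof -
  have "v \<in> S" using assms(2) by (rule extreme_point_of_convex_hull)
  then have S: "S = insert v (S - {v})" by blast
  have "v \<notin> convex hull (S - {v})"
  proof -
    have "convex (convex hull S - {v})"
      using assms(2) by (simp add: extreme_point_of_stillconvex)
    then have "convex hull (S - {v}) \<subseteq> convex hull S - {v}"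
      by (intro hull_minimal) (auto intro: hull_inc)
    then show ?thesis by blast
  qed
  moreover have "closed (convex hull (S - {v}))"
    using assms(1) by (intro compact_imp_closed compact_convex_hull finite_imp_compact) simp
  ultimately obtain a b where ab: "a \<bullet> v < b" "\<And>x. x \<in> convex hull (S - {v}) \<Longrightarrow> b < a \<bullet> x"
    using separating_hyperplane_closed_point[OF convex_convex_hull] by blast
  define r where "r = (\<Sum>x\<in>S. norm (x - v)) + 1"
  have r: "0 < r" "\<And>x. x \<in> S \<Longrightarrow> norm (x - v) \<le> r"
    using member_le_sum[of _ S "\<lambda>x. norm (x - v)"] assms(1)
    by (force simp: r_def intro!: add_nonneg_pos sum_nonneg)+
  define \<kappa> where "\<kappa> = (b - a \<bullet> v) / r"
  have "0 < \<kappa>" using ab(1) r(1) by (simp add: \<kappa>_def)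
  have "convex {x. (- a) \<bullet> (x - v) + \<kappa> * norm (x - v) \<le> 0}"
  proof (rule convexI)
    fix x y :: 'a and s t :: real
    assume xy: "x \<in> {x. (- a) \<bullet> (x - v) + \<kappa> * norm (x - v) \<le> 0}" "y \<in> {x. (- a) \<bullet> (x - v) + \<kappa> * norm (x - v) \<le> 0}"
      and st: "0 \<le> s" "0 \<le> t" "s + t = 1"
    have eq: "s *\<^sub>R x + t *\<^sub>R y - v = s *\<^sub>R (x - v) + t *\<^sub>R (y - v)"
      using st(3) by (simp add: algebra_simps) (metis scaleR_add_left scaleR_one)
    have "norm (s *\<^sub>R x + t *\<^sub>R y - v) \<le> s * norm (x - v) + t * norm (y - v)"
      unfolding eq using norm_triangle_ineq[of "s *\<^sub>R (x - v)" "t *\<^sub>R (y - v)"] st by simp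
    then have "\<kappa> * norm (s *\<^sub>R x + t *\<^sub>R y - v) \<le> \<kappa> * (s * norm (x - v) + t * norm (y - v))"
      using \<open>0 < \<kappa>\<close> by simp
    moreover have "(- a) \<bullet> (s *\<^sub>R x + t *\<^sub>R y - v) = s * ((- a) \<bullet> (x - v)) + t * ((- a) \<bullet> (y - v))"
      unfolding eq by (simp only: inner_add_right inner_scaleR_right)
    moreover have "s * ((- a) \<bullet> (x - v) + \<kappa> * norm (x - v)) + t * ((- a) \<bullet> (y - v) + \<kappa> * norm (y - v)) \<le> 0"
      using add_nonpos_nonpos[OF mult_nonneg_nonpos[OF st(1)] mult_nonneg_nonpos[OF st(2)]] xy by blast
    ultimately show "s *\<^sub>R x + t *\<^sub>R y \<in> {x. (- a) \<bullet> (x - v) + \<kappa> * norm (x - v) \<le> 0}"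
      by (simp add: algebra_simps)
  qed
  moreover have "S \<subseteq> {x. (- a) \<bullet> (x - v) + \<kappa> * norm (x - v) \<le> 0}"
  proof
    fix x assume "x \<in> S"
    show "x \<in> {x. (- a) \<bullet> (x - v) + \<kappa> * norm (x - v) \<le> 0}"
    proof (cases "x = v")
      case False
      then have "b < a \<bullet> x" using \<open>x \<in> S\<close> by (intro ab(2) hull_inc) simp
      moreover have "\<kappa> * norm (x - v) \<le> \<kappa> * r" using r(2)[OF \<open>x \<in> S\<close>] \<open>0 < \<kappa>\<close> by simp
      moreover have "\<kappa> * r = b - a \<bullet> v" using r(1) by (simp add: \<kappa>_def)
      ultimately show ?thesis by (simp add: inner_diff_right)
    qed simp
  qed
  ultimately have "convex hull S \<subseteq> {x. (- a) \<bullet> (x - v) + \<kappa> * norm (x - v) \<le> 0}"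
    by (intro hull_minimal)
  then show thesis using that[OF \<open>0 < \<kappa>\<close>, of "- a"] by blast
qed

text \<open>By the linear rate \<open>\<kappa>\<close>, the functional \<open>a + \<eta>\<close> is still maximal at the vertex for every small \<open>\<eta>\<close>.
  Hence \<open>p\<close> is a critical point of \<open>J \<bullet> (a + \<eta>)\<close> for all these \<open>\<eta>\<close>, and so of every component of \<open>J\<close>;
  since the Kaehler form is nondegenerate, the fundamental fields vanish.\<close>

lemma fund_field_zero_over_vertex:
  assumes N: "kaehler_manifold N" and J: "momentum_map N \<Phi> J"
    and S: "finite S" "J ` kspace N \<subseteq> convex hull S" "J p extreme_point_of (convex hull S)"
    and U: "(U, \<phi>) \<in> charts N" "p \<in> U"
  shows "fund_field \<Phi> \<xi> \<phi> p = 0"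
proof -
  note ch = chart_maps[OF N U(1)]
  obtain D where D: "((J \<circ> inv_into U \<phi>) has_derivative D) (at (\<phi> p))"
    "\<And>\<xi> u. kform N \<phi> p (fund_field \<Phi> \<xi> \<phi> p) u = D u \<bullet> \<xi>"
    using momentum_map_differentiable[OF J U] by metis
  obtain a \<kappa> where a: "0 < \<kappa>" "\<And>x. x \<in> convex hull S \<Longrightarrow> a \<bullet> (x - J p) + \<kappa> * norm (x - J p) \<le> 0"
    using extreme_point_sharp_support[OF S(1,3)] by metis
  have crit: "D u \<bullet> (a + \<eta>) = 0" if "norm \<eta> \<le> \<kappa>" for u \<eta>
  proof -
    have le: "(J \<circ> inv_into U \<phi>) z \<bullet> (a + \<eta>) \<le> (J \<circ> inv_into U \<phi>) (\<phi> p) \<bullet> (a + \<eta>)" if "z \<in> \<phi> ` U" for z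
    proof -
      define y where "y = J (inv_into U \<phi> z)"
      have "inv_into U \<phi> z \<in> kspace N" using inv_into_into[OF that] ch(2) by blast
      then have "y \<in> convex hull S" using S(2) by (auto simp: y_def)
      have "\<eta> \<bullet> (y - J p) \<le> norm \<eta> * norm (y - J p)" by (rule norm_cauchy_schwarz)
      also have "\<dots> \<le> \<kappa> * norm (y - J p)" using \<open>norm \<eta> \<le> \<kappa>\<close> by (rule mult_right_mono) simp
      finally have "(a + \<eta>) \<bullet> (y - J p) \<le> 0"
        using a(2)[OF \<open>y \<in> convex hull S\<close>] by (simp add: inner_add_left)
      then show ?thesis
        using ch(4) U(2) by (simp add: y_def inner_diff_right inner_commute)
    qed
    have "(\<lambda>u. D u \<bullet> (a + \<eta>)) = (\<lambda>u. 0)"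
      by (rule differential_zero_maxmin[OF _ ch(3) has_derivative_inner_left[OF D(1)]])
         (use U(2) le in auto)
    then show ?thesis by meson
  qed
  have "D u = 0" for u
  proof -
    have "norm (\<kappa> *\<^sub>R sgn (D u)) \<le> \<kappa>" using a(1) by (simp add: norm_sgn)
    then have "D u \<bullet> (\<kappa> *\<^sub>R sgn (D u)) = 0"
      using crit[of "\<kappa> *\<^sub>R sgn (D u)" u] crit[of 0 u] a(1) by (simp add: inner_add_right)
    then have "D u \<bullet> D u = 0 \<or> D u = 0" using a(1) by (simp add: sgn_div_norm)
    then show ?thesis by simp
  qed
  then show ?thesis by (intro kform_nondegenerate[OF N U]) (simp add: D(2))
qed

text \<open>The curve \<open>s \<mapsto> \<Phi> (torus_pt (s *\<^sub>R \<xi>)) p\<close> has velocity zero, so in a chart around \<open>p\<close> it is locally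
  constant: the set of times at which it is at \<open>p\<close> is open as well as closed.\<close>

lemma fixed_point_if_fund_field_zero:
  assumes N: "kaehler_manifold N" and act: "kaehler_torus_action N \<Phi>" and p: "p \<in> kspace N"
    and 0: "\<And>t U \<phi>. (U, \<phi>) \<in> charts N \<Longrightarrow> \<Phi> (torus_pt t) p \<in> U \<Longrightarrow>
       fund_field \<Phi> \<xi> \<phi> (\<Phi> (torus_pt t) p) = 0"
  shows "\<Phi> (torus_pt (s *\<^sub>R \<xi>)) p = p"
proof -
  note act_facts = torus_action_facts[OF act]
  have Hd: "Hausdorff_space (ktop N)" using N by (simp add: kaehler_manifold_def)
  define \<gamma> where "\<gamma> = (\<lambda>s. \<Phi> (torus_pt (s *\<^sub>R \<xi>)) p)"
  have \<gamma>_in: "\<gamma> s \<in> kspace N" for s unfolding \<gamma>_def by (rule act_facts(6)[OF p])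
  have \<gamma>: "continuous_map euclidean (ktop N) \<gamma>"
  proof -
    have "continuous_map euclidean euclidean (\<lambda>s. s *\<^sub>R \<xi>)"
      by (simp add: continuous_intros)
    from continuous_map_compose[OF this act_facts(5)[OF p]] show ?thesis by (simp add: o_def \<gamma>_def)
  qed
  define S where "S = {s. \<gamma> s = p}"
  have "closedin euclidean S"
    unfolding S_def using closedin_continuous_maps_eq[OF Hd \<gamma>, of "\<lambda>_. p"] p by simp
  then have "closed S" by simp
  moreover have "open S"
    unfolding open_contains_ball
  proof
    fix s0 assume "s0 \<in> S"
    then have s0: "\<gamma> s0 = p" by (simp add: S_def)
    obtain U \<phi> where U: "(U, \<phi>) \<in> charts N" "p \<in> U" using chart_around N p by metis
    note ch = chart_maps[OF N U(1)]
    have "open {s. \<gamma> s \<in> U}"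
      using openin_continuous_map_preimage[OF \<gamma> ch(1)] by simp
    then obtain e where e: "0 < e" "ball s0 e \<subseteq> {s. \<gamma> s \<in> U}"
      using s0 U(2) open_contains_ball by (metis (mono_tags, lifting) mem_Collect_eq)
    have "((\<phi> \<circ> \<gamma>) has_vector_derivative 0) (at s within ball s0 e)" if "s \<in> ball s0 e" for s
    proof -
      have sU: "\<gamma> s \<in> U" using e(2) that by blast
      define k where "k = (\<lambda>t. \<phi> (\<Phi> (torus_pt (t *\<^sub>R \<xi>)) (\<gamma> s)))"
      define A where "A = (\<lambda>(t, z). \<phi> (\<Phi> (torus_pt t) (inv_into U \<phi> z)))"
      have "smooth_on A {(t, z). z \<in> \<phi> ` U \<and> \<Phi> (torus_pt t) (inv_into U \<phi> z) \<in> U}"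
        using act U(1) unfolding kaehler_torus_action_def A_def by blast
      then have "Ck_on (Suc 0) A {(t, z). z \<in> \<phi> ` U \<and> \<Phi> (torus_pt t) (inv_into U \<phi> z) \<in> U}"
        unfolding smooth_on_def by blast
      then have "\<forall>x\<in>{(t, z). z \<in> \<phi> ` U \<and> \<Phi> (torus_pt t) (inv_into U \<phi> z) \<in> U}. A differentiable (at x)"
        by simp
      moreover have "(0, \<phi> (\<gamma> s)) \<in> {(t, z). z \<in> \<phi> ` U \<and> \<Phi> (torus_pt t) (inv_into U \<phi> z) \<in> U}"
        using sU ch(4) act_facts(1)[OF \<gamma>_in] by simp
      ultimately have "A differentiable (at (0, \<phi> (\<gamma> s)))" by (rule bspec)
      then obtain A' where "(A has_derivative A') (at ((0::real) *\<^sub>R \<xi>, \<phi> (\<gamma> s)))"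
        unfolding differentiable_def by auto
      moreover have "((\<lambda>t::real. (t *\<^sub>R \<xi>, \<phi> (\<gamma> s))) has_derivative (\<lambda>t. (t *\<^sub>R \<xi>, 0))) (at 0)"
        by (auto intro!: derivative_eq_intros)
      ultimately have "((\<lambda>t. A (t *\<^sub>R \<xi>, \<phi> (\<gamma> s))) has_derivative (\<lambda>t. A' (t *\<^sub>R \<xi>, 0))) (at 0)"
        by (rule has_derivative_compose[rotated])
      moreover have "(\<lambda>t. A (t *\<^sub>R \<xi>, \<phi> (\<gamma> s))) = k" using sU ch(4) by (simp add: A_def k_def)
      ultimately have "k differentiable (at 0)" unfolding differentiable_def by auto
      then have "(k has_vector_derivative fund_field \<Phi> \<xi> \<phi> (\<gamma> s)) (at 0)"
        unfolding fund_field_def k_def by (rule vector_derivative_works[THEN iffD1])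
      moreover have "fund_field \<Phi> \<xi> \<phi> (\<gamma> s) = 0"
        unfolding \<gamma>_def by (rule 0[OF U(1)]) (use sU in \<open>simp add: \<gamma>_def\<close>)
      ultimately have "(k has_derivative (\<lambda>_. 0)) (at (s - s))" by (simp add: has_vector_derivative_def)
      then have "((\<lambda>t. k (t - s)) has_derivative (\<lambda>_. 0)) (at s)"
        by (rule has_derivative_compose[rotated]) (auto intro!: derivative_eq_intros)
      moreover have "(\<lambda>t. k (t - s)) = \<phi> \<circ> \<gamma>"
      proof
        fix t
        have "\<gamma> t = \<Phi> (torus_pt ((t - s) *\<^sub>R \<xi>)) (\<gamma> s)"
          unfolding \<gamma>_def using act_facts(2)[OF p, of "(t - s) *\<^sub>R \<xi>" "s *\<^sub>R \<xi>"]
          by (simp add: scaleR_add_left[symmetric])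
        then show "k (t - s) = (\<phi> \<circ> \<gamma>) t" by (simp add: k_def)
      qed
      ultimately show ?thesis by (simp add: has_vector_derivative_def has_derivative_at_withinI)
    qed
    then obtain c where c: "\<And>s. s \<in> ball s0 e \<Longrightarrow> (\<phi> \<circ> \<gamma>) s = c"
      by (rule has_vector_derivative_zero_constant[OF convex_ball]) auto
    have "\<gamma> s = p" if "s \<in> ball s0 e" for s
    proof -
      have "\<phi> (\<gamma> s) = \<phi> p" using c[OF that] c[of s0] e(1) s0 by simp
      then show ?thesis using e(2) that U(2) ch(4) by (blast dest: inj_onD)
    qed
    then show "\<exists>e>0. ball s0 e \<subseteq> S" using e(1) by (auto simp: S_def)
  qed
  ultimately have "S = {} \<or> S = UNIV" using clopen by blast
  moreover have "0 \<in> S" using act_facts(1)[OF p] by (simp add: S_def \<gamma>_def)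
  ultimately have "s \<in> S" by blast
  then show ?thesis by (simp add: S_def \<gamma>_def)
qed

section \<open>The momentum map and the metric on the free locus\<close>

text \<open>The fundamental field of \<open>\<xi>\<close> is \<open>\<i> A \<xi>\<close> in the coordinates \<open>z\<close>, where \<open>A \<xi> = frame_comb e \<xi>\<close>.  The
  Kaehler form rotates it once more, to \<open>- A \<xi>\<close>, which the metric pairs with the real part of \<open>u\<close> only.\<close>

lemma momentum_map_in_tube_coordinates:
  fixes N :: "('a, 'n::finite) kaehler"
  assumes N: "kaehler_manifold N" and J: "momentum_map N \<Phi> J" and cover: "equivariant_cover N \<Phi> h e G"
  obtains D where "((J \<circ> G) has_derivative D) (at z)"
    "\<And>\<xi> u. D u \<bullet> \<xi> = - (frame_comb e \<xi> \<bullet> (h (re_vec z) *v re_vec u))"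
proof -
  note G = equivariant_coverD(1)[OF cover] and act = equivariant_coverD(2)[OF cover]
    and der = equivariant_coverD(3)[OF cover]
  have "G z \<in> kspace N" using continuous_map_image_subset_topspace[OF G] by force
  then obtain V \<psi> where V: "(V, \<psi>) \<in> charts N" "G z \<in> V" using chart_around[OF N] by metis
  note ch = chart_maps[OF N V(1)]
  obtain D where D: "((\<psi> \<circ> G) has_derivative D) (at z)" "\<And>c v. D (c *s v) = c *s D v"
    "\<And>v w. kmetric N \<psi> (G z) (D v) (D w) = dombrowski_metric h z v w"
    using der[OF V] by blast
  obtain D1 where D1: "((J \<circ> inv_into V \<psi>) has_derivative D1) (at (\<psi> (G z)))"
    "\<And>\<xi> u. kform N \<psi> (G z) (fund_field \<Phi> \<xi> \<psi> (G z)) u = D1 u \<bullet> \<xi>"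
    using momentum_map_differentiable[OF J V] by metis
  have "((J \<circ> G) has_derivative (\<lambda>u. D1 (D u))) (at z)"
  proof (rule has_derivative_transform_within_open)
    show "((\<lambda>z. (J \<circ> inv_into V \<psi>) ((\<psi> \<circ> G) z)) has_derivative (\<lambda>u. D1 (D u))) (at z)"
      by (rule has_derivative_compose[OF D(1)]) (simp only: o_apply[of \<psi>] D1(1))
    show "open {z. G z \<in> V}" using openin_continuous_map_preimage[OF G ch(1)] by simp
  qed (use V ch(4) in auto)
  moreover have "D1 (D u) \<bullet> \<xi> = - (frame_comb e \<xi> \<bullet> (h (re_vec z) *v re_vec u))" for u \<xi>
  proof -
    define w where "w = \<i> *s real_emb (frame_comb e \<xi>)"
    have "((\<lambda>t. z + t *\<^sub>R w) has_derivative (\<lambda>t. t *\<^sub>R w)) (at 0)"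
      by (auto intro!: derivative_eq_intros)
    moreover have "((\<psi> \<circ> G) has_derivative D) (at (z + 0 *\<^sub>R w))" using D(1) by simp
    ultimately have "((\<lambda>t. (\<psi> \<circ> G) (z + t *\<^sub>R w)) has_derivative (\<lambda>t. D (t *\<^sub>R w))) (at 0)"
      by (rule has_derivative_compose)
    moreover have "D (t *\<^sub>R w) = t *\<^sub>R D w" for t
      using D(1) has_derivative_linear linear_scale by blast
    moreover have "(\<psi> \<circ> G) (z + t *\<^sub>R w) = \<psi> (\<Phi> (torus_pt (t *\<^sub>R \<xi>)) (G z))" for t
    proof -
      have "t *\<^sub>R w = \<i> *s real_emb (frame_comb e (t *\<^sub>R \<xi>))"
        by (simp add: w_def linear_scale[OF linear_frame_comb] linear_scale[OF linear_real_emb] vec_eq_iff)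
      then show ?thesis by (simp add: act)
    qed
    ultimately have "((\<lambda>t. \<psi> (\<Phi> (torus_pt (t *\<^sub>R \<xi>)) (G z))) has_vector_derivative D w) (at 0)"
      by (simp add: has_vector_derivative_def)
    then have "fund_field \<Phi> \<xi> \<psi> (G z) = D w"
      unfolding fund_field_def by (rule vector_derivative_at)
    then have "D1 (D u) \<bullet> \<xi> = kmetric N \<psi> (G z) (D (\<i> *s w)) (D u)"
      using D1(2)[of \<xi> "D u"] by (simp add: kform_def D(2))
    also have "\<dots> = dombrowski_metric h z (\<i> *s w) u" by (rule D(3))
    also have "\<i> *s w = - real_emb (frame_comb e \<xi>)" by (simp add: w_def vec_eq_iff)
    finally have fin: "D1 (D u) \<bullet> \<xi> = dombrowski_metric h z (- real_emb (frame_comb e \<xi>)) u" .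
    have "re_vec (- real_emb (frame_comb e \<xi>)) = - frame_comb e \<xi>" "im_vec (- real_emb (frame_comb e \<xi>)) = 0"
      by (simp_all add: re_vec_def im_vec_def real_emb_def vec_eq_iff)
    then show ?thesis unfolding fin by (simp add: dombrowski_metric_eq)
  qed
  ultimately show thesis using that by blast
qed

text \<open>Near the fixed point \<open>p\<close> there are free points whose whole orbit under the \<open>k\<close>-th circle stays in a ball
  on which the metric is given by one power series.  The complex line through such a point in the direction
  \<open>e k\<close> therefore has a strip that maps into this ball.  In the chart this is a holomorphic curve of period
  \<open>\<i>\<close>, with squared speed \<open>(log S0)''\<close>, where \<open>S0\<close> is the exponential sum with exponents
  \<open>feature F x \<bullet> e k\<close>.  So \<open>(log S0)''\<close> has period \<open>\<i>/2\<close>, and the phases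
  \<open>exp (\<i> / 2 * (feature F x \<bullet> e k))\<close> do not depend on \<open>x\<close>.\<close>

lemma frame_pairings_differ_by_4pi:
  fixes C :: "'x::finite \<Rightarrow> real" and F :: "'n::finite \<Rightarrow> 'x \<Rightarrow> real" and \<psi> :: "real^'n \<Rightarrow> real"
    and N :: "('a, 'n) kaehler" and e :: "'n \<Rightarrow> real^'n"
  defines "h \<equiv> fisher (exp_family C F \<psi>)"
  assumes norm1: "\<And>\<theta>. (\<Sum>x\<in>UNIV. exp_family C F \<psi> \<theta> $ x) = 1"
    and N: "kaehler_manifold N" and ana: "real_analytic_metric N"
    and action: "kaehler_torus_action N \<Phi>"
    and cover: "equivariant_cover N \<Phi> h e G" and dense: "ktop N closure_of range G = kspace N"
    and p: "p \<in> kspace N" and fixed: "\<And>t. \<Phi> (torus_pt (t *\<^sub>R axis k 1)) p = p"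
  shows "\<exists>n::int. feature F x \<bullet> e k - feature F y \<bullet> e k = 4 * pi * of_int n"
proof -
  note G = equivariant_coverD(1)[OF cover] and act = equivariant_coverD(2)[OF cover]
    and der = equivariant_coverD(3)[OF cover]
  obtain U \<phi> where U: "(U, \<phi>) \<in> charts N" "p \<in> U" using chart_around[OF N p] by metis
  note ch = chart_maps[OF N U(1)]
  define g where "g = (\<lambda>z. kmetric N \<phi> (inv_into U \<phi> z))"
  have "real_analytic_on (\<lambda>z. g z v w) (\<phi> ` U)" for v w
    using ana U(1) unfolding real_analytic_metric_def g_def by blast
  moreover have "\<phi> p \<in> \<phi> ` U" using U(2) by simp
  ultimately obtain r where r: "0 < r" and half_period: "\<And>\<delta> f u. 0 < \<delta> \<Longrightarrow>
       \<forall>j. (\<lambda>\<sigma>. f \<sigma> $ j) holomorphic_on strip \<delta> \<Longrightarrow> \<forall>\<sigma>. f (\<sigma> + \<i>) = f \<sigma> \<Longrightarrow>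
       \<forall>\<sigma>\<in>strip \<delta>. (\<forall>j. norm (f \<sigma> $ j - \<phi> p $ j) \<le> r) \<and> bilinear (g (f \<sigma>)) \<and>
          g (f \<sigma>) (\<chi> j. deriv (\<lambda>\<sigma>. f \<sigma> $ j) \<sigma>) (\<chi> j. deriv (\<lambda>\<sigma>. f \<sigma> $ j) \<sigma>) = u (Re \<sigma>) \<Longrightarrow>
       \<exists>R. R holomorphic_on strip \<delta> \<and>
         (\<forall>s. \<bar>s\<bar> < \<delta> \<longrightarrow> R (of_real s) = of_real (u s) \<and> R (of_real s + \<i> / 2) = of_real (u s))"
    using pullback_metric_half_periodic[of g "\<phi> ` U" "\<phi> p"] by blast
  define Q where "Q = {q \<in> U. \<phi> q \<in> ball (\<phi> p) r}"
  have Q: "openin (ktop N) Q" "p \<in> Q"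
    unfolding Q_def using ch(7)[of "ball (\<phi> p) r"] U(2) r by simp_all
  define rot where "rot = (\<lambda>(t::real, q). \<Phi> (torus_pt (t *\<^sub>R axis k 1)) q)"
  have rot: "continuous_map (prod_topology euclidean (ktop N)) (ktop N) rot"
  proof -
    have "continuous_map (prod_topology euclidean (ktop N)) (prod_topology euclidean (ktop N))
        (\<lambda>x. (fst x *\<^sub>R (axis k 1 :: real^'n), snd x))"
      by (intro continuous_map_pairedI continuous_map_snd continuous_map_compose[OF continuous_map_fst, unfolded o_def])
         (simp_all add: continuous_intros)
    from continuous_map_compose[OF this torus_action_continuous[OF action]]
    show ?thesis by (simp add: o_def rot_def case_prod_unfold)
  qed
  \<comment> \<open>The interval \<open>{0..1}\<close> covers the circle and is compact, so a whole neighbourhood of \<open>p\<close> stays inside \<open>Q\<close>.\<close>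
  define Z where "Z = {x \<in> topspace (prod_topology euclidean (ktop N)). rot x \<in> Q}"
  have Z: "openin (prod_topology euclidean (ktop N)) Z"
    unfolding Z_def by (rule openin_continuous_map_preimage[OF rot Q(1)])
  have sub: "{0..1} \<times> {p} \<subseteq> Z"
    using Q(2) p fixed by (auto simp: rot_def Z_def)
  have cpt: "compactin euclidean {0..1::real}" "compactin (ktop N) {p}" using p by simp_all
  have "\<exists>X V. openin (ktop N) V \<and> p \<in> V \<and> {0..1} \<subseteq> X \<and> X \<times> V \<subseteq> Z"
  proof (rule Wallace_theorem_prod_topology[OF cpt Z sub])
    fix X V assume "openin (ktop N) V" "{0..1} \<subseteq> X" "{p} \<subseteq> V" "X \<times> V \<subseteq> Z"
    then show ?thesis by (intro exI[of _ X] exI[of _ V]) simp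
  qed
  then obtain X V where V: "openin (ktop N) V" "p \<in> V" "{0..1} \<subseteq> X" "X \<times> V \<subseteq> Z"
    by metis
  have VQ: "rot (t, q) \<in> Q" if "q \<in> V" for t q
  proof -
    have "torus_pt (t *\<^sub>R axis k 1) = torus_pt (frac t *\<^sub>R axis k (1::real))"
      unfolding torus_pt_eq_iff by (auto simp: int_vec_def axis_def frac_def algebra_simps)
    then have "rot (t, q) = rot (frac t, q)" by (simp add: rot_def)
    have "frac t \<in> X" using V(3) frac_ge_0[of t] frac_lt_1[of t] by auto
    then have "(frac t, q) \<in> Z" using V(4) that by blast
    then show ?thesis using \<open>rot (t, q) = rot (frac t, q)\<close> by (simp add: Z_def)
  qed
  obtain z1 where z1: "G z1 \<in> V"
  proof -
    have "p \<in> ktop N closure_of range G" using dense p by simp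
    then show thesis using V(1,2) that unfolding in_closure_of by (metis imageE)
  qed
  define w where "w = real_emb (e k)"
  have act_k: "rot (t, G z) = G (z + (\<i> * of_real t) *s w)" for t z
  proof -
    have "frame_comb e (t *\<^sub>R axis k 1) = t *\<^sub>R e k"
      unfolding frame_comb_def by (subst sum.remove[of _ k]) (auto simp: axis_def intro!: sum.neutral)
    moreover have "\<i> *s real_emb (t *\<^sub>R e k) = (\<i> * of_real t) *s w"
      by (simp add: w_def vec_eq_iff real_emb_def)
    ultimately show ?thesis by (simp add: rot_def act)
  qed
  have "continuous_map euclidean (ktop N) (\<lambda>s::real. G (z1 + s *\<^sub>R w))"
  proof -
    have "continuous_map euclidean euclidean (\<lambda>s. z1 + s *\<^sub>R w)" by (simp add: continuous_intros)
    from continuous_map_compose[OF this G] show ?thesis by (simp add: o_def)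
  qed
  from openin_continuous_map_preimage[OF this V(1)]
  have "open {s. G (z1 + s *\<^sub>R w) \<in> V}" by simp
  then obtain \<delta> where \<delta>: "0 < \<delta>" "ball 0 \<delta> \<subseteq> {s. G (z1 + s *\<^sub>R w) \<in> V}"
    using z1 open_contains_ball by (metis (no_types, lifting) add_0_right mem_Collect_eq scaleR_zero_left)
  define \<Gamma> where "\<Gamma> = (\<lambda>\<sigma>. G (z1 + \<sigma> *s w))"
  have \<Gamma>_Q: "\<Gamma> \<sigma> \<in> Q" if "\<sigma> \<in> strip \<delta>" for \<sigma>
  proof -
    have eq: "z1 + \<sigma> *s w = (z1 + Re \<sigma> *\<^sub>R w) + (\<i> * of_real (Im \<sigma>)) *s w"
      by (simp add: vec_eq_iff complex_eq_iff algebra_simps)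
    have "\<Gamma> \<sigma> = rot (Im \<sigma>, G (z1 + Re \<sigma> *\<^sub>R w))" by (simp only: \<Gamma>_def act_k eq)
    moreover have "G (z1 + Re \<sigma> *\<^sub>R w) \<in> V" using \<delta>(2) that by (auto simp: strip_def)
    ultimately show ?thesis using VQ by simp
  qed
  have \<Gamma>_per: "\<Gamma> (\<sigma> + \<i>) = \<Gamma> \<sigma>" for \<sigma>
  proof -
    have "\<Gamma> (\<sigma> + \<i>) = rot (1, \<Gamma> \<sigma>)"
      by (simp add: \<Gamma>_def act_k) (simp add: vec_eq_iff algebra_simps)
    also have "\<dots> = \<Phi> (torus_pt 0) (\<Gamma> \<sigma>)"
    proof -
      have "torus_pt (axis k (1::real)) = torus_pt 0"
        by (simp add: torus_pt_eq_iff int_vec_def axis_def)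
      then show ?thesis by (simp add: rot_def)
    qed
    also have "\<dots> = \<Gamma> \<sigma>"
    proof (rule torus_action_0[OF action])
      show "\<Gamma> \<sigma> \<in> kspace N" using continuous_map_image_subset_topspace[OF G] by (force simp: \<Gamma>_def)
    qed
    finally show ?thesis .
  qed
  define f where "f = (\<lambda>\<sigma>. \<phi> (\<Gamma> \<sigma>))"
  define u where "u = (\<lambda>s. e k \<bullet> (h (re_vec z1 + s *\<^sub>R e k) *v e k))"
  have f_deriv: "\<exists>D. (\<forall>j. ((\<lambda>\<sigma>. f \<sigma> $ j) has_field_derivative D $ j) (at \<sigma>)) \<and> g (f \<sigma>) D D = u (Re \<sigma>)"
    if \<sigma>: "\<sigma> \<in> strip \<delta>" for \<sigma>
  proof -
    have "\<Gamma> \<sigma> \<in> U" using \<Gamma>_Q[OF \<sigma>] by (simp add: Q_def)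
    then obtain D where D: "((\<phi> \<circ> G) has_derivative D) (at (z1 + \<sigma> *s w))" "\<And>c v. D (c *s v) = c *s D v"
      "\<And>v w'. kmetric N \<phi> (\<Gamma> \<sigma>) (D v) (D w') = dombrowski_metric h (z1 + \<sigma> *s w) v w'"
      using der[OF U(1), of "z1 + \<sigma> *s w"] unfolding \<Gamma>_def by blast
    have "((\<lambda>\<sigma>. f \<sigma> $ j) has_field_derivative D w $ j) (at \<sigma>)" for j
      using has_field_derivative_along_line[OF D(1,2), of j] by (simp add: f_def \<Gamma>_def)
    moreover have "g (f \<sigma>) (D w) (D w) = u (Re \<sigma>)"
    proof -
      have "g (f \<sigma>) (D w) (D w) = dombrowski_metric h (z1 + \<sigma> *s w) w w"
        using \<open>\<Gamma> \<sigma> \<in> U\<close> ch(4) D(3) by (simp add: g_def f_def)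
      moreover have "re_vec (z1 + \<sigma> *s w) = re_vec z1 + Re \<sigma> *\<^sub>R e k"
        by (simp add: re_vec_def w_def real_emb_def vec_eq_iff)
      ultimately show ?thesis by (simp add: dombrowski_metric_eq u_def w_def)
    qed
    ultimately show ?thesis by blast
  qed
  obtain R where R: "R holomorphic_on strip \<delta>"
    "\<And>s. \<bar>s\<bar> < \<delta> \<Longrightarrow> R (of_real s) = of_real (u s)"
    "\<And>s. \<bar>s\<bar> < \<delta> \<Longrightarrow> R (of_real s + \<i> / 2) = of_real (u s)"
  proof -
    have "\<exists>R. R holomorphic_on strip \<delta> \<and>
         (\<forall>s. \<bar>s\<bar> < \<delta> \<longrightarrow> R (of_real s) = of_real (u s) \<and> R (of_real s + \<i> / 2) = of_real (u s))"
    proof (rule half_period[OF \<delta>(1)]; intro allI ballI conjI)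
      show "(\<lambda>\<sigma>. f \<sigma> $ j) holomorphic_on strip \<delta>" for j
        unfolding holomorphic_on_open[OF open_strip] using f_deriv by blast
      show "f (\<sigma> + \<i>) = f \<sigma>" for \<sigma> by (simp add: f_def \<Gamma>_per)
      fix \<sigma> assume \<sigma>: "\<sigma> \<in> strip \<delta>"
      show "norm (f \<sigma> $ j - \<phi> p $ j) \<le> r" for j
        using Finite_Cartesian_Product.norm_nth_le[of "f \<sigma> - \<phi> p" j] \<Gamma>_Q[OF \<sigma>]
        by (simp add: Q_def f_def dist_norm norm_minus_commute)
      have "\<Gamma> \<sigma> \<in> U" using \<Gamma>_Q[OF \<sigma>] by (simp add: Q_def)
      then show "bilinear (g (f \<sigma>))"
        using N U(1) ch(4) unfolding kaehler_manifold_def hermitian_metric_def g_def f_def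
        by (auto simp del: split_paired_All)
      obtain D where D: "\<And>j. ((\<lambda>\<sigma>. f \<sigma> $ j) has_field_derivative D $ j) (at \<sigma>)" "g (f \<sigma>) D D = u (Re \<sigma>)"
        using f_deriv[OF \<sigma>] by blast
      have "(\<chi> j. deriv (\<lambda>\<sigma>. f \<sigma> $ j) \<sigma>) = D" using DERIV_imp_deriv[OF D(1)] by (simp add: vec_eq_iff)
      then show "g (f \<sigma>) (\<chi> j. deriv (\<lambda>\<sigma>. f \<sigma> $ j) \<sigma>) (\<chi> j. deriv (\<lambda>\<sigma>. f \<sigma> $ j) \<sigma>) = u (Re \<sigma>)"
        using D(2) by simp
    qed
    then show thesis using that by blast
  qed
  define c where "c = (\<lambda>x. exp (C x + feature F x \<bullet> re_vec z1))"
  define l where "l = (\<lambda>x. feature F x \<bullet> e k)"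
  define S0 where "S0 = exp_sum (\<lambda>x. of_real (c x)) l"
  define S1 where "S1 = exp_sum (\<lambda>x. of_real (l x) * of_real (c x)) l"
  define S2 where "S2 = exp_sum (\<lambda>x. of_real (l x) * (of_real (l x) * of_real (c x))) l"
  \<comment> \<open>\<open>R\<close> is the continuation of \<open>(log S0)''\<close> from the real axis to the strip; \<open>S0\<close> may have zeros there.\<close>
  have on_reals: "of_real (u s) * S0 (of_real s) ^ 2 = S2 (of_real s) * S0 (of_real s) - S1 (of_real s) ^ 2" for s
  proof -
    have S: "S0 (of_real s) = of_real (\<Sum>x\<in>UNIV. (l x) ^ 0 * (c x * exp (l x * s)))"
      "S1 (of_real s) = of_real (\<Sum>x\<in>UNIV. (l x) ^ 1 * (c x * exp (l x * s)))"
      "S2 (of_real s) = of_real (\<Sum>x\<in>UNIV. (l x) ^ 2 * (c x * exp (l x * s)))"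
      by (simp_all add: S0_def S1_def S2_def exp_sum_def exp_of_real[symmetric] power2_eq_square algebra_simps)
    show ?thesis
      using fisher_along_line[OF norm1, where e = "e k" and \<theta> = "re_vec z1" and s = s]
      unfolding S of_real_power[symmetric] of_real_mult[symmetric] of_real_diff[symmetric] of_real_eq_iff
      by (simp only: u_def h_def c_def l_def)
  qed
  have on_strip: "R \<sigma> * S0 \<sigma> ^ 2 = S2 \<sigma> * S0 \<sigma> - S1 \<sigma> ^ 2" if "\<sigma> \<in> strip \<delta>" for \<sigma>
  proof (rule eq_of_eq_on_real_interval[OF _ _ open_strip connected_strip, where a = "-\<delta>" and b = \<delta>
        and f = "\<lambda>\<sigma>. R \<sigma> * S0 \<sigma> ^ 2" and g = "\<lambda>\<sigma>. S2 \<sigma> * S0 \<sigma> - S1 \<sigma> ^ 2"])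
    have hol: "S0 holomorphic_on strip \<delta>" "S1 holomorphic_on strip \<delta>" "S2 holomorphic_on strip \<delta>"
      unfolding S0_def S1_def S2_def by (rule exp_sum_holomorphic)+
    show "(\<lambda>\<sigma>. R \<sigma> * S0 \<sigma> ^ 2) holomorphic_on strip \<delta>"
      "(\<lambda>\<sigma>. S2 \<sigma> * S0 \<sigma> - S1 \<sigma> ^ 2) holomorphic_on strip \<delta>"
      by (intro holomorphic_intros R(1) hol)+
    show "R (of_real s) * S0 (of_real s) ^ 2 = S2 (of_real s) * S0 (of_real s) - S1 (of_real s) ^ 2"
      if "- \<delta> < s" "s < \<delta>" for s
      using R(2)[of s] that on_reals[of s] by simp
  qed (use \<delta>(1) that in auto)
  have "exp (of_real (l x) * (\<i> * (1 / 2))) = exp (of_real (l y) * (\<i> * (1 / 2)))"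
  proof (rule log_hessian_periodic_imp_phases_eq[where c = c and l = l and h = "1 / 2" and \<delta> = \<delta>, folded S0_def S1_def S2_def])
    show "0 < c x" for x by (simp add: c_def)
    show "0 < \<delta>" by (rule \<delta>(1))
    show "(1 / 2 :: complex) \<in> \<real>" by simp
    fix s :: real assume s: "\<bar>s\<bar> < \<delta>"
    have half: "of_real s + \<i> * (1 / 2) = of_real s + \<i> / 2" by simp
    have "S2 (of_real s + \<i> / 2) * S0 (of_real s + \<i> / 2) - S1 (of_real s + \<i> / 2) ^ 2
        = of_real (u s) * S0 (of_real s + \<i> / 2) ^ 2"
      using on_strip[of "of_real s + \<i> / 2"] R(3)[OF s] s by simp
    then show "(S2 (of_real s + \<i> * (1 / 2)) * S0 (of_real s + \<i> * (1 / 2)) - S1 (of_real s + \<i> * (1 / 2)) ^ 2)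
          * S0 (of_real s) ^ 2
        = (S2 (of_real s) * S0 (of_real s) - S1 (of_real s) ^ 2) * S0 (of_real s + \<i> * (1 / 2)) ^ 2"
      unfolding half using on_reals[of s] by (simp add: mult.commute mult.left_commute)
  qed
  then obtain n :: int where n: "of_real (l x) * (\<i> * (1 / 2)) = of_real (l y) * (\<i> * (1 / 2)) + (of_int (2 * n) * pi) * \<i>"
    unfolding exp_eq by blast
  from arg_cong[OF n, of Im] have "l x / 2 = l y / 2 + 2 * of_int n * pi" by simp
  then have "l x - l y = 4 * pi * of_int n" by simp
  then show ?thesis unfolding l_def by blast
qed

section \<open>The momentum polytope\<close>

theorem corollary1p2:
  fixes C :: "'x::finite \<Rightarrow> real" and F :: "'n::finite \<Rightarrow> 'x \<Rightarrow> real" and \<psi> :: "real^'n \<Rightarrow> real"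
    and N :: "('a, 'n) kaehler" and \<Phi> :: "(real^'n) set \<Rightarrow> 'a \<Rightarrow> 'a" and J :: "'a \<Rightarrow> real^'n"
  assumes "lin_indep_with_1 F"
    and "\<And>\<theta>. (\<Sum>x\<in>UNIV. exp_family C F \<psi> \<theta> $ x) = 1"
    and "regular_torification (exp_family C F \<psi>) (fisher (exp_family C F \<psi>)) N \<Phi>"
    and "momentum_map N \<Phi> J"
    and "full_family (range (exp_family C F \<psi>))"
    and "closed_map (ktop N) euclidean J"
  shows "polytope (J ` kspace N) \<and>
    (\<forall>v w. v extreme_point_of (J ` kspace N) \<and> w extreme_point_of (J ` kspace N) \<longrightarrow>
       (\<exists>k\<in>int_vec. v - w = (4 * pi) *\<^sub>R k))"
proof -
  define P where "P = exp_family C F \<psi>"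
  define f where "f = feature F"
  define \<mu> where "\<mu> = mean C F \<psi>"
  note indep = assms(1) and norm1 = assms(2) and J = assms(4)
  have tor: "torification P (fisher P) N \<Phi>" and ana: "real_analytic_metric N"
    using assms(3) by (simp_all add: regular_torification_def P_def)
  then have N: "kaehler_manifold N" "connected_space (ktop N)"
    and action: "kaehler_torus_action N \<Phi>" and eff: "effective N \<Phi>"
    by (simp_all add: torification_def)
  obtain L E T where L: "lattice_generator P E L"
    and T: "kaehler_iso (tube P (fisher P) L) (open_submanifold N (free_locus N \<Phi>)) T"
    "\<And>a c. a \<in> torus \<Longrightarrow> c \<in> kspace (tube P (fisher P) L) \<Longrightarrow> T (tube_action E a c) = \<Phi> a (T c)"
    using tor unfolding torification_def by blast
  have "inj P" unfolding P_def by (rule inj_exp_family[OF norm1 indep])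
  have "free_locus N \<Phi> \<subseteq> kspace N" by (auto simp: free_locus_def)
  obtain e G where cover: "equivariant_cover N \<Phi> (fisher P) e G" and G: "range G = free_locus N \<Phi>"
    using tube_parametrization[OF \<open>inj P\<close> L T \<open>free_locus N \<Phi> \<subseteq> kspace N\<close>] by blast
  have dense: "ktop N closure_of range G = kspace N"
    using free_locus_dense[OF N action eff] G by simp
  define B where "B = (\<lambda>y::real^'n. \<chi> i. y \<bullet> e i)"
  have linB: "linear B"
    unfolding B_def by (intro linearI) (auto simp: vec_eq_iff inner_add_left)
  have adjoint: "frame_comb e t \<bullet> y = B y \<bullet> t" for t y
  proof -
    have "B y \<bullet> t = (\<Sum>i\<in>UNIV. (y \<bullet> e i) * t $ i)" by (simp add: B_def inner_vec_def)
    then show ?thesis by (simp add: frame_comb_def inner_sum_left inner_commute[of y] mult.commute)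
  qed
  \<comment> \<open>The derivative of \<open>\<mu>\<close> is the Fisher matrix, so \<open>J\<close> is an affine function of the mean parameter.\<close>
  have "((\<lambda>z. J (G z) + B (\<mu> (re_vec z))) has_derivative (\<lambda>u. 0)) (at z)" for z
  proof -
    obtain D where D: "((J \<circ> G) has_derivative D) (at z)"
      "\<And>\<xi> u. D u \<bullet> \<xi> = - (frame_comb e \<xi> \<bullet> (fisher P (re_vec z) *v re_vec u))"
      using momentum_map_in_tube_coordinates[OF N(1) J cover, of z] by metis
    have "(re_vec has_derivative re_vec) (at z)"
      by (rule bounded_linear_imp_has_derivative) (use linear_re_vec in \<open>simp add: linear_conv_bounded_linear\<close>)
    moreover have "(\<mu> has_derivative (\<lambda>v. fisher P (re_vec z) *v v)) (at (re_vec z))"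
      unfolding \<mu>_def P_def by (rule mean_has_derivative[OF norm1])
    ultimately have "((\<lambda>z. \<mu> (re_vec z)) has_derivative (\<lambda>u. fisher P (re_vec z) *v re_vec u)) (at z)"
      by (rule has_derivative_compose)
    then have "((\<lambda>z. B (\<mu> (re_vec z))) has_derivative (\<lambda>u. B (fisher P (re_vec z) *v re_vec u))) (at z)"
      by (rule bounded_linear.has_derivative[rotated]) (use linB in \<open>simp add: linear_conv_bounded_linear\<close>)
    from has_derivative_add[OF D(1) this]
    have "((\<lambda>z. J (G z) + B (\<mu> (re_vec z))) has_derivative (\<lambda>u. D u + B (fisher P (re_vec z) *v re_vec u))) (at z)"
      by (simp add: o_def)
    moreover have "D u + B (fisher P (re_vec z) *v re_vec u) = 0" for u
    proof -
      have "(D u + B (fisher P (re_vec z) *v re_vec u)) \<bullet> \<xi> = 0" for \<xi>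
        by (simp add: inner_add_left D(2) adjoint)
      then show ?thesis by (metis inner_eq_zero_iff)
    qed
    ultimately show ?thesis by simp
  qed
  then have "\<exists>b. \<forall>z\<in>UNIV. J (G z) + B (\<mu> (re_vec z)) = b"
    by (intro has_derivative_zero_constant[of UNIV "\<lambda>z. J (G z) + B (\<mu> (re_vec z))"]) simp_all
  then obtain b where b: "\<And>z. J (G z) + B (\<mu> (re_vec z)) = b" by blast
  define \<tau> where "\<tau> = (\<lambda>y. b - B y)"
  have JG: "J (G z) = \<tau> (\<mu> (re_vec z))" for z
    using b[of z] by (simp add: \<tau>_def algebra_simps)
  have J_range: "J ` range G = \<tau> ` range \<mu>"
  proof -
    have "surj (re_vec :: complex^'n \<Rightarrow> real^'n)" by (rule surjI[of _ real_emb]) simp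
    then have "\<tau> ` range \<mu> = \<tau> ` \<mu> ` range (re_vec :: complex^'n \<Rightarrow> real^'n)" by simp
    also have "\<dots> = J ` range G" by (simp only: image_image JG)
    finally show ?thesis by simp
  qed
  have cont_\<tau>: "continuous_on X \<tau>" for X
    unfolding \<tau>_def using linB
    by (intro continuous_intros linear_continuous_on) (simp add: linear_conv_bounded_linear)
  have hull: "convex hull (\<tau> ` range f) = \<tau> ` (convex hull (range f))"
  proof -
    have "\<tau> ` X = (\<lambda>y. b + y) ` (\<lambda>y. - B y) ` X" for X by (simp add: image_image \<tau>_def)
    moreover have "linear (\<lambda>y. - B y)" using linB by (rule linear_compose_neg)
    ultimately show ?thesis
      by (simp only: convex_hull_translation convex_hull_linear_image[symmetric])
  qed
  have image: "J ` kspace N = convex hull (\<tau> ` range f)"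
  proof (rule subset_antisym)
    have "compact (convex hull (\<tau> ` range f))"
      by (intro compact_convex_hull finite_imp_compact) simp
    then have "closed (convex hull (\<tau> ` range f))" by (rule compact_imp_closed)
    moreover have "J ` range G \<subseteq> convex hull (\<tau> ` range f)"
      unfolding J_range hull using mean_in_convex_hull[OF norm1] by (auto simp: \<mu>_def f_def)
    ultimately have "closure (J ` range G) \<subseteq> convex hull (\<tau> ` range f)"
      by (rule closure_minimal[rotated])
    moreover have "J ` kspace N \<subseteq> closure (J ` range G)"
      using continuous_map_image_closure_subset[OF momentum_map_continuous[OF N(1) J], of "range G"] dense
      by simp
    ultimately show "J ` kspace N \<subseteq> convex hull (\<tau> ` range f)" by blast
  next
    have "closedin euclidean (J ` kspace N)"
      using assms(6) unfolding closed_map_def by blast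
    then have "closed (J ` kspace N)" by simp
    moreover have "\<tau> ` range \<mu> \<subseteq> J ` kspace N"
      unfolding J_range[symmetric] using G \<open>free_locus N \<Phi> \<subseteq> kspace N\<close> by blast
    ultimately have "\<tau> ` closure (range \<mu>) \<subseteq> J ` kspace N"
      by (intro image_closure_subset[OF cont_\<tau>])
    moreover have "closure (range \<mu>) = convex hull (range f)"
      unfolding \<mu>_def f_def by (rule closure_range_mean[OF norm1 indep])
    ultimately show "convex hull (\<tau> ` range f) \<subseteq> J ` kspace N" by (simp add: hull)
  qed
  have vertices: "\<exists>k\<in>int_vec. v - w = (4 * pi) *\<^sub>R k"
    if v: "v extreme_point_of (J ` kspace N)" and w: "w extreme_point_of (J ` kspace N)" for v w
  proof -
    obtain x y where xy: "v = \<tau> (f x)" "w = \<tau> (f y)"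
      using v w unfolding image by (blast dest: extreme_point_of_convex_hull)
    have "v \<in> J ` kspace N" using v by (simp add: extreme_point_of_def)
    then obtain p where p: "p \<in> kspace N" "J p = v" by blast
    have fixed: "\<Phi> (torus_pt (t *\<^sub>R \<xi>)) p = p" for t \<xi>
    proof (rule fixed_point_if_fund_field_zero[OF N(1) action p(1)])
      fix s U \<phi> assume U: "(U, \<phi>) \<in> charts N" "\<Phi> (torus_pt s) p \<in> U"
      have "J (\<Phi> (torus_pt s) p) = v"
        using J p unfolding momentum_map_def torus_def by blast
      then show "fund_field \<Phi> \<xi> \<phi> (\<Phi> (torus_pt s) p) = 0"
        using v image by (intro fund_field_zero_over_vertex[OF N(1) J _ _ _ U, of "\<tau> ` range f"]) auto
    qed
    have "\<exists>n::int. f y \<bullet> e i - f x \<bullet> e i = 4 * pi * of_int n" for i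
      unfolding f_def
      by (rule frame_pairings_differ_by_4pi[OF norm1 N(1) ana action cover[unfolded P_def] dense p(1) fixed])
    then obtain n where n: "\<And>i. f y \<bullet> e i - f x \<bullet> e i = 4 * pi * of_int (n i :: int)" by metis
    define k :: "real^'n" where "k = (\<chi> i. of_int (n i))"
    have "v - w = (4 * pi) *\<^sub>R k"
      using n by (simp add: xy \<tau>_def B_def k_def vec_eq_iff)
    moreover have "k \<in> int_vec" by (simp add: k_def int_vec_def)
    ultimately show ?thesis by blast
  qed
  have "polytope (J ` kspace N)"
    unfolding polytope_def image by (intro exI[of _ "\<tau> ` range f"]) simp
  then show ?thesis using vertices by blast
qed

end
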